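(* Let $(K_n)_{n\in\mathbb{N}}$ be a sequence of convex bodies with $K_n\subseteq\mathbb{R}^n$, and let $\mu_{K_n}$ denote the uniform probability measure on $K_n$. Assume that $$\lim_{n\to\infty}\frac1n\,\mathbb{E}_{\mu_{K_n}}\left[I_{K_n}\right]=+\infty.$$ Then the sequence $(\mu_{K_n})_{n\in\mathbb{N}}$ exhibits a sharp threshold around $\left(\mathbb{E}_{\mu_{K_n}}[\Lambda_{K_n}^*]\right)_{n\in\mathbb{N}}$.
   Context: A convex body in $\mathbb{R}^n$ is a compact convex set with non-empty interior. For a convex body $K$: $\Lambda_K^*(x)=\sup_{\theta\in\mathbb{R}^n}\{\langle\theta,x\rangle-\log\int e^{\langle\theta,y\rangle}\,d\mu_K(y)\}$ (Cramér transform), $q_K(x)=\inf\{\mu_K(H):H\text{ a closed half-space containing }x\}$ (Tukey half-space depth), and $I_K(x)=-\log q_K(x)$. Sharp threshold: given a Borel probability measure $\mu$ on $\mathbb{R}^n$, for a positive integer $N$ let $P_N=\operatorname{conv}\{X_1,\ldots,X_N\}$ with $X_1,\ldots,X_N$ independent with law $\mu$, and let $\mathbb{E}_{\mu^N}$ be the expectation over $(X_1,\ldots,X_N)$. For $\delta>0$ set $$\varrho_1(\mu,\delta)=\sup\{r>0:\mathbb{E}_{\mu^N}[\mu(P_N)]\leq\delta\text{ for every }N\leq e^r\},\qquad \varrho_2(\mu,\delta)=\inf\{r>0:\mathbb{E}_{\mu^N}[\mu(P_N)]\geq1-\delta\text{ for every }N\geq e^r\}.$$ A sequence $(\mu_n)$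 of probability measures $\mu_n$ on $\mathbb{R}^n$ exhibits a sharp threshold around a sequence $(T_n)$ of positive numbers if there is a sequence $(\delta_n)$ of positive numbers with $\delta_n\to0$ such that for every $\varepsilon\in(0,1)$ there is $n_0(\varepsilon)$ with $\varrho_1(\mu_n,\delta_n)\geq(1-\varepsilon)T_n$ and $\varrho_2(\mu_n,\delta_n)\leq(1+\varepsilon)T_n$ for all $n\geq n_0(\varepsilon)$. *)

theory Defs
  imports "HOL-Probability.Probability"
begin

text \<open>
  The dimension varies along the sequence, so \<open>R\<^sup>n\<close> cannot be a type. It is rendered as the
  set of functions \<open>nat \<Rightarrow> real\<close> that are \<open>undefined\<close> outside \<open>{..<n}\<close>: this is both the
  topspace of \<open>product_topology (\<lambda>_. euclideanreal) {..<n}\<close> and the space of Lebesgue measure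
  \<open>PiM {..<n} (\<lambda>_. lborel)\<close>.
\<close>

abbreviation Rn :: "nat \<Rightarrow> (nat \<Rightarrow> real) set" where
  "Rn n \<equiv> {..<n} \<rightarrow>\<^sub>E UNIV"

abbreviation Rn_topology :: "nat \<Rightarrow> (nat \<Rightarrow> real) topology" where
  "Rn_topology n \<equiv> product_topology (\<lambda>_. euclideanreal) {..<n}"

abbreviation Rn_lborel :: "nat \<Rightarrow> (nat \<Rightarrow> real) measure" where
  "Rn_lborel n \<equiv> PiM {..<n} (\<lambda>_. lborel)"

definition Rn_inner :: "nat \<Rightarrow> (nat \<Rightarrow> real) \<Rightarrow> (nat \<Rightarrow> real) \<Rightarrow> real" where
  "Rn_inner n x y = (\<Sum>i<n. x i * y i)"

definition Rn_convex :: "nat \<Rightarrow> (nat \<Rightarrow> real) set \<Rightarrow> bool" where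
  "Rn_convex n C \<longleftrightarrow> C \<subseteq> Rn n \<and>
     (\<forall>x\<in>C. \<forall>y\<in>C. \<forall>u\<ge>0. \<forall>v\<ge>0. u + v = 1 \<longrightarrow> (\<lambda>i\<in>{..<n}. u * x i + v * y i) \<in> C)"

definition convex_body :: "nat \<Rightarrow> (nat \<Rightarrow> real) set \<Rightarrow> bool" where
  "convex_body n K \<longleftrightarrow>
     Rn_convex n K \<and> compactin (Rn_topology n) K \<and> Rn_topology n interior_of K \<noteq> {}"

definition unif :: "nat \<Rightarrow> (nat \<Rightarrow> real) set \<Rightarrow> (nat \<Rightarrow> real) measure" where
  "unif n K = uniform_measure (Rn_lborel n) K"

text \<open>
  The value \<open>\<infinity>\<close> is attained outside \<open>K\<close>. Taking \<open>\<theta> = 0\<close> shows that the transform is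
  nonnegative when \<open>K\<close> is a convex body; the exponential integral is then finite and positive,
  as \<open>K\<close> is bounded.
\<close>

definition cramer_transform :: "nat \<Rightarrow> (nat \<Rightarrow> real) set \<Rightarrow> (nat \<Rightarrow> real) \<Rightarrow> ereal" where
  "cramer_transform n K x =
     (SUP \<theta>\<in>Rn n. ereal (Rn_inner n \<theta> x - ln (\<integral>y. exp (Rn_inner n \<theta> y) \<partial>unif n K)))"

definition closed_halfspace :: "nat \<Rightarrow> (nat \<Rightarrow> real) set \<Rightarrow> bool" where
  "closed_halfspace n H \<longleftrightarrow>
     (\<exists>\<theta>\<in>Rn n. \<exists>b. (\<exists>i<n. \<theta> i \<noteq> 0) \<and> H = {y \<in> Rn n. Rn_inner n \<theta> y \<le> b})"

definition tukey_depth :: "nat \<Rightarrow> (nat \<Rightarrow> real) set \<Rightarrow> (nat \<Rightarrow> real) \<Rightarrow> real" where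
  "tukey_depth n K x = Inf {measure (unif n K) H | H. closed_halfspace n H \<and> x \<in> H}"

text \<open>\<open>- log q\<^sub>K\<close>, with \<open>- log 0 = \<infinity>\<close>; nonnegative because the depth is at most 1.\<close>

definition neg_log_depth :: "nat \<Rightarrow> (nat \<Rightarrow> real) set \<Rightarrow> (nat \<Rightarrow> real) \<Rightarrow> ereal" where
  "neg_log_depth n K x =
     (if tukey_depth n K x = 0 then \<infinity> else ereal (- ln (tukey_depth n K x)))"

text \<open>
  Expectation under \<open>\<mu>\<^sub>K\<close>, with values in \<open>[0,\<infinity>]\<close>; only applied to the two nonnegative
  functions above, where \<open>e2ennreal\<close> does not truncate.
\<close>

definition expect :: "nat \<Rightarrow> (nat \<Rightarrow> real) set \<Rightarrow> ((nat \<Rightarrow> real) \<Rightarrow> ereal) \<Rightarrow> ennreal" where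
  "expect n K f = (\<integral>\<^sup>+ x. e2ennreal (f x) \<partial>unif n K)"

definition expected_hull_measure :: "nat \<Rightarrow> (nat \<Rightarrow> real) measure \<Rightarrow> nat \<Rightarrow> real" where
  "expected_hull_measure n \<mu> N =
     (\<integral>X. measure \<mu> (Rn_convex n hull (X ` {..<N})) \<partial>PiM {..<N} (\<lambda>_. \<mu>))"

text \<open>The thresholds are extended reals: the set may be unbounded (sup) or empty (inf).\<close>

definition rho1 :: "nat \<Rightarrow> (nat \<Rightarrow> real) measure \<Rightarrow> real \<Rightarrow> ereal" where
  "rho1 n \<mu> \<delta> = Sup (ereal ` {r. r > 0 \<and>
     (\<forall>N\<ge>1. real N \<le> exp r \<longrightarrow> expected_hull_measure n \<mu> N \<le> \<delta>)})"

definition rho2 :: "nat \<Rightarrow> (nat \<Rightarrow> real) measure \<Rightarrow> real \<Rightarrow> ereal" where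
  "rho2 n \<mu> \<delta> = Inf (ereal ` {r. r > 0 \<and>
     (\<forall>N\<ge>1. real N \<ge> exp r \<longrightarrow> expected_hull_measure n \<mu> N \<ge> 1 - \<delta>)})"

text \<open>
  Sequences are indexed by the dimensions \<open>n \<ge> 1\<close>; the entry at \<open>0\<close> is irrelevant. The first
  two conjuncts say that \<open>\<mu> n\<close> is a Borel probability measure on \<open>R\<^sup>n\<close> and that the \<open>T n\<close> are
  positive numbers; for \<open>T n = enn2real t\<close> positivity entails \<open>t < \<infinity>\<close>.
\<close>

definition sharp_threshold :: "(nat \<Rightarrow> (nat \<Rightarrow> real) measure) \<Rightarrow> (nat \<Rightarrow> real) \<Rightarrow> bool" where
  "sharp_threshold \<mu> T \<longleftrightarrow>
     (\<forall>n\<ge>1. prob_space (\<mu> n) \<and> sets (\<mu> n) = sets (PiM {..<n} (\<lambda>_. borel))) \<and>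
     (\<forall>n\<ge>1. T n > 0) \<and>
     (\<exists>\<delta> :: nat \<Rightarrow> real. (\<forall>n\<ge>1. \<delta> n > 0) \<and> \<delta> \<longlonglongrightarrow> 0 \<and>
       (\<forall>\<epsilon>::real. 0 < \<epsilon> \<and> \<epsilon> < 1 \<longrightarrow>
         (\<exists>n0\<ge>1. \<forall>n\<ge>n0.
            rho1 n (\<mu> n) (\<delta> n) \<ge> ereal ((1 - \<epsilon>) * T n) \<and>
            rho2 n (\<mu> n) (\<delta> n) \<le> ereal ((1 + \<epsilon>) * T n))))"

end

theory Submission
  imports Defs
begin
text \<open>
  Fix a convex body \<open>K\<close> in dimension \<open>n\<close> with uniform measure \<open>\<mu>\<close>, let \<open>q\<close> be the half-space
  depth, \<open>I = - ln q\<close>, \<open>s0\<close> a median of \<open>q\<close> and \<open>m = - ln s0\<close>. The number \<open>m\<close> is compared with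
  everything else; the theorem follows because \<open>I\<close>, the Cramer transform and the threshold all
  sit at \<open>m\<close>, up to errors that are negligible once \<open>m\<close> is much larger than \<open>n\<close>.

  Concentration of \<open>I\<close>. If \<open>x\<close> and \<open>y\<close> lie in \<open>K\<close>, then \<open>q (u x + (1 - u) y) \<ge> u\<^sup>n q x\<close>: contract
  towards \<open>y\<close>, by the factor \<open>u\<close>, the part of \<open>K\<close> that a half-space cuts off at \<open>x\<close>
  (\<open>depth_homothety\<close>). Since \<open>\<mu>\<close> is log-concave by the Brunn--Minkowski inequality, the function
  \<open>F s = \<mu> {q \<ge> s}\<close> satisfies \<open>F (u\<^sup>n s) \<ge> F s powr u\<close> (\<open>measure_deep_powr\<close>). Hence \<open>I\<close> differs from
  \<open>m\<close> by more than \<open>n a\<close> with a probability that vanishes as \<open>a\<close> grows, at a rate depending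
  neither on \<open>n\<close> nor on \<open>K\<close>. In particular the mean of \<open>I\<close> is at most \<open>m + C n\<close> for an absolute
  constant \<open>C\<close>, so that the hypothesis forces \<open>m / n\<close> to tend to infinity.

  The Cramer transform. By Markov's inequality it is at most \<open>I\<close>. Conversely, the distribution
  function of a linear functional under \<open>\<mu>\<close> is log-concave, and therefore decays exponentially
  beyond each of its points, at the rate given by a tangent; the exponential moment at \<open>c < 1\<close>
  times this rate shows that the transform is at least \<open>c I\<close> minus a constant depending on \<open>c\<close>
  alone (\<open>cramer_ge_neg_log_depth\<close>). So the mean of the transform is asymptotic to \<open>m\<close>.

  Random polytopes. If \<open>x\<close> lies in the polytope \<open>P\<close> spanned by \<open>N\<close> samples, then every half-space
  that contains \<open>x\<close> contains a sample, whence \<open>x \<in> P\<close> has probability at most \<open>N q x\<close>. If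
  \<open>x \<notin> P\<close>, the point of \<open>P\<close> nearest to \<open>x\<close> is a convex combination of at most \<open>n + 1\<close> samples, by
  Caratheodory's theorem, and all remaining samples avoid a half-space that contains \<open>x\<close> and is
  determined by these few. So \<open>x \<notin> P\<close> has probability at most
  \<open>N ^ (n + 1) * (1 - q x) ^ (N - (n + 1))\<close> (\<open>miss_probability_le\<close>). The first bound is small when
  \<open>ln N \<le> (1 - \<epsilon>) m\<close> and the second one when \<open>ln N \<ge> (1 + \<epsilon>) m\<close>, for all typical \<open>x\<close>. This settles
  every fixed \<open>\<delta>\<close>; a diagonal choice turns it into one sequence tending to \<open>0\<close>.
\<close>

section \<open>Brunn--Minkowski and Prekopa--Leindler on the line\<close>

lemma emeasure_affine_vimage:
  fixes A :: "real set"
  assumes "A \<in> sets borel" "u > 0"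
  shows "emeasure lborel {z. (z - d) / u \<in> A} = ennreal u * emeasure lborel A"
proof -
  have m: "{z. (z - d) / u \<in> A} \<in> sets borel"
    using measurable_sets_borel[of "\<lambda>z. (z - d) / u" borel A] assms by (simp add: vimage_def)
  have "emeasure lborel {z. (z - d) / u \<in> A} = (\<integral>\<^sup>+z. indicator {z. (z - d) / u \<in> A} z \<partial>lborel)"
    using m by simp
  also have "\<dots> = ennreal \<bar>u\<bar> * (\<integral>\<^sup>+z. indicator {z. (z - d) / u \<in> A} (d + u * z) \<partial>lborel)"
    using assms m by (intro nn_integral_real_affine) auto
  also have "(\<lambda>z. indicator {z. (z - d) / u \<in> A} (d + u * z)) = (indicator A :: real \<Rightarrow> ennreal)"
    using assms by (auto simp: indicator_def)
  finally show ?thesis using assms by simp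
qed

text \<open>
  Choose \<open>a \<in> A\<close> close to the supremum of \<open>A\<close> and \<open>b \<in> B\<close> close to the infimum of \<open>B\<close>. Then \<open>C\<close>
  contains a copy of \<open>u A\<close> to the left of \<open>u a + v b\<close> and a copy of \<open>v B\<close> to its right, and these
  are disjoint.
\<close>

lemma brunn_minkowski_real:
  fixes A B C :: "real set"
  assumes [measurable]: "A \<in> sets borel" "B \<in> sets borel" "C \<in> sets borel"
    and ne: "A \<noteq> {}" "B \<noteq> {}" and bdd: "bdd_above A" "bdd_below B"
    and uv: "u > 0" "v > 0"
    and sub: "\<And>a b. a \<in> A \<Longrightarrow> b \<in> B \<Longrightarrow> u * a + v * b \<in> C"
  shows "ennreal u * emeasure lborel A + ennreal v * emeasure lborel B \<le> emeasure lborel C"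
proof (rule ennreal_le_epsilon)
  fix e :: real assume e: "e > 0"
  define e' where "e' = e / (u + v)"
  have e': "e' > 0" using e uv by (simp add: e'_def)
  obtain a where a: "a \<in> A" "Sup A - e' < a"
    using less_cSup_iff[OF ne(1) bdd(1), of "Sup A - e'"] e' by auto
  obtain b where b: "b \<in> B" "b < Inf B + e'"
    using cInf_less_iff[OF ne(2) bdd(2), of "Inf B + e'"] e' by auto
  define C1 where "C1 = {z. (z - v * b) / u \<in> A \<inter> {..<a}}"
  define C2 where "C2 = {z. (z - u * a) / v \<in> B \<inter> {b..}}"
  have mC: "C1 \<in> sets borel" "C2 \<in> sets borel" unfolding C1_def C2_def
    using measurable_sets_borel[of "\<lambda>z. (z - v * b) / u" borel "A \<inter> {..<a}"]
          measurable_sets_borel[of "\<lambda>z. (z - u * a) / v" borel "B \<inter> {b..}"]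
    by (simp_all add: vimage_def)
  have C1: "emeasure lborel C1 = ennreal u * emeasure lborel (A \<inter> {..<a})"
    unfolding C1_def using uv by (intro emeasure_affine_vimage) auto
  have C2: "emeasure lborel C2 = ennreal v * emeasure lborel (B \<inter> {b..})"
    unfolding C2_def using uv by (intro emeasure_affine_vimage) auto
  have "C1 \<subseteq> C"
  proof
    fix z assume "z \<in> C1"
    then have "u * ((z - v * b) / u) + v * b \<in> C" using sub b by (simp add: C1_def del: times_divide_eq_right)
    then show "z \<in> C" using uv by simp
  qed
  moreover have "C2 \<subseteq> C"
  proof
    fix z assume "z \<in> C2"
    then have "u * a + v * ((z - u * a) / v) \<in> C" using sub a by (simp add: C2_def del: times_divide_eq_right)
    then show "z \<in> C" using uv by simp
  qed
  moreover have "C1 \<inter> C2 = {}"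
    using uv by (auto simp: C1_def C2_def field_simps)
  ultimately have "emeasure lborel C1 + emeasure lborel C2 \<le> emeasure lborel C"
    using mC by (subst plus_emeasure) (auto intro!: emeasure_mono)
  moreover have "emeasure lborel A \<le> emeasure lborel (A \<inter> {..<a}) + ennreal e'"
  proof -
    have "A \<subseteq> (A \<inter> {..<a}) \<union> {a..Sup A}" using bdd(1) by (auto intro: cSup_upper)
    then have "emeasure lborel A \<le> emeasure lborel ((A \<inter> {..<a}) \<union> {a..Sup A})"
      by (intro emeasure_mono) auto
    also have "\<dots> \<le> emeasure lborel (A \<inter> {..<a}) + emeasure lborel {a..Sup A}"
      by (intro emeasure_subadditive) auto
    also have "emeasure lborel {a..Sup A} \<le> ennreal e'"
      using a cSup_upper[OF a(1) bdd(1)] by (auto intro!: ennreal_leI)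
    finally show ?thesis by simp
  qed
  moreover have "emeasure lborel B \<le> emeasure lborel (B \<inter> {b..}) + ennreal e'"
  proof -
    have "B \<subseteq> (B \<inter> {b..}) \<union> {Inf B..b}" using bdd(2) by (auto intro: cInf_lower)
    then have "emeasure lborel B \<le> emeasure lborel ((B \<inter> {b..}) \<union> {Inf B..b})"
      by (intro emeasure_mono) auto
    also have "\<dots> \<le> emeasure lborel (B \<inter> {b..}) + emeasure lborel {Inf B..b}"
      by (intro emeasure_subadditive) auto
    also have "emeasure lborel {Inf B..b} \<le> ennreal e'"
      using b cInf_lower[OF b(1) bdd(2)] by (auto intro!: ennreal_leI)
    finally show ?thesis by simp
  qed
  ultimately have "ennreal u * emeasure lborel A + ennreal v * emeasure lborel B \<le>
      ennreal u * (emeasure lborel (A \<inter> {..<a}) + ennreal e') +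
      ennreal v * (emeasure lborel (B \<inter> {b..}) + ennreal e')"
    by (intro add_mono mult_left_mono) auto
  also have "\<dots> = (emeasure lborel C1 + emeasure lborel C2) + (ennreal u * ennreal e' + ennreal v * ennreal e')"
    by (simp add: C1 C2 algebra_simps)
  also have "ennreal u * ennreal e' + ennreal v * ennreal e' = ennreal e"
  proof -
    have "u * e' + v * e' = e" using uv by (simp only: e'_def flip: distrib_right) simp
    then show ?thesis using uv e' by (simp flip: ennreal_mult ennreal_plus)
  qed
  also have "(emeasure lborel C1 + emeasure lborel C2) + ennreal e \<le> emeasure lborel C + ennreal e"
    using \<open>emeasure lborel C1 + emeasure lborel C2 \<le> emeasure lborel C\<close> by (rule add_right_mono)
  finally show "ennreal u * emeasure lborel A + ennreal v * emeasure lborel B \<le> emeasure lborel C + ennreal e" .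
qed

text \<open>
  The layer-cake formula, restricted to levels below \<open>c\<close> and normalised to the unit interval. For
  \<open>c\<close> a bound of \<open>f\<close> the truncation is void.
\<close>

lemma nn_integral_truncated_layers:
  fixes f :: "real \<Rightarrow> real"
  assumes [measurable]: "f \<in> borel_measurable borel" and f: "\<And>x. 0 \<le> f x" and c: "c > 0"
  shows "(\<integral>\<^sup>+z. indicator {0<..<1} z * emeasure lborel {x. c * z < f x} \<partial>lborel)
       = (\<integral>\<^sup>+x. ennreal (min 1 (f x / c)) \<partial>lborel)"
proof -
  have "(\<integral>\<^sup>+z. indicator {0<..<1} z * emeasure lborel {x. c * z < f x} \<partial>lborel)
      = (\<integral>\<^sup>+z. (\<integral>\<^sup>+x. indicator {0<..<1} z * indicator {x. c * z < f x} x \<partial>lborel) \<partial>lborel)"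
    by (intro nn_integral_cong) (simp add: nn_integral_cmult)
  also have "\<dots> = (\<integral>\<^sup>+x. (\<integral>\<^sup>+z. indicator {0<..<1} z * indicator {x. c * z < f x} x \<partial>lborel) \<partial>lborel)"
    by (rule lborel_pair.Fubini') measurable
  also have "\<dots> = (\<integral>\<^sup>+x. ennreal (min 1 (f x / c)) \<partial>lborel)"
  proof (rule nn_integral_cong)
    fix x :: real
    have "(\<integral>\<^sup>+z. indicator {0<..<1} z * indicator {x. c * z < f x} x \<partial>lborel)
        = (\<integral>\<^sup>+z. indicator {0<..<min 1 (f x / c)} z \<partial>lborel)"
      using c by (intro nn_integral_cong) (auto simp: indicator_def field_simps)
    also have "\<dots> = ennreal (min 1 (f x / c))" using f[of x] c by simp
    finally show "(\<integral>\<^sup>+z. indicator {0<..<1} z * indicator {x. c * z < f x} x \<partial>lborel)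
        = ennreal (min 1 (f x / c))" .
  qed
  finally show ?thesis .
qed

text \<open>
  After division by their suprema, \<open>f\<close> and \<open>g\<close> have non-empty superlevel sets at every level below
  \<open>1\<close>, so the inequality for sets applies to each level. Integration over the levels gives an
  arithmetic mean of the two normalised integrals, which dominates their geometric mean.
\<close>

lemma prekopa_leindler_real:
  fixes f g h :: "real \<Rightarrow> real"
  assumes [measurable]: "f \<in> borel_measurable borel" "g \<in> borel_measurable borel" "h \<in> borel_measurable borel"
    and nn: "\<And>x. 0 \<le> f x" "\<And>x. 0 \<le> g x" "\<And>x. 0 \<le> h x"
    and bd: "\<And>x. f x \<le> M" "\<And>x. g x \<le> M"
    and supp: "\<And>x. f x \<noteq> 0 \<Longrightarrow> \<bar>x\<bar> \<le> R" "\<And>x. g x \<noteq> 0 \<Longrightarrow> \<bar>x\<bar> \<le> R"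
    and uv: "u > 0" "v > 0" "u + v = 1"
    and le: "\<And>x y. f x powr u * g y powr v \<le> h (u * x + v * y)"
  shows "ennreal (enn2real (\<integral>\<^sup>+x. f x \<partial>lborel) powr u * enn2real (\<integral>\<^sup>+x. g x \<partial>lborel) powr v)
    \<le> (\<integral>\<^sup>+x. h x \<partial>lborel)"
proof (cases "(\<forall>x. f x = 0) \<or> (\<forall>x. g x = 0)")
  case True
  then show ?thesis by auto
next
  case False
  then obtain x0 y0 where xy0: "f x0 > 0" "g y0 > 0" using nn by (metis order_le_less)
  define a where "a = Sup (range f)"
  define b where "b = Sup (range g)"
  have bdd: "bdd_above (range f)" "bdd_above (range g)" using bd by (auto intro!: bdd_aboveI)
  have fa: "f x \<le> a" and gb: "g x \<le> b" for x
    unfolding a_def b_def using bdd by (auto intro!: cSup_upper)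
  have a: "a > 0" and b: "b > 0" using xy0 fa[of x0] gb[of y0] by auto
  define c where "c = a powr u * b powr v"
  have c: "c > 0" using a b by (simp add: c_def)
  define If where "If = enn2real (\<integral>\<^sup>+x. f x \<partial>lborel)"
  define Ig where "Ig = enn2real (\<integral>\<^sup>+x. g x \<partial>lborel)"
  have fin: "(\<integral>\<^sup>+x. ennreal (k x) \<partial>lborel) < \<infinity>" if "\<And>x. k x \<noteq> 0 \<Longrightarrow> \<bar>x\<bar> \<le> R" "\<And>x. k x \<le> M" for k :: "real \<Rightarrow> real"
  proof -
    have "(\<integral>\<^sup>+x. ennreal (k x) \<partial>lborel) \<le> (\<integral>\<^sup>+x. ennreal M * indicator {-R..R} x \<partial>lborel)"
    proof (rule nn_integral_mono)
      fix x :: real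
      show "ennreal (k x) \<le> ennreal M * indicator {-R..R} x"
        using that[of x] by (cases "k x = 0") (auto intro!: ennreal_leI simp: indicator_def)
    qed
    also have "\<dots> < \<infinity>" by (simp add: nn_integral_cmult ennreal_mult_less_top emeasure_lborel_Icc_eq)
    finally show ?thesis .
  qed
  have If: "(\<integral>\<^sup>+x. f x \<partial>lborel) = ennreal If" "If \<ge> 0"
    using fin[OF supp(1) bd(1)] by (auto simp: If_def less_top)
  have Ig: "(\<integral>\<^sup>+x. g x \<partial>lborel) = ennreal Ig" "Ig \<ge> 0"
    using fin[OF supp(2) bd(2)] by (auto simp: Ig_def less_top)
  have layers: "(\<integral>\<^sup>+z. indicator {0<..<1} z * emeasure lborel {x. d * z < k x} \<partial>lborel) = ennreal (1 / d) * (\<integral>\<^sup>+x. k x \<partial>lborel)"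
    if [measurable]: "k \<in> borel_measurable borel" and "\<And>x. 0 \<le> k x" "\<And>x. k x \<le> d" "d > 0" for k :: "real \<Rightarrow> real" and d
  proof -
    have "(\<integral>\<^sup>+z. indicator {0<..<1} z * emeasure lborel {x. d * z < k x} \<partial>lborel) = (\<integral>\<^sup>+x. ennreal (min 1 (k x / d)) \<partial>lborel)"
      using that by (intro nn_integral_truncated_layers) auto
    also have "\<dots> = (\<integral>\<^sup>+x. ennreal (1 / d) * ennreal (k x) \<partial>lborel)"
      using that by (intro nn_integral_cong) (auto simp: min_def field_simps simp flip: ennreal_mult intro: antisym)
    also have "\<dots> = ennreal (1 / d) * (\<integral>\<^sup>+x. k x \<partial>lborel)" by (rule nn_integral_cmult) simp
    finally show ?thesis .
  qed
  have level: "ennreal u * emeasure lborel {x. a * z < f x} + ennreal v * emeasure lborel {x. b * z < g x}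
      \<le> emeasure lborel {x. c * z < h x}" if z: "0 < z" "z < 1" for z
  proof (rule brunn_minkowski_real)
    have "a * z < a" "b * z < b" using z a b by auto
    then show "{x. a * z < f x} \<noteq> {}" "{x. b * z < g x} \<noteq> {}"
      using less_cSup_iff[OF _ bdd(1), of "a * z"] less_cSup_iff[OF _ bdd(2), of "b * z"]
      by (auto simp: a_def b_def)
    have p: "a * z > 0" "b * z > 0" using z a b by auto
    show "bdd_above {x. a * z < f x}" using supp(1) p
      by (intro bdd_aboveI[of _ R]) (smt (verit) mem_Collect_eq)
    show "bdd_below {x. b * z < g x}" using supp(2) p
      by (intro bdd_belowI[of _ "-R"]) (smt (verit) mem_Collect_eq)
    fix x y assume "x \<in> {x. a * z < f x}" "y \<in> {x. b * z < g x}"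
    then have "(a * z) powr u * (b * z) powr v < f x powr u * g y powr v"
      using p uv by (intro mult_strict_mono powr_less_mono2) auto
    moreover have "(a * z) powr u * (b * z) powr v = c * z"
      using a b z uv by (simp add: powr_mult c_def flip: powr_add)
    ultimately show "u * x + v * y \<in> {x. c * z < h x}" using le[of x y] by simp
  qed (use uv in auto)
  have "If powr u * Ig powr v = c * ((If / a) powr u * (Ig / b) powr v)"
    using a b If Ig by (simp add: c_def powr_divide)
  also have "\<dots> \<le> c * (u * (If / a) + v * (Ig / b))"
  proof (cases "If = 0 \<or> Ig = 0")
    case True
    then show ?thesis using c uv a b If Ig by (auto intro!: mult_nonneg_nonneg)
  next
    case False
    then show ?thesis using c uv a b If Ig by (intro mult_left_mono Youngs_inequality_0) auto
  qed
  finally have "ennreal (If powr u * Ig powr v) \<le> ennreal c * (ennreal u * (ennreal (1/a) * ennreal If) + ennreal v * (ennreal (1/b) * ennreal Ig))"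
    using a b c uv If Ig by (simp flip: ennreal_mult ennreal_plus)
  also have "ennreal u * (ennreal (1/a) * ennreal If) + ennreal v * (ennreal (1/b) * ennreal Ig) =
     (\<integral>\<^sup>+z. ennreal u * (indicator {0<..<1} z * emeasure lborel {x. a * z < f x})
       + ennreal v * (indicator {0<..<1} z * emeasure lborel {x. b * z < g x}) \<partial>lborel)"
    using layers[of f a] layers[of g b] nn fa gb a b
    by (simp add: nn_integral_add nn_integral_cmult If Ig)
  also have "\<dots> \<le> (\<integral>\<^sup>+z. indicator {0<..<1} z * emeasure lborel {x. c * z < h x} \<partial>lborel)"
    using level by (intro nn_integral_mono) (auto simp: indicator_def)
  also have "\<dots> = (\<integral>\<^sup>+x. ennreal (min 1 (h x / c)) \<partial>lborel)"
    using nn c by (intro nn_integral_truncated_layers) auto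
  also have "\<dots> \<le> (\<integral>\<^sup>+x. ennreal (1 / c) * ennreal (h x) \<partial>lborel)"
    using nn c by (intro nn_integral_mono) (auto simp flip: ennreal_mult intro!: ennreal_leI)
  also have "\<dots> = ennreal (1 / c) * (\<integral>\<^sup>+x. h x \<partial>lborel)" by (rule nn_integral_cmult) simp
  finally have "ennreal (If powr u * Ig powr v) \<le> ennreal c * (ennreal (1 / c) * (\<integral>\<^sup>+x. h x \<partial>lborel))"
    by (simp add: mult_left_mono)
  also have "\<dots> = (\<integral>\<^sup>+x. h x \<partial>lborel)" using c by (simp add: mult.assoc[symmetric] flip: ennreal_mult)
  finally show ?thesis by (simp add: If_def Ig_def)
qed

section \<open>The Prekopa--Leindler inequality in every dimension\<close>

interpretation lborel_family: product_sigma_finite "\<lambda>_::nat. lborel :: real measure" ..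

abbreviation Rn_cube :: "nat \<Rightarrow> real \<Rightarrow> (nat \<Rightarrow> real) set" where
  "Rn_cube n R \<equiv> {..<n} \<rightarrow>\<^sub>E {-R..R}"

text \<open>
  A class of integrands that is closed under taking sections and integrating out the last
  coordinate (with a larger bound), so that the induction on the dimension stays inside it.
\<close>

definition box_bounded :: "nat \<Rightarrow> real \<Rightarrow> real \<Rightarrow> ((nat \<Rightarrow> real) \<Rightarrow> real) \<Rightarrow> bool" where
  "box_bounded n M R f \<longleftrightarrow> f \<in> borel_measurable (Rn_lborel n) \<and> (\<forall>x. 0 \<le> f x \<and> f x \<le> M) \<and>
     (\<forall>x. f x \<noteq> 0 \<longrightarrow> (\<forall>i<n. \<bar>x i\<bar> \<le> R))"

lemma box_bounded_nonneg: "box_bounded n M R f \<Longrightarrow> 0 \<le> M"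
  unfolding box_bounded_def by (meson order_trans)

lemma in_cube_iff: "x \<in> Rn_cube n R \<longleftrightarrow> x \<in> Rn n \<and> (\<forall>i<n. \<bar>x i\<bar> \<le> R)"
  by (force simp: PiE_iff abs_le_iff)

lemma Rn_update: "x \<in> Rn n \<Longrightarrow> x(n := t) \<in> Rn (Suc n)"
  by (auto simp: PiE_def extensional_def)

abbreviation Rn_comb :: "nat \<Rightarrow> real \<Rightarrow> (nat \<Rightarrow> real) \<Rightarrow> real \<Rightarrow> (nat \<Rightarrow> real) \<Rightarrow> nat \<Rightarrow> real" where
  "Rn_comb n u x v y \<equiv> (\<lambda>i\<in>{..<n}. u * x i + v * y i)"

lemma emeasure_Rn_cube:
  assumes "R \<ge> 0"
  shows "emeasure (Rn_lborel n) (Rn_cube n R) = ennreal ((2 * R) ^ n)"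
  using assms by (subst lborel_family.emeasure_PiM) (auto simp: prod_constant ennreal_power)

lemma box_bounded_integral:
  assumes f: "box_bounded n M R f" and R: "R \<ge> 0"
  shows "(\<integral>\<^sup>+x. f x \<partial>Rn_lborel n) \<le> ennreal (M * (2 * R) ^ n)"
proof -
  have "(\<integral>\<^sup>+x. f x \<partial>Rn_lborel n) \<le> (\<integral>\<^sup>+x. ennreal M * indicator (Rn_cube n R) x \<partial>Rn_lborel n)"
  proof (rule nn_integral_mono)
    fix x assume x: "x \<in> space (Rn_lborel n)"
    then show "ennreal (f x) \<le> ennreal M * indicator (Rn_cube n R) x"
    proof (cases "f x = 0")
      case False
      then have "x \<in> Rn_cube n R"
        using f x by (auto simp: box_bounded_def space_PiM in_cube_iff)
      then show ?thesis using f by (auto simp: box_bounded_def intro!: ennreal_leI)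
    qed simp
  qed
  also have "\<dots> = ennreal (M * (2 * R) ^ n)"
    using R box_bounded_nonneg[OF f] by (subst nn_integral_cmult) (auto simp: emeasure_Rn_cube ennreal_mult intro!: sets_PiM_I_finite)
  finally show ?thesis .
qed

lemma box_bounded_section:
  assumes f: "box_bounded (Suc n) M R f"
  shows "box_bounded n M R (\<lambda>x. f (x(n := t)))"
proof -
  have "(\<lambda>x. x(n := t)) \<in> Rn_lborel n \<rightarrow>\<^sub>M Rn_lborel (Suc n)"
    unfolding lessThan_Suc by (rule measurable_fun_upd[where J="{..<n}"]) auto
  then have "(\<lambda>x. f (x(n := t))) \<in> borel_measurable (Rn_lborel n)"
    using f unfolding box_bounded_def by (metis measurable_compose)
  with f show ?thesis unfolding box_bounded_def by (metis fun_upd_apply less_SucI nat_neq_iff)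
qed

definition "is_marginal n B R f F \<longleftrightarrow> F \<in> borel_measurable borel \<and>
    (\<forall>t. 0 \<le> F t \<and> F t \<le> B) \<and> (\<forall>t. F t \<noteq> 0 \<longrightarrow> \<bar>t\<bar> \<le> R) \<and>
    (\<forall>t. (\<integral>\<^sup>+x. ennreal (f (x(n := t))) \<partial>Rn_lborel n) = ennreal (F t)) \<and>
    (\<integral>\<^sup>+x. ennreal (f x) \<partial>Rn_lborel (Suc n)) = (\<integral>\<^sup>+t. ennreal (F t) \<partial>lborel)"
  for B R :: real and F :: "real \<Rightarrow> real"

lemmas is_marginalD = is_marginal_def[THEN iffD1, THEN conjunct1]
  is_marginal_def[THEN iffD1, THEN conjunct2, THEN conjunct1]
  is_marginal_def[THEN iffD1, THEN conjunct2, THEN conjunct2, THEN conjunct1]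
  is_marginal_def[THEN iffD1, THEN conjunct2, THEN conjunct2, THEN conjunct2, THEN conjunct1]
  is_marginal_def[THEN iffD1, THEN conjunct2, THEN conjunct2, THEN conjunct2, THEN conjunct2]

lemma box_bounded_marginal:
  assumes f: "box_bounded (Suc n) M R f" and R: "R \<ge> 0"
  shows "\<exists>F. is_marginal n (M * (2 * R) ^ n) R f F"
  unfolding is_marginal_def
proof (intro exI conjI allI impI)
  define F where "F = (\<lambda>t. enn2real (\<integral>\<^sup>+x. f (x(n := t)) \<partial>Rn_lborel n))"
  have M: "M \<ge> 0" using f by (rule box_bounded_nonneg)
  have [measurable]: "f \<in> borel_measurable (Rn_lborel (Suc n))" using f by (simp add: box_bounded_def)
  have upd: "(\<lambda>(t, x). x(n := t)) \<in> lborel \<Otimes>\<^sub>M Rn_lborel n \<rightarrow>\<^sub>M Rn_lborel (Suc n)"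
    unfolding lessThan_Suc case_prod_beta by (rule measurable_fun_upd[where J="{..<n}"]) auto
  have [measurable]: "(\<lambda>(t, x). f (x(n := t))) \<in> borel_measurable (lborel \<Otimes>\<^sub>M Rn_lborel n)"
    using measurable_compose[OF upd, of f borel] by (simp add: case_prod_beta)
  interpret P: finite_product_sigma_finite "\<lambda>_. lborel :: real measure" "{..<n}" by standard auto
  have "F \<in> borel_measurable lborel" unfolding F_def by measurable
  then show "F \<in> borel_measurable borel" by simp
  show "0 \<le> F t" for t by (simp add: F_def)
  have bd: "(\<integral>\<^sup>+x. f (x(n := t)) \<partial>Rn_lborel n) \<le> ennreal (M * (2 * R) ^ n)" for t
    using box_bounded_integral[OF box_bounded_section[OF f] R] .
  show "F t \<le> M * (2 * R) ^ n" for t unfolding F_def using M R bd[of t]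
    by (intro enn2real_leI) auto
  show *: "(\<integral>\<^sup>+x. f (x(n := t)) \<partial>Rn_lborel n) = ennreal (F t)" for t
    unfolding F_def using bd[of t] by (simp add: ennreal_enn2real_if) (auto simp: top_unique)
  show "\<bar>t\<bar> \<le> R" if "F t \<noteq> 0" for t
  proof (rule ccontr)
    assume "\<not> \<bar>t\<bar> \<le> R"
    then have "f (x(n := t)) = 0" for x using f unfolding box_bounded_def by (metis fun_upd_same lessI)
    then show False using that by (simp add: F_def)
  qed
  have mf: "(\<lambda>x. ennreal (f x)) \<in> borel_measurable (Rn_lborel (Suc n))" by measurable
  have "(\<integral>\<^sup>+x. f x \<partial>Rn_lborel (Suc n)) = (\<integral>\<^sup>+t. (\<integral>\<^sup>+x. f (x(n := t)) \<partial>Rn_lborel n) \<partial>lborel)"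
    using lborel_family.product_nn_integral_insert_rev[of "{..<n}" n f] mf by (simp add: lessThan_Suc)
  then show "(\<integral>\<^sup>+x. f x \<partial>Rn_lborel (Suc n)) = (\<integral>\<^sup>+t. F t \<partial>lborel)" by (simp only: *)
qed

text \<open>
  Induction on the dimension: by the induction hypothesis applied to the sections, the integrals
  over the sections satisfy the hypothesis of the inequality on the line.
\<close>

theorem prekopa_leindler:
  fixes u v :: real
  assumes uv: "u > 0" "v > 0" "u + v = 1" and R: "R \<ge> 0"
    and "box_bounded n M R f" "box_bounded n M R g" "box_bounded n M R h"
    and "\<And>x y. x \<in> Rn n \<Longrightarrow> y \<in> Rn n \<Longrightarrow> f x powr u * g y powr v \<le> h (Rn_comb n u x v y)"
  shows "enn2real (\<integral>\<^sup>+x. f x \<partial>Rn_lborel n) powr u * enn2real (\<integral>\<^sup>+x. g x \<partial>Rn_lborel n) powr v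
    \<le> enn2real (\<integral>\<^sup>+x. h x \<partial>Rn_lborel n)"
  using assms(5-)
proof (induction n arbitrary: f g h)
  case 0
  have "enn2real (\<integral>\<^sup>+x. k x \<partial>Rn_lborel 0) = k (\<lambda>_. undefined)" if "box_bounded 0 M R k" for k
    using that by (simp add: PiM_empty nn_integral_count_space_finite box_bounded_def)
  with 0 show ?case by (auto simp: restrict_def)
next
  case (Suc n)
  obtain F where "is_marginal n (M * (2 * R) ^ n) R f F"
    using box_bounded_marginal[OF Suc.prems(1) R] by blast
  note F = is_marginalD[OF this]
  obtain G where "is_marginal n (M * (2 * R) ^ n) R g G"
    using box_bounded_marginal[OF Suc.prems(2) R] by blast
  note G = is_marginalD[OF this]
  obtain H where "is_marginal n (M * (2 * R) ^ n) R h H"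
    using box_bounded_marginal[OF Suc.prems(3) R] by blast
  note H = is_marginalD[OF this]
  have step: "F s powr u * G t powr v \<le> H (u * s + v * t)" for s t
  proof -
    have "enn2real (\<integral>\<^sup>+x. f (x(n := s)) \<partial>Rn_lborel n) powr u * enn2real (\<integral>\<^sup>+x. g (x(n := t)) \<partial>Rn_lborel n) powr v
        \<le> enn2real (\<integral>\<^sup>+x. h (x(n := u * s + v * t)) \<partial>Rn_lborel n)"
    proof (rule Suc.IH)
      fix x y assume "x \<in> Rn n" "y \<in> Rn n"
      then have "f (x(n := s)) powr u * g (y(n := t)) powr v
          \<le> h (\<lambda>i\<in>{..<Suc n}. u * (x(n := s)) i + v * (y(n := t)) i)"
        by (intro Suc.prems(4) Rn_update)
      also have "(\<lambda>i\<in>{..<Suc n}. u * (x(n := s)) i + v * (y(n := t)) i) =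
          (Rn_comb n u x v y)(n := u * s + v * t)"
        by (auto simp: fun_eq_iff)
      finally show "f (x(n := s)) powr u * g (y(n := t)) powr v
          \<le> h ((Rn_comb n u x v y)(n := u * s + v * t))" .
    qed ((rule box_bounded_section, rule Suc.prems)+)
    then show ?thesis using F(2) G(2) H(2) by (simp only: F(4)[rule_format] G(4)[rule_format] H(4)[rule_format] enn2real_ennreal)
  qed
  have "ennreal (enn2real (\<integral>\<^sup>+x. F x \<partial>lborel) powr u * enn2real (\<integral>\<^sup>+x. G x \<partial>lborel) powr v)
      \<le> (\<integral>\<^sup>+x. H x \<partial>lborel)"
    using F(2,3) G(2,3) H(2)
    by (intro prekopa_leindler_real[where M="M * (2 * R) ^ n" and R=R] F(1) G(1) H(1) uv step) simp_all
  moreover have "(\<integral>\<^sup>+x. H x \<partial>lborel) < \<top>"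
    using box_bounded_integral[OF Suc.prems(3) R] by (simp add: H(5)[symmetric] less_top[symmetric]) (auto simp: top_unique)
  ultimately show ?case
    unfolding F(5) G(5) H(5) by (metis enn2real_ennreal enn2real_mono mult_nonneg_nonneg powr_ge_zero)
qed

lemma brunn_minkowski_multiplicative:
  assumes uv: "u > 0" "v > 0" "u + v = 1"
    and m: "A \<in> sets (Rn_lborel n)" "B \<in> sets (Rn_lborel n)" "C \<in> sets (Rn_lborel n)"
    and box: "A \<union> B \<union> C \<subseteq> Rn_cube n R" and R: "R \<ge> 0"
    and sub: "\<And>x y. x \<in> A \<Longrightarrow> y \<in> B \<Longrightarrow> Rn_comb n u x v y \<in> C"
  shows "measure (Rn_lborel n) A powr u * measure (Rn_lborel n) B powr v \<le> measure (Rn_lborel n) C"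
proof -
  have bb: "box_bounded n 1 R (indicator D)" if "D \<in> sets (Rn_lborel n)" "D \<subseteq> Rn_cube n R" for D
  proof -
    have "\<bar>x i\<bar> \<le> R" if "x \<in> D" "i < n" for x i
      using that \<open>D \<subseteq> _\<close> by (auto simp: in_cube_iff)
    then show ?thesis using that by (auto simp: box_bounded_def indicator_def)
  qed
  have int: "enn2real (\<integral>\<^sup>+x. ennreal (indicator D x) \<partial>Rn_lborel n) = measure (Rn_lborel n) D"
    if "D \<in> sets (Rn_lborel n)" for D
    using that by (simp add: ennreal_indicator measure_def)
  have "enn2real (\<integral>\<^sup>+x. ennreal (indicator A x) \<partial>Rn_lborel n) powr u * enn2real (\<integral>\<^sup>+x. ennreal (indicator B x) \<partial>Rn_lborel n) powr v
     \<le> enn2real (\<integral>\<^sup>+x. ennreal (indicator C x) \<partial>Rn_lborel n)"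
  proof (intro prekopa_leindler[where M=1 and R=R] uv R bb m)
    fix x y
    show "indicat_real A x powr u * indicat_real B y powr v \<le> indicat_real C (Rn_comb n u x v y)"
      using sub[of x y] by (cases "x \<in> A \<and> y \<in> B") (auto simp: indicator_def)
  qed (use box in auto)
  then show ?thesis using m by (simp add: int)
qed

lemma nn_integral_Rn_affine:
  assumes c: "c > 0" and f: "f \<in> borel_measurable (Rn_lborel n)"
  shows "(\<integral>\<^sup>+x. f x \<partial>Rn_lborel n) = ennreal (c ^ n) * (\<integral>\<^sup>+x. f (\<lambda>i\<in>{..<n}. c * x i + d i) \<partial>Rn_lborel n)"
  using f
proof (induction n arbitrary: f)
  case 0
  then show ?case by (simp add: PiM_empty nn_integral_count_space_finite restrict_def)
next
  case (Suc n)
  note [measurable] = Suc.prems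
  let ?T = "\<lambda>n x. \<lambda>i\<in>{..<n}. c * x i + d i"
  have T [measurable]: "?T n \<in> Rn_lborel n \<rightarrow>\<^sub>M Rn_lborel n" for n by measurable
  have fT: "(\<lambda>x. f (?T (Suc n) x)) \<in> borel_measurable (Rn_lborel (Suc n))"
    using measurable_compose[OF T Suc.prems] .
  have sec: "(\<lambda>x. f (x(n := t))) \<in> borel_measurable (Rn_lborel n)" for t
  proof -
    have "(\<lambda>x. x(n := t)) \<in> Rn_lborel n \<rightarrow>\<^sub>M Rn_lborel (Suc n)"
      unfolding lessThan_Suc by (rule measurable_fun_upd[where J="{..<n}"]) auto
    then show ?thesis by (rule measurable_compose[OF _ Suc.prems])
  qed
  have upd: "(\<lambda>(t, x). x(n := t)) \<in> lborel \<Otimes>\<^sub>M Rn_lborel n \<rightarrow>\<^sub>M Rn_lborel (Suc n)"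
    unfolding lessThan_Suc case_prod_beta by (rule measurable_fun_upd[where J="{..<n}"]) auto
  have [measurable]: "(\<lambda>(t, x). f (x(n := t))) \<in> borel_measurable (lborel \<Otimes>\<^sub>M Rn_lborel n)"
    using measurable_compose[OF upd Suc.prems] by (simp add: case_prod_unfold del: fun_upd_apply)
  interpret P: finite_product_sigma_finite "\<lambda>_. lborel :: real measure" "{..<n}" by standard auto
  have marg: "(\<lambda>t. \<integral>\<^sup>+x. f (x(n := t)) \<partial>Rn_lborel n) \<in> borel_measurable lborel" by measurable
  have "(\<integral>\<^sup>+x. f x \<partial>Rn_lborel (Suc n)) = (\<integral>\<^sup>+t. (\<integral>\<^sup>+x. f (x(n := t)) \<partial>Rn_lborel n) \<partial>lborel)"
    using lborel_family.product_nn_integral_insert_rev[of "{..<n}" n f] Suc.prems by (simp add: lessThan_Suc)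
  also have "\<dots> = ennreal c * (\<integral>\<^sup>+t. (\<integral>\<^sup>+x. f (x(n := d n + c * t)) \<partial>Rn_lborel n) \<partial>lborel)"
    using c marg by (subst nn_integral_real_affine[where c=c and t="d n"]) auto
  also have "(\<lambda>t. \<integral>\<^sup>+x. f (x(n := d n + c * t)) \<partial>Rn_lborel n) =
     (\<lambda>t. ennreal (c ^ n) * (\<integral>\<^sup>+x. f ((?T n x)(n := d n + c * t)) \<partial>Rn_lborel n))"
    by (rule ext, rule Suc.IH, rule sec)
  also have "(\<lambda>t x. f ((?T n x)(n := d n + c * t))) = (\<lambda>t x. f (?T (Suc n) (x(n := t))))"
    by (intro ext arg_cong[of _ _ f]) auto
  also have "(\<integral>\<^sup>+t. ennreal (c ^ n) * (\<integral>\<^sup>+x. f (?T (Suc n) (x(n := t))) \<partial>Rn_lborel n) \<partial>lborel) =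
      ennreal (c ^ n) * (\<integral>\<^sup>+t. (\<integral>\<^sup>+x. f (?T (Suc n) (x(n := t))) \<partial>Rn_lborel n) \<partial>lborel)"
  proof (rule nn_integral_cmult)
    have [measurable]: "(\<lambda>(t, x). f (?T (Suc n) (x(n := t)))) \<in> borel_measurable (lborel \<Otimes>\<^sub>M Rn_lborel n)"
      using measurable_compose[OF upd fT] by (simp add: case_prod_unfold del: fun_upd_apply)
    show "(\<lambda>t. \<integral>\<^sup>+x. f (?T (Suc n) (x(n := t))) \<partial>Rn_lborel n) \<in> borel_measurable lborel" by measurable
  qed
  also have "(\<integral>\<^sup>+t. (\<integral>\<^sup>+x. f (?T (Suc n) (x(n := t))) \<partial>Rn_lborel n) \<partial>lborel) = (\<integral>\<^sup>+x. f (?T (Suc n) x) \<partial>Rn_lborel (Suc n))"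
    using lborel_family.product_nn_integral_insert_rev[of "{..<n}" n "\<lambda>x. f (?T (Suc n) x)"] fT by (simp add: lessThan_Suc)
  finally show ?case using c by (simp only: power_Suc ennreal_mult[of c "c ^ n"] mult.assoc zero_le_power less_imp_le)
qed

lemma emeasure_Rn_homothety_le:
  assumes c: "c > 0" and A: "A \<in> sets (Rn_lborel n)" and B: "B \<in> sets (Rn_lborel n)"
    and sub: "\<And>x. x \<in> A \<Longrightarrow> (\<lambda>i\<in>{..<n}. c * x i + d i) \<in> B"
  shows "ennreal (c ^ n) * emeasure (Rn_lborel n) A \<le> emeasure (Rn_lborel n) B"
proof -
  have "emeasure (Rn_lborel n) B = (\<integral>\<^sup>+x. indicator B x \<partial>Rn_lborel n)" using B by simp
  also have "\<dots> = ennreal (c ^ n) * (\<integral>\<^sup>+x. indicator B (\<lambda>i\<in>{..<n}. c * x i + d i) \<partial>Rn_lborel n)"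
    by (rule nn_integral_Rn_affine) (use c B in auto)
  also have "\<dots> \<ge> ennreal (c ^ n) * (\<integral>\<^sup>+x. indicator A x \<partial>Rn_lborel n)"
    using sub by (intro mult_left_mono nn_integral_mono) (auto simp: indicator_def)
  finally show ?thesis using A by simp
qed

section \<open>The uniform measure on a convex body\<close>

text \<open>
  Extending by \<open>0\<close> turns the set into the trace of a closed set of the space of all sequences, where
  Borel sets and product sets agree by countability of the index set.
\<close>

lemma closedin_Rn_measurable:
  assumes "closedin (Rn_topology n) K"
  shows "K \<in> sets (Rn_lborel n)"
proof -
  let ?r = "\<lambda>x::nat \<Rightarrow> real. restrict x {..<n}"
  let ?e = "\<lambda>x::nat \<Rightarrow> real. \<lambda>i. if i < n then x i else 0"
  have cont: "continuous_map euclidean (Rn_topology n) ?r"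
  proof -
    have "continuous_map euclidean euclideanreal (\<lambda>x. ?r x k)" if "k < n" for k
      using that continuous_on_product_coordinates[of k] by simp
    then show ?thesis by (simp add: continuous_map_componentwise image_subset_iff)
  qed
  have "closed {x. ?r x \<in> K}"
    using closedin_continuous_map_preimage[OF cont assms] by simp
  then have cl: "{x. ?r x \<in> K} \<in> sets (PiM UNIV (\<lambda>_. borel))"
    by (simp add: sets_PiM_equal_borel)
  have e: "?e \<in> Rn_lborel n \<rightarrow>\<^sub>M PiM UNIV (\<lambda>_. borel)"
  proof (intro measurable_PiM_single')
    fix i :: nat
    show "(\<lambda>x. ?e x i) \<in> borel_measurable (Rn_lborel n)" by (cases "i < n") auto
  qed auto
  have "?e -` {x. ?r x \<in> K} \<inter> space (Rn_lborel n) = K"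
  proof -
    have "?r (?e x) = x" if "x \<in> Rn n" for x using that by (auto simp: fun_eq_iff PiE_def extensional_def)
    moreover have "K \<subseteq> Rn n" using closedin_subset[OF assms] by simp
    ultimately show ?thesis by (auto simp: space_PiM)
  qed
  then show ?thesis using measurable_sets[OF e cl] by simp
qed

lemma compactin_Rn_bounded:
  assumes "compactin (Rn_topology n) K"
  obtains R where "R > 0" "K \<subseteq> Rn_cube n R"
proof -
  have "\<exists>R. \<forall>x\<in>K. \<bar>x i\<bar> \<le> R" if "i < n" for i
  proof -
    have "compactin euclideanreal ((\<lambda>x. x i) ` K)"
      using that by (intro image_compactin[OF assms] continuous_map_product_projection) auto
    then have "bounded ((\<lambda>x. x i) ` K)" by (simp add: compact_imp_bounded)
    then show ?thesis by (auto simp: bounded_iff)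
  qed
  then obtain r where r: "\<And>i x. i < n \<Longrightarrow> x \<in> K \<Longrightarrow> \<bar>x i\<bar> \<le> r i" by metis
  define R where "R = (\<Sum>i<n. \<bar>r i\<bar>) + 1"
  have "r i \<le> R" if "i < n" for i
    using member_le_sum[of i "{..<n}" "\<lambda>i. \<bar>r i\<bar>"] that by (simp add: R_def)
  then have "\<bar>x i\<bar> \<le> R" if "i < n" "x \<in> K" for i x using r[OF that] that by (metis order_trans)
  moreover have "K \<subseteq> Rn n" using compactin_subset_topspace[OF assms] by simp
  ultimately have "K \<subseteq> Rn_cube n R" by (subst subset_iff, unfold in_cube_iff) blast
  moreover have "R > 0" unfolding R_def by (smt (verit) sum_nonneg abs_ge_zero)
  ultimately show ?thesis by (rule that[rotated])
qed

abbreviation Rn_cell :: "nat \<Rightarrow> (nat \<Rightarrow> real) \<Rightarrow> real \<Rightarrow> (nat \<Rightarrow> real) set" where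
  "Rn_cell n c r \<equiv> Rn n \<inter> {x. \<forall>i<n. \<bar>x i - c i\<bar> \<le> r}"

lemma interior_Rn_cell:
  assumes "Rn_topology n interior_of K \<noteq> {}"
  obtains c r where "c \<in> Rn n" "r > 0" "Rn_cell n c r \<subseteq> K"
proof -
  obtain c U where U: "openin (Rn_topology n) U" "c \<in> U" "U \<subseteq> K"
    using assms by (auto simp: interior_of_def)
  obtain V where V: "\<forall>i<n. open (V i)" "c \<in> PiE {..<n} V" "PiE {..<n} V \<subseteq> U"
    using U unfolding openin_product_topology_alt by (auto simp: Ball_def)
  have "\<exists>e>0. \<forall>y. \<bar>y - c i\<bar> \<le> e \<longrightarrow> y \<in> V i" if i: "i < n" for i
  proof -
    have "c i \<in> V i" using V(2) that by auto
    then obtain e where "e > 0" "cball (c i) e \<subseteq> V i" using V(1) i open_contains_cball by metis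
    moreover have "y \<in> cball (c i) e" if "\<bar>y - c i\<bar> \<le> e" for y
      using that by (simp add: dist_real_def abs_minus_commute)
    ultimately show ?thesis by blast
  qed
  then obtain e where e: "\<And>i. i < n \<Longrightarrow> e i > 0" "\<And>i y. i < n \<Longrightarrow> \<bar>y - c i\<bar> \<le> e i \<Longrightarrow> y \<in> V i" by metis
  define r where "r = Min (insert 1 (e ` {..<n}))"
  have r: "r > 0" "\<And>i. i < n \<Longrightarrow> r \<le> e i" using e by (auto simp: r_def)
  show ?thesis
  proof
    show "c \<in> Rn n" using V(2) by (auto simp: PiE_iff)
    show "Rn_cell n c r \<subseteq> K"
    proof
      fix x assume x: "x \<in> Rn_cell n c r"
      then have "x i \<in> V i" if "i < n" for i
        by (intro e(2)[OF that] order_trans[OF _ r(2)[OF that]]) (use that in blast)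
      then have "x \<in> PiE {..<n} V" using x by (auto simp: PiE_iff)
      then show "x \<in> K" using V(3) U(3) by auto
    qed
  qed (use r in auto)
qed

lemma emeasure_Rn_box:
  assumes "\<And>i. i < n \<Longrightarrow> a i \<le> b i"
  shows "emeasure (Rn_lborel n) (PiE {..<n} (\<lambda>i. {a i..b i})) = ennreal (\<Prod>i<n. b i - a i)"
  proof -
  have "emeasure (Rn_lborel n) (PiE {..<n} (\<lambda>i. {a i..b i})) = (\<Prod>i<n. ennreal (b i - a i))"
    using assms by (subst lborel_family.emeasure_PiM) simp_all
  also have "\<dots> = ennreal (\<Prod>i<n. b i - a i)" by (rule prod_ennreal) (use assms in auto)
  finally show ?thesis .
qed

locale body =
  fixes n :: nat and K :: "(nat \<Rightarrow> real) set"
  assumes n_pos: "n \<ge> 1" and convex_body: "convex_body n K"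
begin

abbreviation "\<mu> \<equiv> unif n K"
abbreviation "evol \<equiv> emeasure (Rn_lborel n)"
abbreviation "vol \<equiv> measure (Rn_lborel n)"

lemma K_Rn: "K \<subseteq> Rn n"
  using convex_body by (simp add: convex_body_def Rn_convex_def)

lemma K_convex: "x \<in> K \<Longrightarrow> y \<in> K \<Longrightarrow> u \<ge> 0 \<Longrightarrow> v \<ge> 0 \<Longrightarrow> u + v = 1 \<Longrightarrow> Rn_comb n u x v y \<in> K"
  using convex_body by (simp add: convex_body_def Rn_convex_def)

lemma K_sets [measurable]: "K \<in> sets (Rn_lborel n)"
proof (rule closedin_Rn_measurable)
  have "Hausdorff_space (Rn_topology n)" by (simp add: Hausdorff_space_product_topology)
  then show "closedin (Rn_topology n) K"
    using convex_body compactin_imp_closedin by (auto simp: convex_body_def)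
qed

lemma K_bounded: obtains R where "R > 0" "K \<subseteq> Rn_cube n R"
proof -
  have "compactin (Rn_topology n) K" using convex_body by (simp add: convex_body_def)
  then show ?thesis by (rule compactin_Rn_bounded) (rule that)
qed

lemma K_cell: obtains c r where "c \<in> Rn n" "r > 0" "Rn_cell n c r \<subseteq> K"
proof -
  have "Rn_topology n interior_of K \<noteq> {}" using convex_body by (simp add: convex_body_def)
  then show ?thesis by (rule interior_Rn_cell) (rule that)
qed

lemma emeasure_K_finite: "evol K < \<infinity>"
proof -
  obtain R where R: "R > 0" "K \<subseteq> Rn_cube n R" by (rule K_bounded)
  have "evol K \<le> evol (Rn_cube n R)"
    using R by (intro emeasure_mono sets_PiM_I_finite) auto
  also have "\<dots> < \<infinity>" using R by (subst emeasure_Rn_cube) auto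
  finally show ?thesis .
qed

lemma emeasure_K_pos: "evol K > 0"
proof -
  obtain c r where c: "c \<in> Rn n" "r > 0" "Rn_cell n c r \<subseteq> K" by (rule K_cell)
  have "0 < (\<Prod>i<n. (c i + r) - c i)" using c(2) by (simp add: prod_pos)
  then have "0 < evol (PiE {..<n} (\<lambda>i. {c i..c i + r}))"
    using c(2) by (subst emeasure_Rn_box) auto
  also have "\<dots> \<le> evol K"
  proof (intro emeasure_mono subsetI)
    fix x assume x: "x \<in> PiE {..<n} (\<lambda>i. {c i..c i + r})"
    have "\<bar>x i - c i\<bar> \<le> r" if "i < n" for i
      using PiE_mem[OF x, of i] that c(2) by (simp add: abs_le_iff)
    moreover have "x \<in> Rn n" using x by (simp add: PiE_iff)
    ultimately show "x \<in> K" using c(3) by blast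
  qed simp
  finally show ?thesis .
qed

lemma vol_K_pos: "vol K > 0"
  using emeasure_K_finite emeasure_K_pos by (simp add: measure_def enn2real_positive_iff)

sublocale prob_space "\<mu>"
  unfolding unif_def using emeasure_K_pos emeasure_K_finite by (intro prob_space_uniform_measure) auto

lemma sets_\<mu> [measurable_cong, simp]: "sets \<mu> = sets (Rn_lborel n)"
  by (simp add: unif_def)

lemma space_\<mu> [simp]: "space \<mu> = Rn n"
  by (simp add: unif_def space_PiM)

lemma emeasure_K_Int:
  assumes "D \<in> sets (Rn_lborel n)"
  shows "evol (K \<inter> D) = ennreal (vol (K \<inter> D))"
proof -
  have "evol (K \<inter> D) \<le> evol K" using assms by (intro emeasure_mono) auto
  then have "evol (K \<inter> D) \<noteq> \<infinity>" using emeasure_K_finite by auto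
  then show ?thesis by (simp add: emeasure_eq_ennreal_measure)
qed

lemma measure_\<mu>: "A \<in> sets (Rn_lborel n) \<Longrightarrow> prob A = vol (K \<inter> A) / vol K"
  unfolding unif_def using emeasure_K_pos emeasure_K_finite by (intro measure_uniform_measure) auto

lemma AE_K: "AE x in \<mu>. x \<in> K"
  unfolding unif_def using emeasure_K_pos emeasure_K_finite by (intro AE_uniform_measureI) auto

text \<open>
  Brunn--Minkowski inside \<open>K\<close>; dividing by the volume of \<open>K\<close> costs nothing because \<open>u + v = 1\<close>.
\<close>

lemma measure_\<mu>_log_concave:
  assumes uv: "u > 0" "v > 0" "u + v = 1"
    and [measurable]: "A \<in> sets (Rn_lborel n)" "B \<in> sets (Rn_lborel n)" "C \<in> sets (Rn_lborel n)"
    and sub: "\<And>x y. x \<in> A \<inter> K \<Longrightarrow> y \<in> B \<inter> K \<Longrightarrow> Rn_comb n u x v y \<in> C"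
  shows "prob A powr u * prob B powr v \<le> prob C"
proof -
  obtain R where R: "R > 0" "K \<subseteq> Rn_cube n R" by (rule K_bounded)
  have "vol (K \<inter> A) powr u * vol (K \<inter> B) powr v \<le> vol (K \<inter> C)"
    using R uv sub K_convex by (intro brunn_minkowski_multiplicative[where R=R]) auto
  moreover have "prob A powr u * prob B powr v = vol (K \<inter> A) powr u * vol (K \<inter> B) powr v / vol K"
    using uv vol_K_pos by (simp add: measure_\<mu> powr_divide flip: powr_add)
  ultimately show ?thesis using vol_K_pos by (simp add: measure_\<mu> divide_right_mono)
qed

lemma measure_\<mu>_homothety:
  assumes c: "0 < c" "c \<le> 1" and y: "y \<in> K"
    and [measurable]: "A \<in> sets (Rn_lborel n)" "B \<in> sets (Rn_lborel n)"
    and sub: "\<And>x. x \<in> A \<inter> K \<Longrightarrow> Rn_comb n c x (1 - c) y \<in> B"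
  shows "c ^ n * prob A \<le> prob B"
proof -
  have "ennreal (c ^ n) * evol (K \<inter> A) \<le> evol (K \<inter> B)"
    using c sub K_convex[OF _ y] by (intro emeasure_Rn_homothety_le[where d="\<lambda>i. (1 - c) * y i"]) auto
  then have "c ^ n * vol (K \<inter> A) \<le> vol (K \<inter> B)"
    using c by (simp add: emeasure_K_Int flip: ennreal_mult)
  then show ?thesis using vol_K_pos by (simp add: measure_\<mu> divide_right_mono)
qed

lemma inner_measurable [measurable]: "(\<lambda>x. Rn_inner n \<theta> x) \<in> borel_measurable (Rn_lborel n)"
  unfolding Rn_inner_def by measurable

lemma inner_comb: "Rn_inner n \<theta> (Rn_comb n u x v y) = u * Rn_inner n \<theta> x + v * Rn_inner n \<theta> y"
  by (simp add: Rn_inner_def sum_distrib_left sum.distrib algebra_simps)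

lemma halfspace_sets [measurable]: "{y \<in> Rn n. Rn_inner n \<theta> y \<le> b} \<in> sets (Rn_lborel n)"
proof -
  have "{y \<in> space (Rn_lborel n). Rn_inner n \<theta> y \<le> b} \<in> sets (Rn_lborel n)" by measurable
  then show ?thesis by (simp add: space_PiM)
qed

end

section \<open>Half-space depth and its concentration\<close>

lemma half_powr_ge: "z \<ge> 0 \<Longrightarrow> (1 / 2) powr z \<ge> 1 - (z::real)"
proof -
  assume z: "z \<ge> 0"
  have "1 - z \<le> 1 + - z * ln 2" using ln_2_less_1 z by (simp add: mult_left_le)
  also have "\<dots> \<le> exp (- z * ln 2)" by (rule exp_ge_add_one_self)
  also have "\<dots> = (1 / 2) powr z" by (simp add: powr_def ln_div)
  finally show ?thesis .
qed

lemma half_powr_le: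
  assumes z: "(z::real) > 0"
  shows "(1 / 2) powr z \<le> 2 / z"
proof -
  have "1 / 2 \<le> ln (2::real)" using ln_le_minus_one[of "1 / 2 :: real"] by (simp add: ln_div)
  then have "z * (1 / 2) \<le> z * ln 2" using z by (intro mult_left_mono) auto
  also have "\<dots> \<le> 1 + z * ln 2" by simp
  also have "\<dots> \<le> exp (z * ln 2)" by (rule exp_ge_add_one_self)
  finally have "z / 2 \<le> exp (z * ln 2)" by simp
  moreover have "(1 / 2) powr z = 1 / exp (z * ln 2)" by (simp add: powr_def ln_div exp_minus inverse_eq_divide)
  moreover have "1 / exp (z * ln 2) \<le> 1 / (z / 2)" using calculation(1) z by (intro divide_left_mono) auto
  ultimately show ?thesis by simp
qed

context body begin

abbreviation "ip \<equiv> Rn_inner n"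
abbreviation "depth \<equiv> tukey_depth n K"
abbreviation "neg_log \<equiv> neg_log_depth n K"
abbreviation "cramer \<equiv> cramer_transform n K"
text \<open>
  The half-spaces over which the depth takes its infimum are the sets \<open>cap \<theta> b\<close> with \<open>direction \<theta>\<close>.
\<close>

definition "direction \<theta> \<longleftrightarrow> \<theta> \<in> Rn n \<and> (\<exists>i<n. \<theta> i \<noteq> 0)"
definition "cap \<theta> b = {y \<in> Rn n. ip \<theta> y \<le> b}"

lemma cap_sets [measurable, simp]: "cap \<theta> b \<in> sets (Rn_lborel n)"
  unfolding cap_def by (rule halfspace_sets)

lemma mem_cap: "y \<in> cap \<theta> b \<longleftrightarrow> y \<in> Rn n \<and> ip \<theta> y \<le> b"
  unfolding cap_def by (rule mem_Collect_eq)

lemma closed_halfspace_iff: "closed_halfspace n H \<longleftrightarrow> (\<exists>\<theta> b. direction \<theta> \<and> H = cap \<theta> b)"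
proof -
  have "closed_halfspace n H \<longleftrightarrow> (\<exists>\<theta>. \<theta> \<in> Rn n \<and> (\<exists>b. (\<exists>i<n. \<theta> i \<noteq> 0) \<and> H = cap \<theta> b))"
    unfolding closed_halfspace_def cap_def Bex_def ..
  also have "\<dots> \<longleftrightarrow> (\<exists>\<theta>. direction \<theta> \<and> (\<exists>b. H = cap \<theta> b))"
    by (simp only: direction_def ex_simps conj_assoc)
  finally show ?thesis by (simp only: ex_simps)
qed

lemma cap_mono:
  assumes "b \<le> c"
  shows "prob (cap \<theta> b) \<le> prob (cap \<theta> c)"
proof (rule finite_measure_mono)
  show "cap \<theta> b \<subseteq> cap \<theta> c" using assms by (auto simp: mem_cap)
qed simp

lemma direction_exists: "direction (\<lambda>i\<in>{..<n}. 1)"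
  unfolding direction_def using n_pos by (intro conjI exI[of _ "0::nat"]) simp_all

lemma depth_le: 
  assumes "x \<in> Rn n" "direction \<theta>" "ip \<theta> x \<le> b"
  shows "depth x \<le> prob (cap \<theta> b)"
  unfolding tukey_depth_def
proof (rule cInf_lower)
  show "bdd_below {measure \<mu> H |H. closed_halfspace n H \<and> x \<in> H}" by (intro bdd_belowI[of _ 0]) auto
  have "closed_halfspace n (cap \<theta> b)" unfolding closed_halfspace_iff using assms(2) by blast
  moreover have "x \<in> cap \<theta> b" using assms by (simp add: mem_cap)
  ultimately show "prob (cap \<theta> b) \<in> {measure \<mu> H |H. closed_halfspace n H \<and> x \<in> H}" by blast
qed

lemma depth_ge:
  assumes x: "x \<in> Rn n" and le: "\<And>\<theta>. direction \<theta> \<Longrightarrow> c \<le> prob (cap \<theta> (ip \<theta> x))"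
  shows "c \<le> depth x"
  unfolding tukey_depth_def
proof (rule cInf_greatest)
  show "{measure \<mu> H |H. closed_halfspace n H \<and> x \<in> H} \<noteq> {}"
  proof -
    have "closed_halfspace n (cap (\<lambda>i\<in>{..<n}. 1) (ip (\<lambda>i\<in>{..<n}. 1) x))"
      unfolding closed_halfspace_iff using direction_exists by blast
    moreover have "x \<in> cap (\<lambda>i\<in>{..<n}. 1) (ip (\<lambda>i\<in>{..<n}. 1) x)" using x by (simp add: mem_cap)
    ultimately show ?thesis by blast
  qed
  fix m assume "m \<in> {measure \<mu> H |H. closed_halfspace n H \<and> x \<in> H}"
  then obtain \<theta> b where *: "direction \<theta>" "x \<in> cap \<theta> b" "m = prob (cap \<theta> b)"
    unfolding closed_halfspace_iff by blast
  have "ip \<theta> x \<le> b" using *(2) by (simp add: mem_cap)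
  then have "prob (cap \<theta> (ip \<theta> x)) \<le> m" unfolding *(3) by (rule cap_mono)
  with le[OF *(1)] show "c \<le> m" by simp
qed

lemma depth_less:
  assumes "x \<in> Rn n" "depth x < s"
  obtains \<theta> where "direction \<theta>" "prob (cap \<theta> (ip \<theta> x)) < s"
proof (rule ccontr)
  assume "\<not> thesis"
  then have "s \<le> prob (cap \<theta> (ip \<theta> x))" if "direction \<theta>" for \<theta>
    using that \<open>\<And>\<theta>. direction \<theta> \<Longrightarrow> prob (cap \<theta> (ip \<theta> x)) < s \<Longrightarrow> thesis\<close> not_le by blast
  then have "s \<le> depth x" by (rule depth_ge[OF assms(1)])
  then show False using assms(2) by simp
qed

lemma depth_nonneg: "x \<in> Rn n \<Longrightarrow> 0 \<le> depth x"
  by (rule depth_ge) auto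

lemma depth_le_1: "x \<in> Rn n \<Longrightarrow> depth x \<le> 1"
  using depth_le[OF _ direction_exists order_refl, of x] prob_le_1 by (rule order_trans)

text \<open>
  Continuity of \<open>\<mu>\<close> from above: a small enlargement of a half-space keeps its measure below a strict
  bound. This leaves the room that is needed to move to rational half-spaces, and to points
  where the distribution function of a linear functional has a tangent.
\<close>

lemma cap_continuous:
  assumes "prob (cap \<theta> t) < s"
  obtains \<eta> where "\<eta> > 0" "prob (cap \<theta> (t + \<eta>)) < s"
proof -
  have "(\<lambda>k. prob (cap \<theta> (t + 1 / real (Suc k)))) \<longlonglongrightarrow> prob (\<Inter>k. cap \<theta> (t + 1 / real (Suc k)))"
  proof (rule finite_Lim_measure_decseq)
    show "decseq (\<lambda>k. cap \<theta> (t + 1 / real (Suc k)))"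
    proof (intro decseq_SucI subsetI)
      fix k x assume x: "x \<in> cap \<theta> (t + 1 / real (Suc (Suc k)))"
      have "1 / real (Suc (Suc k)) \<le> 1 / real (Suc k)" by (intro divide_left_mono) auto
      then show "x \<in> cap \<theta> (t + 1 / real (Suc k))"
        using x unfolding mem_cap by linarith
    qed
  qed auto
  moreover have "(\<Inter>k. cap \<theta> (t + 1 / real (Suc k))) = cap \<theta> t"
  proof (intro equalityI subsetI)
    fix y assume y: "y \<in> (\<Inter>k. cap \<theta> (t + 1 / real (Suc k)))"
    have "ip \<theta> y \<le> t"
    proof (rule field_le_epsilon)
      fix e :: real assume "e > 0"
      then obtain k where "1 / real (Suc k) < e" using nat_approx_posE by auto
      moreover have "ip \<theta> y \<le> t + 1 / real (Suc k)" using y by (auto simp: mem_cap)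
      ultimately show "ip \<theta> y \<le> t + e" by simp
    qed
    then show "y \<in> cap \<theta> t" using y by (auto simp: mem_cap)
  qed (auto simp: mem_cap intro: order_trans)
  ultimately have "\<forall>\<^sub>F k in sequentially. prob (cap \<theta> (t + 1 / real (Suc k))) < s"
    using assms by (auto dest: order_tendstoD(2))
  then obtain k where "prob (cap \<theta> (t + 1 / real (Suc k))) < s" by (auto simp: eventually_sequentially)
  then show ?thesis by (intro that[of "1 / real (Suc k)"]) auto
qed

lemma inner_diff_le:
  fixes \<theta> \<theta>' y :: "nat \<Rightarrow> real" and e B :: real
  assumes "\<And>i. i < n \<Longrightarrow> \<bar>\<theta>' i - \<theta> i\<bar> \<le> e" "\<And>i. i < n \<Longrightarrow> \<bar>y i\<bar> \<le> B" "e \<ge> 0"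
  shows "\<bar>ip \<theta>' y - ip \<theta> y\<bar> \<le> n * e * B"
proof -
  have "\<bar>ip \<theta>' y - ip \<theta> y\<bar> = \<bar>\<Sum>i<n. (\<theta>' i - \<theta> i) * y i\<bar>"
    by (simp add: Rn_inner_def left_diff_distrib flip: sum_subtractf)
  also have "\<dots> \<le> (\<Sum>i<n. \<bar>\<theta>' i - \<theta> i\<bar> * \<bar>y i\<bar>)"
    by (rule order_trans[OF sum_abs]) (simp add: abs_mult)
  also have "\<dots> \<le> (\<Sum>i<n. e * B)"
    using assms by (intro sum_mono mult_mono) auto
  finally show ?thesis by simp
qed

text \<open>
  Countably many half-spaces suffice, which makes the depth measurable. Given a half-space at \<open>x\<close>
  of measure below \<open>s\<close>, enlarge it by \<open>\<eta>\<close>. As \<open>K\<close> is bounded, a rational direction close to \<open>\<theta>\<close>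
  changes the linear functional on \<open>K\<close> and at \<open>x\<close> by at most \<open>\<eta> / 4\<close>, so some rational half-space
  lies in between.
\<close>

lemma depth_less_iff_rational:
  assumes x: "x \<in> Rn n"
  shows "depth x < s \<longleftrightarrow> (\<exists>\<theta>\<in>{\<theta> \<in> {..<n} \<rightarrow>\<^sub>E \<rat>. direction \<theta>}. \<exists>b\<in>\<rat>. ip \<theta> x \<le> b \<and> prob (cap \<theta> b) < s)"
proof
  assume "depth x < s"
  then obtain \<theta> where \<theta>: "direction \<theta>" "prob (cap \<theta> (ip \<theta> x)) < s" by (rule depth_less[OF x])
  then obtain \<eta> where \<eta>: "\<eta> > 0" "prob (cap \<theta> (ip \<theta> x + \<eta>)) < s" using cap_continuous by blast
  obtain i0 where i0: "i0 < n" "\<theta> i0 \<noteq> 0" using \<theta> by (auto simp: direction_def)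
  obtain R where R: "R > 0" "K \<subseteq> Rn_cube n R" by (rule K_bounded)
  define B where "B = R + (\<Sum>i<n. \<bar>x i\<bar>)"
  have B: "B > 0" using R by (simp add: B_def add_pos_nonneg sum_nonneg)
  define e where "e = min (\<eta> / (4 * n * B)) (\<bar>\<theta> i0\<bar> / 2)"
  have e: "e > 0" "n * e * B \<le> \<eta> / 4" "e < \<bar>\<theta> i0\<bar>"
    using \<eta> B n_pos i0 by (auto simp: e_def min_def field_simps)
  have "\<exists>q\<in>\<rat>. \<bar>q - \<theta> i\<bar> \<le> e" for i
    using Rats_dense_in_real[of "\<theta> i" "\<theta> i + e"] e by force
  then obtain q where q: "\<And>i. q i \<in> \<rat>" "\<And>i. \<bar>q i - \<theta> i\<bar> \<le> e" by metis
  define \<theta>' where "\<theta>' = restrict q {..<n}"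
  have \<theta>': "\<bar>\<theta>' i - \<theta> i\<bar> \<le> e" if "i < n" for i using q that by (simp add: \<theta>'_def)
  have dir: "\<theta>' \<in> {\<theta> \<in> {..<n} \<rightarrow>\<^sub>E \<rat>. direction \<theta>}"
  proof -
    have "\<theta>' i0 \<noteq> 0" using \<theta>'[OF i0(1)] e(3) by auto
    then show ?thesis using q i0 by (auto simp: \<theta>'_def direction_def)
  qed
  have xB: "\<bar>x i\<bar> \<le> B" if "i < n" for i
    using member_le_sum[of i "{..<n}" "\<lambda>i. \<bar>x i\<bar>"] that R by (simp add: B_def)
  have KB: "\<bar>y i\<bar> \<le> B" if "i < n" "y \<in> K" for i y
  proof -
    have "\<bar>y i\<bar> \<le> R" using that R(2) by (auto simp: in_cube_iff)
    also have "R \<le> B" by (simp add: B_def sum_nonneg)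
    finally show ?thesis .
  qed
  obtain b where b: "b \<in> \<rat>" "ip \<theta> x + \<eta> / 4 < b" "b < ip \<theta> x + \<eta> / 2"
    using Rats_dense_in_real[of "ip \<theta> x + \<eta> / 4" "ip \<theta> x + \<eta> / 2"] \<eta> by auto
  have le_b: "ip \<theta>' x \<le> b"
    using inner_diff_le[of \<theta>' \<theta> e x B, OF \<theta>' xB] e b by linarith
  have "prob (cap \<theta>' b) \<le> prob (cap \<theta> (ip \<theta> x + \<eta>))"
  proof (rule finite_measure_mono_AE)
    show "AE y in \<mu>. y \<in> cap \<theta>' b \<longrightarrow> y \<in> cap \<theta> (ip \<theta> x + \<eta>)"
      using AE_K
    proof eventually_elim
      case (elim y)
      then have "\<bar>ip \<theta>' y - ip \<theta> y\<bar> \<le> \<eta> / 4"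
        using inner_diff_le[of \<theta>' \<theta> e y B, OF \<theta>' KB[OF _ elim]] e by linarith
      then have "ip \<theta> y \<le> ip \<theta>' y + \<eta> / 4" by linarith
      then show ?case using b(3) \<eta>(1) by (simp add: mem_cap)
    qed
  qed simp
  then have "prob (cap \<theta>' b) < s" using \<eta>(2) by (rule le_less_trans)
  then show "\<exists>\<theta>\<in>{\<theta> \<in> {..<n} \<rightarrow>\<^sub>E \<rat>. direction \<theta>}. \<exists>b\<in>\<rat>. ip \<theta> x \<le> b \<and> prob (cap \<theta> b) < s"
    using dir b(1) le_b by blast
next
  assume "\<exists>\<theta>\<in>{\<theta> \<in> {..<n} \<rightarrow>\<^sub>E \<rat>. direction \<theta>}. \<exists>b\<in>\<rat>. ip \<theta> x \<le> b \<and> prob (cap \<theta> b) < s"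
  then obtain \<theta> b where "direction \<theta>" "ip \<theta> x \<le> b" "prob (cap \<theta> b) < s" by blast
  then show "depth x < s" using depth_le[OF x, of \<theta> b] by simp
qed

lemma depth_measurable [measurable]: "depth \<in> borel_measurable (Rn_lborel n)"
proof (rule borel_measurableI_less)
  fix s
  let ?T = "{\<theta> \<in> {..<n} \<rightarrow>\<^sub>E \<rat>. direction \<theta>}"
  have "countable ({..<n} \<rightarrow>\<^sub>E (\<rat> :: real set))" by (intro countable_PiE) (auto intro: countable_rat)
  then have c: "countable ?T" by (rule countable_subset[rotated]) auto
  have "{x \<in> space (Rn_lborel n). depth x < s} =
      (\<Union>\<theta>\<in>?T. \<Union>b\<in>{b\<in>\<rat>. prob (cap \<theta> b) < s}. cap \<theta> b)"
  proof (rule set_eqI)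
    fix x
    show "x \<in> {x \<in> space (Rn_lborel n). depth x < s} \<longleftrightarrow>
        x \<in> (\<Union>\<theta>\<in>?T. \<Union>b\<in>{b\<in>\<rat>. prob (cap \<theta> b) < s}. cap \<theta> b)"
    proof (cases "x \<in> Rn n")
      case True
      then have "x \<in> space (Rn_lborel n)" by (simp add: space_PiM)
      moreover have "x \<in> cap \<theta> b \<longleftrightarrow> ip \<theta> x \<le> b" for \<theta> b using True by (simp add: mem_cap)
      ultimately show ?thesis using depth_less_iff_rational[OF True, of s] by blast
    next
      case False
      then have "x \<notin> space (Rn_lborel n)" by (simp add: space_PiM)
      moreover have "x \<notin> cap \<theta> b" for \<theta> b using False by (simp add: mem_cap)
      ultimately show ?thesis by blast
    qed
  qed
  also have "\<dots> \<in> sets (Rn_lborel n)"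
    using c by (intro sets.countable_UN'') (auto intro: countable_subset[OF _ countable_rat])
  finally show "{x \<in> space (Rn_lborel n). depth x < s} \<in> sets (Rn_lborel n)" .
qed

text \<open>
  The homothety with centre \<open>y\<close> and factor \<open>u\<close> maps the part of \<open>K\<close> in the half-space bounded at \<open>x\<close>
  into the part of \<open>K\<close> in the parallel half-space bounded at the image of \<open>x\<close>.
\<close>

lemma depth_homothety:
  assumes x: "x \<in> K" and y: "y \<in> K" and u: "0 < u" "u \<le> 1"
  shows "u ^ n * depth x \<le> depth (Rn_comb n u x (1 - u) y)"
proof (rule depth_ge)
  fix \<theta> assume \<theta>: "direction \<theta>"
  have "u ^ n * depth x \<le> u ^ n * prob (cap \<theta> (ip \<theta> x))"
    using depth_le[OF _ \<theta> order_refl, of x] x K_Rn u by (intro mult_left_mono) auto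
  also have "\<dots> \<le> prob (cap \<theta> (ip \<theta> (Rn_comb n u x (1 - u) y)))"
    using u y by (intro measure_\<mu>_homothety[OF u y]) (auto simp: mem_cap inner_comb mult_left_mono)
  finally show "u ^ n * depth x \<le> prob (cap \<theta> (ip \<theta> (Rn_comb n u x (1 - u) y)))" .
qed auto

definition "deep s = {x \<in> Rn n. s \<le> depth x}"

lemma mem_deep: "x \<in> deep s \<longleftrightarrow> x \<in> Rn n \<and> s \<le> depth x"
  unfolding deep_def by (rule mem_Collect_eq)

lemma deep_sets [measurable, simp]: "deep s \<in> sets (Rn_lborel n)"
proof -
  have "{x \<in> space (Rn_lborel n). s \<le> depth x} \<in> sets (Rn_lborel n)" by measurable
  moreover have "{x \<in> space (Rn_lborel n). s \<le> depth x} = deep s"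
    unfolding deep_def by (simp add: space_PiM)
  ultimately show ?thesis by simp
qed

lemma deep_mono:
  assumes "s \<le> t"
  shows "prob (deep t) \<le> prob (deep s)"
proof (rule finite_measure_mono)
  show "deep t \<subseteq> deep s" using assms by (auto simp: mem_deep)
qed simp

text \<open>
  The key to concentration. Combinations of points of depth at least \<open>s\<close> with arbitrary points
  of \<open>K\<close> have depth at least \<open>u\<^sup>n s\<close>, and the measure of \<open>K\<close> itself is \<open>1\<close>.
\<close>

lemma measure_deep_powr:
  assumes u: "0 < u" "u < 1" and s: "s \<ge> 0"
  shows "prob (deep s) powr u \<le> prob (deep (u ^ n * s))"
proof -
  have "prob (deep s) powr u * prob (Rn n) powr (1 - u) \<le> prob (deep (u ^ n * s))"
  proof (rule measure_\<mu>_log_concave)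
    show "Rn n \<in> sets (Rn_lborel n)" by (metis sets.top space_\<mu> sets_\<mu>)
    fix x y assume "x \<in> deep s \<inter> K" "y \<in> Rn n \<inter> K"
    then have *: "x \<in> K" "y \<in> K" "s \<le> depth x" by (auto simp: mem_deep)
    have "u ^ n * s \<le> u ^ n * depth x" using * u by (intro mult_left_mono) auto
    also have "\<dots> \<le> depth (Rn_comb n u x (1 - u) y)" using * u by (intro depth_homothety) auto
    finally show "Rn_comb n u x (1 - u) y \<in> deep (u ^ n * s)"
      by (auto simp: mem_deep)
  qed (use u in auto)
  then show ?thesis using prob_space by simp
qed

text \<open>
  Around each point \<open>x\<close> of a small cube inside \<open>K\<close> one of the orthants of a cube centred at \<open>x\<close> lies
  in any given half-space containing \<open>x\<close>, so the depth is bounded below there.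
\<close>

lemma deep_positive: obtains s where "s > 0" "prob (deep s) > 0"
proof -
  obtain c r where c: "c \<in> Rn n" "r > 0" "Rn_cell n c r \<subseteq> K" by (rule K_cell)
  define s where "s = (r / 2) ^ n / vol K"
  have s: "s > 0" using c vol_K_pos by (simp add: s_def)
  have boxK: "(r / 2) ^ n / vol K \<le> prob D"
    if D: "D \<in> sets (Rn_lborel n)" and a: "PiE {..<n} (\<lambda>i. {a i..a i + r / 2}) \<subseteq> K \<inter> D" for a D
  proof -
    have "ennreal ((r / 2) ^ n) = evol (PiE {..<n} (\<lambda>i. {a i..a i + r / 2}))"
      using c(2) by (subst emeasure_Rn_box) (auto simp: prod_constant)
    also have "\<dots> \<le> evol (K \<inter> D)" using a D by (intro emeasure_mono) auto
    also have "\<dots> = ennreal (vol (K \<inter> D))" by (rule emeasure_K_Int[OF D])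
    finally have "(r / 2) ^ n \<le> vol (K \<inter> D)" by (simp add: ennreal_le_iff)
    then show ?thesis using vol_K_pos D by (simp add: measure_\<mu> divide_right_mono)
  qed
  have "PiE {..<n} (\<lambda>i. {c i..c i + r / 2}) \<subseteq> K \<inter> deep s"
  proof
    fix x assume x: "x \<in> PiE {..<n} (\<lambda>i. {c i..c i + r / 2})"
    then have xc: "c i \<le> x i" "x i \<le> c i + r / 2" if "i < n" for i using that by (auto simp: PiE_iff)
    have "\<bar>x i - c i\<bar> \<le> r" if "i < n" for i using xc[OF that] c(2) by (simp add: abs_le_iff)
    moreover have "x \<in> Rn n" using x by (simp add: PiE_iff)
    ultimately have xK: "x \<in> K" using c(3) by blast
    have "s \<le> depth x"
    proof (rule depth_ge)
      show "x \<in> Rn n" using xK K_Rn by auto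
      fix \<theta> :: "nat \<Rightarrow> real"
      \<comment> \<open>The lower corner of the orthant on which the functional does not exceed its value at \<open>x\<close>.\<close>
      let ?a = "\<lambda>i. if \<theta> i \<ge> 0 then x i - r / 2 else x i"
      show "s \<le> prob (cap \<theta> (ip \<theta> x))"
        unfolding s_def
      proof (rule boxK[of _ ?a])
        show "PiE {..<n} (\<lambda>i. {?a i..?a i + r / 2}) \<subseteq> K \<inter> cap \<theta> (ip \<theta> x)"
        proof
          fix y assume y: "y \<in> PiE {..<n} (\<lambda>i. {?a i..?a i + r / 2})"
          then have yx: "?a i \<le> y i" "y i \<le> ?a i + r / 2" if "i < n" for i using that by (auto simp: PiE_iff)
          have "\<bar>y i - c i\<bar> \<le> r" if "i < n" for i
            using yx[OF that] xc[OF that] c(2) by (auto simp: abs_le_iff split: if_splits)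
          moreover have "ip \<theta> y \<le> ip \<theta> x" unfolding Rn_inner_def
          proof (rule sum_mono)
            fix i assume "i \<in> {..<n}"
            then show "\<theta> i * y i \<le> \<theta> i * x i" using yx[of i]
              by (cases "\<theta> i \<ge> 0") (auto intro: mult_left_mono mult_left_mono_neg)
          qed
          moreover have "y \<in> Rn n" using y by (simp add: PiE_iff)
          ultimately show "y \<in> K \<inter> cap \<theta> (ip \<theta> x)" using c(3) by (auto simp: mem_cap)
        qed
      qed simp
    qed
    then show "x \<in> K \<inter> deep s" using xK K_Rn by (auto simp: mem_deep)
  qed
  then have "s \<le> prob (deep s)" unfolding s_def by (intro boxK) auto
  with s show ?thesis by (intro that[of s]) auto
qed

text \<open>
  The inequalities are imposed off \<open>s0\<close> only; the supremum of the levels of measure at least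
  \<open>1 / 2\<close> then qualifies, whether or not the distribution of the depth is continuous.
\<close>

definition "is_median s0 \<longleftrightarrow> 0 < s0 \<and> s0 \<le> 1 \<and> (\<forall>s<s0. prob (deep s) \<ge> 1 / 2) \<and>
    (\<forall>s>s0. prob (deep s) \<le> 1 / 2)"

text \<open>
  The supremum of the levels whose superlevel set has measure at least \<open>1 / 2\<close>. Such levels exist:
  a positive measure \<open>p\<close> of some superlevel set becomes \<open>p powr u = 1 / 2\<close> for a suitable \<open>u\<close>.
\<close>

lemma median_exists: obtains s0 where "is_median s0"
proof -
  let ?S = "{s. prob (deep s) \<ge> 1 / 2}"
  obtain s1 where s1: "s1 > 0" "prob (deep s1) > 0" by (rule deep_positive)
  have "\<exists>s>0. s \<in> ?S"
  proof (cases "prob (deep s1) \<ge> 1 / 2")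
    case False
    define p where "p = prob (deep s1)"
    have p: "0 < p" "p < 1 / 2" using False s1 by (auto simp: p_def)
    \<comment> \<open>The solution of \<open>p powr u = 1 / 2\<close>.\<close>
    define u where "u = ln (1 / 2) / ln p"
    have lnp: "ln p < ln (1 / 2)" using p by (subst ln_less_cancel_iff) auto
    have "ln (1 / 2) < (0::real)" by simp
    then have u: "0 < u" "u < 1" using lnp unfolding u_def by (simp_all add: divide_neg_neg neg_divide_less_eq del: ln_less_zero_iff)
    have "p powr u = 1 / 2" using p lnp by (auto simp: powr_def u_def exp_minus)
    then have "prob (deep (u ^ n * s1)) \<ge> 1 / 2"
      using measure_deep_powr[OF u, of s1] s1 by (simp add: p_def)
    then show ?thesis using u s1 by (intro exI[of _ "u ^ n * s1"]) auto
  qed (use s1 in auto)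
  then obtain s2 where s2: "s2 > 0" "s2 \<in> ?S" by auto
  have le1: "s \<le> 1" if "s \<in> ?S" for s
  proof (rule ccontr)
    assume "\<not> s \<le> 1"
    then have "deep s = {}" using depth_le_1 by (force simp: mem_deep)
    then show False using that by simp
  qed
  have bdd: "bdd_above ?S" using le1 by (intro bdd_aboveI[of _ 1])
  have "is_median (Sup ?S)"
    unfolding is_median_def
  proof (intro conjI allI impI)
    show "0 < Sup ?S" using cSup_upper[OF s2(2) bdd] s2 by simp
    show "Sup ?S \<le> 1" using s2 le1 by (intro cSup_least) auto
    show "prob (deep s) \<ge> 1 / 2" if less: "s < Sup ?S" for s
    proof -
      have "\<exists>t\<in>?S. s < t" by (subst less_cSup_iff[OF _ bdd, symmetric]) (use s2 less in auto)
      then obtain t where "t \<in> ?S" "s < t" by blast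
      then show ?thesis using deep_mono[of s t] by auto
    qed
    show "prob (deep s) \<le> 1 / 2" if "s > Sup ?S" for s
      using cSup_upper[OF _ bdd, of s] that by (cases "s \<in> ?S") auto
  qed
  then show ?thesis by (rule that)
qed

text \<open>
  Both tail bounds apply \<open>measure_deep_powr\<close> with \<open>u = exp (- a / 2)\<close>. Half of the distance \<open>n a\<close> is
  spent on getting away from the median, the other half is the factor \<open>u\<^sup>n\<close>.
\<close>

lemma depth_upper_tail:
  fixes a :: real
  assumes s0: "is_median s0" and a: "a > 0"
  shows "prob (deep (s0 * exp (- (n * a)))) \<ge> (1 / 2) powr exp (- a / 2)"
proof -
  define u where "u = exp (- a / 2)"
  have u: "0 < u" "u < 1" using a by (auto simp: u_def)
  have un: "u ^ n = exp (- (n * a) / 2)" by (simp add: u_def flip: exp_of_nat_mult)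
  define s where "s = s0 * exp (- (n * a) / 2)"
  have "s < s0" using s0 a n_pos by (auto simp: s_def is_median_def)
  then have "(1 / 2) powr u \<le> prob (deep s) powr u"
    using s0 u by (intro powr_mono2) (auto simp: is_median_def)
  also have "\<dots> \<le> prob (deep (u ^ n * s))"
    using u s0 by (intro measure_deep_powr) (auto simp: s_def is_median_def)
  also have "u ^ n * s = s0 * exp (- (n * a))" by (simp add: un s_def flip: exp_add)
  finally show ?thesis by (simp add: u_def)
qed

lemma depth_lower_tail:
  fixes a :: real
  assumes s0: "is_median s0" and a: "a > 0"
  shows "prob (deep (s0 * exp (n * a))) \<le> (1 / 2) powr exp (a / 2)"
proof -
  define u where "u = exp (- a / 2)"
  have u: "0 < u" "u < 1" using a by (auto simp: u_def)
  have un: "u ^ n = exp (- (n * a) / 2)" by (simp add: u_def flip: exp_of_nat_mult)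
  define s where "s = s0 * exp (n * a)"
  have "prob (deep s) powr u \<le> prob (deep (u ^ n * s))"
    using u s0 by (intro measure_deep_powr) (auto simp: s_def is_median_def)
  also have "u ^ n * s = s0 * exp (n * a / 2)" by (simp add: un s_def flip: exp_add)
  also have "prob (deep (s0 * exp (n * a / 2))) \<le> 1 / 2"
    using s0 a n_pos by (auto simp: is_median_def)
  finally have "(prob (deep s) powr u) powr (1 / u) \<le> (1 / 2) powr (1 / u)"
    using u by (intro powr_mono2) auto
  then show ?thesis using u by (simp add: powr_powr s_def) (simp add: u_def exp_minus inverse_eq_divide)
qed

end

section \<open>The Cramer transform against the depth\<close>

text \<open>
  One plus the geometric series that bounds the moment in \<open>exp_moment_of_exp_tail\<close>.
\<close>

definition exp_tail_const :: "real \<Rightarrow> real" where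
  "exp_tail_const c = 1 + exp c / (1 - exp (c - 1))"

lemma exp_tail_const_pos: "c < 1 \<Longrightarrow> exp_tail_const c > 0"
  unfolding exp_tail_const_def by (intro add_pos_nonneg divide_nonneg_nonneg) auto

text \<open>
  A variable with the tail of a standard exponential one has exponential moments of every order
  \<open>c < 1\<close>, bounded in terms of \<open>c\<close>: the contributions of the integer levels form a geometric
  series.
\<close>

lemma (in prob_space) exp_moment_of_exp_tail:
  assumes [measurable]: "X \<in> borel_measurable M" and c: "0 < c" "c < 1"
    and tail: "\<And>k::nat. measure M {x \<in> space M. real k \<le> X x} \<le> exp (- real k)"
  shows "(\<integral>\<^sup>+x. ennreal (exp (c * X x)) \<partial>M) \<le> ennreal (exp_tail_const c)"
proof -
  let ?A = "\<lambda>k::nat. {x \<in> space M. real k \<le> X x}"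
  have "(\<integral>\<^sup>+x. ennreal (exp (c * X x)) \<partial>M) \<le>
      (\<integral>\<^sup>+x. 1 + (\<Sum>k. ennreal (exp (c * (real k + 1))) * indicator (?A k) x) \<partial>M)"
  proof (rule nn_integral_mono)
    fix x assume x: "x \<in> space M"
    show "ennreal (exp (c * X x)) \<le> 1 + (\<Sum>k. ennreal (exp (c * (real k + 1))) * indicator (?A k) x)"
    proof (cases "X x \<ge> 0")
      case True
      define k where "k = nat \<lfloor>X x\<rfloor>"
      have k: "real k \<le> X x" "X x \<le> real k + 1" using True by (auto simp: k_def)
      define f where "f j = ennreal (exp (c * (real j + 1))) * indicator (?A j) x" for j
      have "ennreal (exp (c * X x)) \<le> f k"
        using k x c by (auto simp: f_def intro!: ennreal_leI)
      also have "f k = sum f {k}" by simp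
      also have "\<dots> \<le> suminf f" by (intro sum_le_suminf) auto
      also have "suminf f \<le> 1 + suminf f" by (simp add: add_increasing)
      finally show ?thesis unfolding f_def .
    next
      case False
      then have "exp (c * X x) \<le> 1" using c by (simp add: mult_le_0_iff)
      then have "ennreal (exp (c * X x)) \<le> 1" by (simp add: ennreal_le_1)
      then show ?thesis by (simp add: add_increasing2)
    qed
  qed
  also have "\<dots> = 1 + (\<Sum>k. ennreal (exp (c * (real k + 1))) * emeasure M (?A k))"
    by (simp add: nn_integral_add nn_integral_suminf nn_integral_cmult emeasure_space_1)
  also have "\<dots> \<le> 1 + (\<Sum>k. ennreal (exp c * exp (c - 1) ^ k))"
  proof (intro add_left_mono suminf_le)
    fix k :: nat
    have "ennreal (exp (c * (real k + 1))) * emeasure M (?A k) \<le> ennreal (exp (c * (real k + 1))) * ennreal (exp (- real k))"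
      using tail[of k] by (intro mult_left_mono) (auto simp: emeasure_eq_measure intro!: ennreal_leI)
    also have "\<dots> = ennreal (exp c * exp (c - 1) ^ k)"
    proof -
      have "c * (real k + 1) + - real k = c + real k * (c - 1)" by (simp add: algebra_simps)
      then have "exp (c * (real k + 1)) * exp (- real k) = exp c * exp (c - 1) ^ k"
        by (simp only: exp_add[symmetric] exp_of_nat_mult[symmetric])
      then show ?thesis by (simp flip: ennreal_mult)
    qed
    finally show "ennreal (exp (c * (real k + 1))) * emeasure M (?A k) \<le> ennreal (exp c * exp (c - 1) ^ k)" .
  qed auto
  also have "(\<Sum>k. ennreal (exp c * exp (c - 1) ^ k)) = ennreal (exp c * (1 / (1 - exp (c - 1))))"
    using c by (intro suminf_ennreal_eq sums_mult geometric_sums) auto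
  also have "1 + ennreal (exp c * (1 / (1 - exp (c - 1)))) = ennreal (exp_tail_const c)"
    using c unfolding exp_tail_const_def by (subst ennreal_plus) auto
  finally show ?thesis .
qed

context body begin

lemma prob_Rn [simp]: "prob (Rn n) = 1"
  using prob_space by simp

definition "mgf \<theta> = (\<integral>y. exp (ip \<theta> y) \<partial>\<mu>)"

lemma ip_bounded_on_K: "\<exists>B>t. \<forall>y\<in>K. ip \<theta> y \<le> B"
proof -
  obtain R where R: "R > 0" "K \<subseteq> Rn_cube n R" by (rule K_bounded)
  define B where "B = \<bar>t\<bar> + 1 + (\<Sum>i<n. \<bar>\<theta> i\<bar> * R)"
  have S: "(\<Sum>i<n. \<bar>\<theta> i\<bar> * R) \<ge> 0" using R by (intro sum_nonneg) auto
  have "ip \<theta> y \<le> B" if "y \<in> K" for y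
  proof -
    have y: "\<bar>y i\<bar> \<le> R" if "i < n" for i using R(2) \<open>y \<in> K\<close> that in_cube_iff[of y n R] by blast
    have "ip \<theta> y \<le> (\<Sum>i<n. \<bar>\<theta> i\<bar> * R)" unfolding Rn_inner_def
    proof (rule sum_mono)
      fix i assume "i \<in> {..<n}"
      then have "\<bar>\<theta> i\<bar> * \<bar>y i\<bar> \<le> \<bar>\<theta> i\<bar> * R" using y by (intro mult_left_mono) auto
      then show "\<theta> i * y i \<le> \<bar>\<theta> i\<bar> * R" using abs_le_D1[of "\<theta> i * y i"] by (simp add: abs_mult)
    qed
    then show ?thesis by (simp add: B_def)
  qed
  moreover have "B > t" using S by (simp add: B_def)
  ultimately show ?thesis by blast
qed

lemma integrable_exp_ip: "integrable \<mu> (\<lambda>y. exp (ip \<theta> y))"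
proof -
  obtain B where B: "\<forall>y\<in>K. ip \<theta> y \<le> B" using ip_bounded_on_K[of 0 \<theta>] by blast
  have "AE y in \<mu>. norm (exp (ip \<theta> y)) \<le> exp B"
    using AE_K by eventually_elim (simp add: B)
  then show ?thesis by (rule integrable_const_bound) measurable
qed

lemma mgf_pos: "mgf \<theta> > 0"
proof -
  have "mgf \<theta> \<ge> 0" by (simp add: mgf_def)
  moreover have "mgf \<theta> \<noteq> 0"
  proof
    assume "mgf \<theta> = 0"
    then have "AE y in \<mu>. exp (ip \<theta> y) = 0"
      unfolding mgf_def using integrable_exp_ip by (subst (asm) integral_nonneg_eq_0_iff_AE) auto
    then have "AE y in \<mu>. False" by (rule AE_mp) simp
    then show False by simp
  qed
  ultimately show ?thesis by simp
qed

lemma mgf_nn: "(\<integral>\<^sup>+y. ennreal (exp (ip \<theta> y)) \<partial>\<mu>) = ennreal (mgf \<theta>)"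
  unfolding mgf_def by (rule nn_integral_eq_integral[OF integrable_exp_ip]) simp

lemma cramer_alt: "cramer x = (SUP \<theta>\<in>Rn n. ereal (ip \<theta> x - ln (mgf \<theta>)))"
  by (simp add: cramer_transform_def mgf_def)

lemma cramer_ge: "\<theta> \<in> Rn n \<Longrightarrow> ereal (ip \<theta> x - ln (mgf \<theta>)) \<le> cramer x"
  unfolding cramer_alt by (rule SUP_upper)

lemma ip_scale: "ip (\<lambda>i\<in>{..<n}. a * \<theta> i) y = a * ip \<theta> y"
  by (simp add: Rn_inner_def sum_distrib_left mult.assoc)

text \<open>
  Markov's inequality for the exponential of the linear functional. A vector without a non-zero
  coordinate defines no half-space; there the claim is that the depth is at most \<open>1\<close>.
\<close>

lemma depth_le_exp:
  assumes x: "x \<in> Rn n" and \<theta>: "\<theta> \<in> Rn n"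
  shows "depth x \<le> mgf \<theta> * exp (- ip \<theta> x)"
proof (cases "direction \<theta>")
  case True
  let ?\<theta> = "\<lambda>i\<in>{..<n}. (-1) * \<theta> i"
  have dir: "direction ?\<theta>" using True unfolding direction_def by auto
  have "depth x \<le> prob (cap ?\<theta> (ip ?\<theta> x))" by (rule depth_le[OF x dir order_refl])
  also have "\<dots> = (\<integral>y. indicator (cap ?\<theta> (ip ?\<theta> x)) y \<partial>\<mu>)"
  proof -
    have "cap ?\<theta> (ip ?\<theta> x) \<inter> Rn n = cap ?\<theta> (ip ?\<theta> x)" by (auto simp: mem_cap)
    then show ?thesis by simp
  qed
  also have "\<dots> \<le> (\<integral>y. exp (ip \<theta> y) * exp (- ip \<theta> x) \<partial>\<mu>)"
  proof (rule integral_mono)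
    fix y
    show "indicator (cap ?\<theta> (ip ?\<theta> x)) y \<le> exp (ip \<theta> y) * exp (- ip \<theta> x)"
    proof (cases "y \<in> cap ?\<theta> (ip ?\<theta> x)")
      case True
      then have "0 \<le> ip \<theta> y + - ip \<theta> x" unfolding mem_cap ip_scale by simp
      then show ?thesis unfolding exp_add[symmetric] using True by simp
    qed simp
  qed (use integrable_exp_ip in \<open>auto intro!: integrable_real_indicator simp: emeasure_eq_measure\<close>)
  also have "\<dots> = mgf \<theta> * exp (- ip \<theta> x)" by (simp add: mgf_def)
  finally show ?thesis .
next
  case False
  then have "ip \<theta> y = 0" for y using \<theta> by (auto simp: direction_def Rn_inner_def intro!: sum.neutral)
  then show ?thesis using depth_le_1[OF x] by (simp add: mgf_def prob_space)
qed

theorem cramer_le_neg_log_depth: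
  assumes x: "x \<in> Rn n"
  shows "cramer x \<le> neg_log x"
proof (cases "depth x = 0")
  case False
  then have d: "depth x > 0" using depth_nonneg[OF x] by simp
  show ?thesis unfolding cramer_alt
  proof (rule SUP_least)
    fix \<theta> assume "\<theta> \<in> Rn n"
    then have "ln (depth x) \<le> ln (mgf \<theta> * exp (- ip \<theta> x))"
      using depth_le_exp[OF x] d by (subst ln_le_cancel_iff) (auto intro: less_le_trans)
    then show "ereal (ip \<theta> x - ln (mgf \<theta>)) \<le> neg_log x"
      using d mgf_pos[of \<theta>] by (simp add: neg_log_depth_def ln_mult)
  qed
qed (simp add: neg_log_depth_def)

lemma cap_log_concave:
  assumes "u > 0" "v > 0" "u + v = 1"
  shows "prob (cap \<theta> a) powr u * prob (cap \<theta> b) powr v \<le> prob (cap \<theta> (u * a + v * b))"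
proof (rule measure_\<mu>_log_concave[OF assms])
  fix x y assume "x \<in> cap \<theta> a \<inter> K" "y \<in> cap \<theta> b \<inter> K"
  then have "u * ip \<theta> x \<le> u * a" "v * ip \<theta> y \<le> v * b" using assms by (auto simp: mem_cap)
  then show "Rn_comb n u x v y \<in> cap \<theta> (u * a + v * b)"
    unfolding mem_cap inner_comb by simp
qed auto

lemma cap_full: obtains B where "B > t" "prob (cap \<theta> B) = 1"
proof -
  obtain B where B: "B > t" "\<forall>y\<in>K. ip \<theta> y \<le> B" using ip_bounded_on_K[of t \<theta>] by blast
  have "AE y in \<mu>. y \<in> cap \<theta> B"
    using AE_K
  proof eventually_elim
    case (elim y)
    then show ?case using B(2) K_Rn unfolding mem_cap by blast
  qed
  then have "prob (cap \<theta> B) = 1" by (subst prob_eq_1) auto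
  with B(1) show ?thesis by (rule that)
qed

text \<open>
  The number \<open>- k\<close> is the slope at \<open>t'\<close> of a supporting line of the convex function \<open>- ln\<close> of the
  distribution function. Positivity at the point \<open>t\<close> to the left of \<open>t'\<close> puts \<open>t'\<close> into the interior
  of the domain, so that the line exists; it is not horizontal because the value \<open>1\<close> is attained
  further right.
\<close>

lemma cap_exponential_decay:
  assumes pos: "prob (cap \<theta> t) > 0" and t': "t < t'" and lt: "prob (cap \<theta> t') < 1"
  obtains k where "k > 0" "\<And>b. prob (cap \<theta> b) \<le> prob (cap \<theta> t') * exp (- k * (t' - b))"
proof -
  define F where "F b = prob (cap \<theta> b)" for b
  define I where "I = {b. F b > 0}"
  have F_mono: "F a \<le> F b" if "a \<le> b" for a b unfolding F_def using that by (rule cap_mono)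
  have up: "{t..} \<subseteq> I"
  proof
    fix b assume "b \<in> {t..}"
    then have "F t \<le> F b" by (intro F_mono) simp
    then show "b \<in> I" using pos by (simp add: I_def F_def)
  qed
  have "{t<..} \<subseteq> I" using up by auto
  then have "{t<..} \<subseteq> interior I" by (intro interior_maximal) auto
  then have int: "t' \<in> interior I" using t' by auto
  have t'I: "t' \<in> I" using int interior_subset by blast
  have "convex_on I (\<lambda>b. - ln (F b))"
  proof (rule convex_onI)
    fix u a b :: real assume u: "0 < u" "u < 1" and ab: "a \<in> I" "b \<in> I"
    have p: "F a > 0" "F b > 0" using ab by (auto simp: I_def)
    have "F a powr (1 - u) * F b powr u \<le> F ((1 - u) * a + u * b)"
      unfolding F_def by (rule cap_log_concave) (use u in auto)
    then have "ln (F a powr (1 - u) * F b powr u) \<le> ln (F ((1 - u) * a + u * b))"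
      using p by (subst ln_le_cancel_iff) (auto intro: less_le_trans[rotated])
    then have "(1 - u) * ln (F a) + u * ln (F b) \<le> ln (F ((1 - u) * a + u * b))"
      using p by (simp add: ln_mult ln_powr)
    then show "- ln (F ((1 - u) *\<^sub>R a + u *\<^sub>R b)) \<le> (1 - u) * - ln (F a) + u * - ln (F b)" by simp
  next
    show "convex I"
    proof (rule is_interval_convex, unfold is_interval_1, intro ballI allI impI)
      fix a b x assume *: "a \<in> I" "b \<in> I" "a \<le> x \<and> x \<le> b"
      then have "F a \<le> F x" by (intro F_mono) simp
      then show "x \<in> I" using *(1) by (simp add: I_def)
    qed
  qed
  then have "\<exists>m. \<forall>b\<in>I. - ln (F b) \<ge> - ln (F t') + m * (b - t')"
    using convex_le_Inf_differential[OF _ int] by blast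
  then obtain m where m: "\<And>b. b \<in> I \<Longrightarrow> - ln (F b) \<ge> - ln (F t') + m * (b - t')" by blast
  have decay: "F b \<le> F t' * exp (- (- m) * (t' - b))" for b
  proof (cases "b \<in> I")
    case True
    have p: "F b > 0" "F t' > 0" using True t'I by (auto simp: I_def)
    have "F b = exp (ln (F b))" using p by simp
    also have "\<dots> \<le> exp (ln (F t') + - (- m) * (t' - b))" using m[OF True] by (simp add: algebra_simps)
    also have "\<dots> = F t' * exp (- (- m) * (t' - b))" using p unfolding exp_add by simp
    finally show ?thesis .
  next
    case False
    then have "F b \<le> 0" by (simp add: I_def)
    moreover have "0 \<le> F t' * exp (- (- m) * (t' - b))" by (simp add: F_def)
    ultimately show ?thesis by linarith
  qed
  obtain B where B: "B > t'" "F B = 1" unfolding F_def by (rule cap_full)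
  have "B \<in> I" using B by (simp add: I_def)
  then have "0 \<ge> - ln (F t') + m * (B - t')" using m[of B] B by simp
  moreover have "- ln (F t') > 0" using t'I lt by (simp add: I_def F_def)
  ultimately have "m * (B - t') < 0" by linarith
  then have "m < 0" using B by (simp add: mult_less_0_iff)
  then show ?thesis using decay unfolding F_def by (intro that[of "- m"]) auto
qed

text \<open>
  Take a half-space at \<open>x\<close> of measure below \<open>s\<close> and the decay rate \<open>k\<close> of its measure. The variable
  \<open>X\<close> below, an affine function of the linear functional, then has the tail of a standard
  exponential variable, and its moment of order \<open>c\<close> is the moment generating function at
  \<open>- c k \<theta>\<close>, up to the factor that produces \<open>c ln (1 / s)\<close>.
\<close>

theorem cramer_ge_neg_log_depth:
  assumes x: "x \<in> Rn n" and d: "0 < depth x" "depth x < s" and s: "s \<le> 1" and c: "0 < c" "c < 1"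
  shows "ereal (c * ln (1 / s) - ln (exp_tail_const c)) \<le> cramer x"
proof -
  obtain \<theta> where \<theta>: "direction \<theta>" "prob (cap \<theta> (ip \<theta> x)) < s"
    using depth_less[OF x d(2)] by blast
  obtain \<eta> where \<eta>: "\<eta> > 0" "prob (cap \<theta> (ip \<theta> x + \<eta>)) < s"
    using cap_continuous[OF \<theta>(2)] by blast
  define t where "t = ip \<theta> x"
  define t' where "t' = t + \<eta>"
  have pos: "prob (cap \<theta> t) > 0" using depth_le[OF x \<theta>(1) order_refl] d(1) by (simp add: t_def)
  have lt: "prob (cap \<theta> t') < s" using \<eta>(2) by (simp add: t'_def t_def)
  obtain k where k: "k > 0" "\<And>b. prob (cap \<theta> b) \<le> prob (cap \<theta> t') * exp (- k * (t' - b))"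
    using cap_exponential_decay[OF pos, of t'] \<eta>(1) lt s by (auto simp: t'_def)
  have s0: "s > 0" using d by simp
  define L where "L = ln (1 / s)"
  \<comment> \<open>The shift by \<open>L\<close> cancels the factor \<open>s\<close> that bounds the measure of the half-space.\<close>
  define X where "X y = k * (t' - ip \<theta> y) + L" for y
  have mX [measurable]: "X \<in> borel_measurable \<mu>" unfolding X_def by measurable
  have tail: "measure \<mu> {y \<in> space \<mu>. v \<le> X y} \<le> exp (- v)" for v
  proof -
    define b where "b = t' - (v - L) / k"
    have "v \<le> X y \<longleftrightarrow> ip \<theta> y \<le> b" for y
      using k(1) by (simp add: X_def b_def field_simps)
    then have "{y \<in> space \<mu>. v \<le> X y} = cap \<theta> b" unfolding cap_def by simp
    then have "measure \<mu> {y \<in> space \<mu>. v \<le> X y} \<le> prob (cap \<theta> t') * exp (- k * (t' - b))"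
      using k(2) by simp
    also have "\<dots> \<le> s * exp (- k * (t' - b))" using lt by (intro mult_right_mono) auto
    also have "- k * (t' - b) = L - v" using k(1) by (simp add: b_def)
    also have "s * exp (L - v) = exp (- v)" using s0 by (simp add: L_def exp_diff exp_minus inverse_eq_divide)
    finally show ?thesis .
  qed
  let ?\<theta> = "\<lambda>i\<in>{..<n}. (- c * k) * \<theta> i"
  have ip': "ip ?\<theta> y = - c * k * ip \<theta> y" for y by (rule ip_scale)
  have "(\<integral>\<^sup>+y. ennreal (exp (c * X y)) \<partial>\<mu>) \<le> ennreal (exp_tail_const c)"
    by (rule exp_moment_of_exp_tail[OF mX c]) (rule tail)
  also have "(\<integral>\<^sup>+y. ennreal (exp (c * X y)) \<partial>\<mu>) =
      (\<integral>\<^sup>+y. ennreal (exp (c * (k * t' + L))) * ennreal (exp (ip ?\<theta> y)) \<partial>\<mu>)"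
  proof (rule nn_integral_cong)
    fix y
    have "c * X y = c * (k * t' + L) + ip ?\<theta> y" unfolding ip' X_def by (simp add: algebra_simps)
    then show "ennreal (exp (c * X y)) = ennreal (exp (c * (k * t' + L))) * ennreal (exp (ip ?\<theta> y))"
      by (simp only: exp_add ennreal_mult exp_ge_zero)
  qed
  also have "\<dots> = ennreal (exp (c * (k * t' + L))) * (\<integral>\<^sup>+y. ennreal (exp (ip ?\<theta> y)) \<partial>\<mu>)"
    by (rule nn_integral_cmult) measurable
  also have "\<dots> = ennreal (exp (c * (k * t' + L)) * mgf ?\<theta>)"
    unfolding mgf_nn using mgf_pos[of ?\<theta>] by (subst ennreal_mult) auto
  finally have "exp (c * (k * t' + L)) * mgf ?\<theta> \<le> exp_tail_const c"
    using exp_tail_const_pos[OF c(2)] by (subst (asm) ennreal_le_iff) auto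
  then have "ln (exp (c * (k * t' + L)) * mgf ?\<theta>) \<le> ln (exp_tail_const c)"
    using mgf_pos[of ?\<theta>] exp_tail_const_pos[OF c(2)] by (subst ln_le_cancel_iff) auto
  then have "c * (k * t' + L) + ln (mgf ?\<theta>) \<le> ln (exp_tail_const c)"
    using mgf_pos[of ?\<theta>] by (subst (asm) ln_mult) auto
  moreover have "c * k * t \<le> c * k * t'" using c k(1) \<eta>(1) by (simp add: t'_def)
  ultimately have "c * L - ln (exp_tail_const c) \<le> ip ?\<theta> x - ln (mgf ?\<theta>)"
    unfolding ip' t_def[symmetric] by (simp add: algebra_simps)
  then have "ereal (c * L - ln (exp_tail_const c)) \<le> ereal (ip ?\<theta> x - ln (mgf ?\<theta>))" by simp
  also have "\<dots> \<le> cramer x" by (rule cramer_ge) simp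
  finally show ?thesis by (simp only: L_def)
qed

lemma measure_shallow_le:
  fixes k :: nat
  assumes s0: "is_median s0"
  shows "prob (Rn n - deep (s0 * exp (- (real n * real k)))) \<le> exp (- 1 / 2) ^ k"
proof (cases "k = 0")
  case True
  then show ?thesis using prob_le_1 by simp
next
  case False
  define z where "z = exp (- real k / 2)"
  have "1 - z \<le> (1 / 2) powr z" by (intro half_powr_ge) (simp add: z_def)
  also have "\<dots> \<le> prob (deep (s0 * exp (- (real n * real k))))"
    using depth_upper_tail[OF s0, of "real k"] False by (simp add: z_def)
  finally have "1 - prob (deep (s0 * exp (- (real n * real k)))) \<le> z" by simp
  moreover have "prob (space \<mu> - deep (s0 * exp (- (real n * real k)))) = 1 - prob (deep (s0 * exp (- (real n * real k))))"
    by (rule prob_compl) simp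
  moreover have "z = exp (- 1 / 2) ^ k" by (simp add: z_def flip: exp_of_nat_mult)
  ultimately show ?thesis by simp
qed

text \<open>
  The excess of \<open>- ln q\<close> over the median is at most \<open>n\<close> times the number of \<open>k\<close> with
  \<open>q < s0 exp (- n k)\<close>, and these events have summable probabilities.
\<close>

theorem expect_neg_log_depth_le:
  assumes s0: "is_median s0"
  shows "expect n K neg_log \<le> ennreal (- ln s0 + n * (1 / (1 - exp (- 1 / 2))))"
proof -
  define B where "B k = Rn n - deep (s0 * exp (- (real n * real k)))" for k
  have Rn_sets: "Rn n \<in> events" by (metis sets.top space_\<mu>)
  have B_sets [measurable]: "B k \<in> events" for k unfolding B_def using Rn_sets by (intro sets.Diff) auto
  have s0': "0 < s0" "s0 \<le> 1" using s0 by (auto simp: is_median_def)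
  then have m: "- ln s0 \<ge> 0" by simp
  let ?S = "\<lambda>x. ennreal (- ln s0) + (\<Sum>k. ennreal n * indicator (B k) x)"
  have partial: "ennreal (- ln s0) + ennreal (j * n) \<le> ?S x" if "\<And>k. k < j \<Longrightarrow> x \<in> B k" for j :: nat and x
  proof (rule add_left_mono)
    have "ennreal (j * n) = (\<Sum>k<j. ennreal n * indicator (B k) x)"
      using that by (simp add: ennreal_mult ennreal_of_nat_eq_real_of_nat)
    also have "\<dots> \<le> (\<Sum>k. ennreal n * indicator (B k) x)" by (intro sum_le_suminf) auto
    finally show "ennreal (j * n) \<le> (\<Sum>k. ennreal n * indicator (B k) x)" .
  qed
  have ptw: "e2ennreal (neg_log x) \<le> ?S x" if x: "x \<in> Rn n" for x
  proof (cases "depth x = 0")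
    case True
    have "x \<in> B k" for k
    proof -
      have "0 < s0 * exp (- (real n * real k))" using s0' by simp
      then show ?thesis using x True by (simp only: B_def mem_deep Diff_iff) simp
    qed
    then have "ennreal (- ln s0) + ennreal (j * n) \<le> ?S x" for j by (rule partial)
    moreover have "of_nat j \<le> ennreal (- ln s0) + ennreal (j * n)" for j
    proof -
      have "real j \<le> real (j * n)" using mult_left_mono[of 1 "real n" "real j"] n_pos by simp
      then have "of_nat j \<le> ennreal (j * n)" unfolding ennreal_of_nat_eq_real_of_nat by (rule ennreal_leI)
      then show ?thesis by (simp add: add_increasing)
    qed
    ultimately have "of_nat j \<le> ?S x" for j by (rule order_trans[rotated])
    then have "?S x = top" using ennreal_Ex_less_of_nat[of "?S x"] by (metis less_top not_le)
    then show ?thesis by simp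
  next
    case False
    then have d: "depth x > 0" using depth_nonneg[OF x] by simp
    define I where "I = - ln (depth x)"
    have nld: "neg_log x = ereal I" using False by (simp add: neg_log_depth_def I_def)
    have dI: "depth x = exp (- I)" "s0 = exp (- (- ln s0))" using d s0' by (auto simp: I_def)
    show ?thesis
    proof (cases "I \<le> - ln s0")
      case True
      then have "ennreal I \<le> ennreal (- ln s0)" by (rule ennreal_leI)
      then show ?thesis by (simp add: nld add_increasing2)
    next
      case False
      define j where "j = nat \<lceil>(I + ln s0) / n\<rceil>"
      have "x \<in> B k" if "k < j" for k
      proof -
        have "real k < (I + ln s0) / n" using that unfolding j_def by linarith
        then have "- I < ln s0 - n * real k" using n_pos by (simp add: field_simps)
        then have "exp (- I) < exp (ln s0 + - (real n * real k))" by simp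
        then have "depth x < s0 * exp (- (real n * real k))" using s0' dI(1) unfolding exp_add by simp
        then show ?thesis using x by (simp add: B_def mem_deep)
      qed
      then have "ennreal (- ln s0) + ennreal (j * n) \<le> ?S x" by (rule partial)
      moreover have "ennreal I \<le> ennreal (- ln s0) + ennreal (j * n)"
      proof -
        have "(I + ln s0) / n \<le> real j" unfolding j_def by linarith
        then have "I \<le> - ln s0 + real (j * n)" using n_pos by (simp add: field_simps)
        then show ?thesis using m by (subst ennreal_plus[symmetric]) (auto intro: ennreal_leI)
      qed
      ultimately have "ennreal I \<le> ?S x" by (rule order_trans[rotated])
      then show ?thesis unfolding nld by simp
    qed
  qed
  have "expect n K neg_log \<le> (\<integral>\<^sup>+x. ?S x \<partial>\<mu>)"
    unfolding expect_def by (intro nn_integral_mono ptw) simp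
  also have "\<dots> = ennreal (- ln s0) + (\<Sum>k. ennreal n * emeasure \<mu> (B k))"
  proof -
    have "emeasure \<mu> (Rn n) = 1" by (simp add: emeasure_eq_measure)
    moreover have "integral\<^sup>N \<mu> (indicator (B k)) = emeasure \<mu> (B k)" for k
      by (rule nn_integral_indicator) (rule B_sets)
    ultimately show ?thesis by (simp add: nn_integral_add nn_integral_suminf nn_integral_cmult)
  qed
  also have "\<dots> \<le> ennreal (- ln s0) + (\<Sum>k. ennreal (n * exp (- 1 / 2) ^ k))"
  proof (intro add_left_mono suminf_le)
    fix k
    have "emeasure \<mu> (B k) \<le> ennreal (exp (- 1 / 2) ^ k)"
      unfolding emeasure_eq_measure B_def by (intro ennreal_leI measure_shallow_le[OF s0])
    then show "ennreal n * emeasure \<mu> (B k) \<le> ennreal (n * exp (- 1 / 2) ^ k)"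
      by (simp add: ennreal_mult mult_left_mono)
  qed auto
  also have "(\<Sum>k. ennreal (n * exp (- 1 / 2) ^ k)) = ennreal (n * (1 / (1 - exp (- 1 / 2))))"
    by (intro suminf_ennreal_eq sums_mult geometric_sums) auto
  also have "ennreal (- ln s0) + ennreal (n * (1 / (1 - exp (- 1 / 2)))) = ennreal (- ln s0 + n * (1 / (1 - exp (- 1 / 2))))"
    using m by (intro ennreal_plus[symmetric]) auto
  finally show ?thesis .
qed

text \<open>
  A homothety with factor \<open>1 / 2\<close> and a centre of \<open>K\<close> off the hyperplane would move the whole mass
  off the hyperplane, while scaling it by \<open>(1 / 2) ^ n\<close> only.
\<close>

lemma measure_hyperplane_less_1: "\<not> (AE x in \<mu>. x 0 = a)"
proof
  assume AE: "AE x in \<mu>. x 0 = a"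
  obtain c r where c: "c \<in> Rn n" "r > 0" "Rn_cell n c r \<subseteq> K" by (rule K_cell)
  have "\<exists>y\<in>K. y 0 \<noteq> a"
  proof (cases "c 0 = a")
    case True
    have "c(0 := c 0 + r) \<in> Rn n" using c(1) n_pos by (auto simp: PiE_iff extensional_def)
    moreover have "\<bar>(c(0 := c 0 + r)) i - c i\<bar> \<le> r" for i using c(2) by simp
    ultimately have "c(0 := c 0 + r) \<in> K" using c(3) by blast
    then show ?thesis using True c(2) by (intro bexI[of _ "c(0 := c 0 + r)"]) simp_all
  next
    case False
    have "c \<in> K" using c(1,2) by (intro subsetD[OF c(3)]) simp
    then show ?thesis using False by auto
  qed
  then obtain y where y: "y \<in> K" "y 0 \<noteq> a" by blast
  define D where "D = {x \<in> space \<mu>. x 0 = a}"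
  have n0: "0 < n" using n_pos by simp
  have coord [measurable]: "(\<lambda>x. x 0) \<in> borel_measurable (Rn_lborel n)" using n0 by simp
  have D_sets: "D \<in> events" unfolding D_def by measurable
  have "AE x in \<mu>. x \<in> D" using AE AE_space unfolding D_def by eventually_elim blast
  then have D1: "prob D = 1" by (simp only: prob_eq_1[OF D_sets])
  have "(1 / 2) ^ n * prob D \<le> prob (space \<mu> - D)"
  proof (rule measure_\<mu>_homothety[OF _ _ y(1)])
    show "space \<mu> - D \<in> sets (Rn_lborel n)" using sets.compl_sets[OF D_sets] by (simp only: sets_\<mu>)
    show "D \<in> sets (Rn_lborel n)" using D_sets by (simp only: sets_\<mu>)
    fix x assume "x \<in> D \<inter> K"
    then have "x 0 = a" by (simp add: D_def)
    then have "1 / 2 * x 0 + (1 - 1 / 2) * y 0 \<noteq> a" using y(2) by simp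
    then show "Rn_comb n (1 / 2) x (1 - 1 / 2) y \<in> space \<mu> - D"
      using n0 by (simp add: D_def)
  qed auto
  then have "(1 / 2) ^ n \<le> (0::real)" using D1 prob_compl[OF D_sets] by simp
  moreover have "(0::real) < (1 / 2) ^ n" by simp
  ultimately show False by linarith
qed

text \<open>
  One direction suffices. The transform at \<open>x\<close> is at least \<open>x 0 - a\<close>, where \<open>a\<close> is the logarithm of
  the mean of \<open>exp (x 0)\<close>. If its mean were \<open>0\<close>, then \<open>exp (x 0)\<close> would be almost surely at most
  its own mean, hence equal to it, and \<open>x 0\<close> would be almost surely constant.
\<close>

theorem expect_cramer_pos: "expect n K cramer > 0"
proof (rule ccontr)
  assume "\<not> expect n K cramer > 0"
  then have E0: "expect n K cramer = 0" by simp
  let ?e = "\<lambda>i\<in>{..<n}. if i = 0 then 1 else 0 :: real"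
  have ip_e: "ip ?e y = y 0" for y
  proof -
    have "ip ?e y = (\<Sum>i<n. if i = 0 then y i else 0)" unfolding Rn_inner_def by (rule sum.cong) auto
    also have "\<dots> = y 0" using n_pos by (subst sum.delta) auto
    finally show ?thesis .
  qed
  define a where "a = ln (mgf ?e)"
  have mg [measurable]: "(\<lambda>x. ip ?e x) \<in> borel_measurable \<mu>" by measurable
  have "(\<integral>\<^sup>+x. ennreal (ip ?e x - a) \<partial>\<mu>) \<le> expect n K cramer"
    unfolding expect_def
  proof (rule nn_integral_mono)
    fix x
    have "e2ennreal (ereal (ip ?e x - a)) \<le> e2ennreal (cramer x)"
      unfolding a_def by (intro e2ennreal_mono cramer_ge) simp
    then show "ennreal (ip ?e x - a) \<le> e2ennreal (cramer x)" by simp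
  qed
  then have "AE x in \<mu>. ennreal (ip ?e x - a) = 0"
    unfolding E0 by (subst nn_integral_0_iff_AE[symmetric]) (auto simp: mg)
  then have le: "AE x in \<mu>. exp (ip ?e x) \<le> mgf ?e"
  proof eventually_elim
    case (elim x)
    then have "ip ?e x \<le> a" by (simp add: ennreal_eq_0_iff)
    then have "exp (ip ?e x) \<le> exp a" by simp
    then show ?case using mgf_pos[of ?e] by (simp add: a_def)
  qed
  have "(\<integral>x. mgf ?e - exp (ip ?e x) \<partial>\<mu>) = 0"
    using integrable_exp_ip[of ?e] by (simp add: mgf_def prob_space)
  then have "AE x in \<mu>. mgf ?e - exp (ip ?e x) = 0"
    using integrable_exp_ip[of ?e] le by (subst (asm) integral_nonneg_eq_0_iff_AE) auto
  then have "AE x in \<mu>. x 0 = a"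
  proof eventually_elim
    case (elim x)
    then have "exp (ip ?e x) = mgf ?e" by simp
    then have "ip ?e x = a" unfolding a_def by (metis ln_exp)
    then show ?case by (simp only: ip_e)
  qed
  then show False using measure_hyperplane_less_1 by blast
qed

end

section \<open>Distance from a point to the hull of finitely many points\<close>

text \<open>
  Elimination of one unknown from one equation, by induction on the number of equations.
\<close>

lemma homogeneous_system:
  fixes a :: "nat \<Rightarrow> 'j \<Rightarrow> real"
  assumes "finite J" "card J > m"
  shows "\<exists>c. (\<exists>j\<in>J. c j \<noteq> 0) \<and> (\<forall>i<m. (\<Sum>j\<in>J. c j * a i j) = 0)"
  using assms
proof (induction m arbitrary: J a)
  case 0
  then have "J \<noteq> {}" by auto
  then show ?case by (intro exI[of _ "\<lambda>_. 1"]) auto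
next
  case (Suc m)
  show ?case
  proof (cases "\<forall>j\<in>J. a m j = 0")
    case True
    obtain c where c: "\<exists>j\<in>J. c j \<noteq> 0" "\<forall>i<m. (\<Sum>j\<in>J. c j * a i j) = 0"
      using Suc.IH[of J a] Suc.prems by auto
    moreover have "(\<Sum>j\<in>J. c j * a m j) = 0" using True by simp
    ultimately show ?thesis by (intro exI[of _ c]) (auto simp: less_Suc_eq)
  next
    case False
    then obtain p where p: "p \<in> J" "a m p \<noteq> 0" by auto
    define J' where "J' = J - {p}"
    have J': "finite J'" "card J' > m" "p \<notin> J'" "J = insert p J'"
      using Suc.prems p by (auto simp: J'_def)
    obtain c where c: "\<exists>j\<in>J'. c j \<noteq> 0" "\<forall>i<m. (\<Sum>j\<in>J'. c j * (a i j - a i p * a m j / a m p)) = 0"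
      using Suc.IH[OF J'(1,2), of "\<lambda>i j. a i j - a i p * a m j / a m p"] by auto
    define c' where "c' = c(p := - (\<Sum>j\<in>J'. c j * a m j) / a m p)"
    have sum': "(\<Sum>j\<in>J. c' j * a i j) = (\<Sum>j\<in>J'. c j * (a i j - a i p * a m j / a m p))" for i
    proof -
      have "(\<Sum>j\<in>J'. c' j * a i j) = (\<Sum>j\<in>J'. c j * a i j)"
        using J'(3) by (intro sum.cong) (auto simp: c'_def)
      then have "(\<Sum>j\<in>J. c' j * a i j) = - (\<Sum>j\<in>J'. c j * a m j) / a m p * a i p + (\<Sum>j\<in>J'. c j * a i j)"
        using J'(1,3) unfolding J'(4) by (simp add: c'_def)
      also have "\<dots> = (\<Sum>j\<in>J'. c j * a i j) - (\<Sum>j\<in>J'. c j * (a i p * a m j / a m p))"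
        by (simp add: sum_distrib_left sum_distrib_right sum_divide_distrib mult.commute mult.left_commute)
      finally show ?thesis by (simp add: right_diff_distrib sum_subtractf)
    qed
    have "\<exists>j\<in>J. c' j \<noteq> 0" using c(1) J'(3,4) by (auto simp: c'_def)
    moreover have "(\<Sum>j\<in>J. c' j * a i j) = 0" if "i < Suc m" for i
    proof (cases "i = m")
      case True
      have "a m j - a m p * a m j / a m p = 0" for j using p by simp
      then show ?thesis unfolding sum' True by simp
    next
      case False
      then show ?thesis using c(2) that unfolding sum' by (simp add: less_Suc_eq)
    qed
    ultimately show ?thesis by blast
  qed
qed

text \<open>
  Weights vanish outside of \<open>J\<close>, so that the set is compact in the space of all sequences and the
  weights on a subset of \<open>J\<close> are among those on \<open>J\<close>.
\<close>

definition weights :: "nat set \<Rightarrow> (nat \<Rightarrow> real) set" where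
  "weights J = {l. (\<forall>j. 0 \<le> l j) \<and> (\<forall>j. j \<notin> J \<longrightarrow> l j = 0) \<and> sum l J = 1}"

definition wcomb :: "nat \<Rightarrow> nat set \<Rightarrow> (nat \<Rightarrow> nat \<Rightarrow> real) \<Rightarrow> (nat \<Rightarrow> real) \<Rightarrow> nat \<Rightarrow> real" where
  "wcomb n J X l = (\<lambda>i\<in>{..<n}. \<Sum>j\<in>J. l j * X j i)"

definition sqdist :: "nat \<Rightarrow> (nat \<Rightarrow> real) \<Rightarrow> (nat \<Rightarrow> real) \<Rightarrow> real" where
  "sqdist n x y = (\<Sum>i<n. (x i - y i)\<^sup>2)"

text \<open>
  The squared distance from \<open>x\<close> to the hull of the points \<open>X j\<close> with \<open>j \<in> J\<close>, for finite non-empty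
  \<open>J\<close>. Events about hulls and nearest points are expressed through it because it depends
  measurably on the points.
\<close>

definition hull_dist :: "nat \<Rightarrow> nat set \<Rightarrow> (nat \<Rightarrow> nat \<Rightarrow> real) \<Rightarrow> (nat \<Rightarrow> real) \<Rightarrow> real" where
  "hull_dist n J X x = (INF l\<in>weights J. sqdist n x (wcomb n J X l))"

lemma wcomb_Rn: "wcomb n J X l \<in> Rn n"
  unfolding wcomb_def by simp

lemma sqdist_nonneg: "sqdist n x y \<ge> 0"
  by (simp add: sqdist_def sum_nonneg)

lemma sqdist_wcomb: "sqdist n x (wcomb n J X l) = (\<Sum>i<n. (x i - (\<Sum>j\<in>J. l j * X j i))\<^sup>2)"
  unfolding sqdist_def wcomb_def by (intro sum.cong) auto

lemma weights_nonempty: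
  assumes "finite J" "J \<noteq> {}"
  shows "weights J \<noteq> {}"
proof -
  obtain p where p: "p \<in> J" using assms by auto
  have "(\<lambda>j. if j = p then 1 else 0) \<in> weights J" using p assms by (auto simp: weights_def)
  then show ?thesis by blast
qed

lemma weights_le_1:
  assumes "finite J" "l \<in> weights J"
  shows "l j \<le> 1"
proof (cases "j \<in> J")
  case True
  then have "l j \<le> sum l J" using assms by (intro member_le_sum) (auto simp: weights_def)
  then show ?thesis using assms by (simp add: weights_def)
qed (use assms in \<open>auto simp: weights_def\<close>)

lemma continuous_on_coordinate: "continuous_on S (\<lambda>l :: nat \<Rightarrow> real. l j)"
  by (rule continuous_on_subset[OF continuous_on_product_coordinates]) simp

lemma compact_weights:
  assumes J: "finite J"
  shows "compact (weights J)"
proof -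
  let ?B = "PiE UNIV (\<lambda>j. if j \<in> J then {0..1::real} else {0})"
  have "compactin (product_topology (\<lambda>_. euclideanreal) UNIV) ?B"
    unfolding compactin_PiE by auto
  then have "compact ?B" by (simp add: euclidean_product_topology)
  moreover have "closed {l :: nat \<Rightarrow> real. sum l J = 1}"
    by (intro closed_Collect_eq continuous_on_sum continuous_on_coordinate continuous_on_const)
  ultimately have "compact (?B \<inter> {l. sum l J = 1})" by (rule compact_Int_closed)
  also have "?B \<inter> {l. sum l J = 1} = weights J"
  proof (intro equalityI subsetI)
    fix l assume l: "l \<in> weights J"
    have "l j \<in> (if j \<in> J then {0..1} else {0})" for j
      using weights_le_1[OF J l, of j] l by (auto simp: weights_def)
    then show "l \<in> ?B \<inter> {l. sum l J = 1}" using l by (auto simp: weights_def)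
  next
    fix l assume l: "l \<in> ?B \<inter> {l. sum l J = 1}"
    then have *: "l j \<in> (if j \<in> J then {0..1} else {0})" for j by (auto simp: PiE_iff)
    have "0 \<le> l j" "j \<notin> J \<longrightarrow> l j = 0" for j using *[of j] by (auto split: if_splits)
    then show "l \<in> weights J" using l by (simp add: weights_def)
  qed
  finally show ?thesis .
qed

lemma continuous_sqdist: "continuous_on S (\<lambda>l. sqdist n x (wcomb n J X l))"
  unfolding sqdist_wcomb
  by (intro continuous_on_sum continuous_on_power continuous_on_diff continuous_on_const continuous_on_mult continuous_on_coordinate)

lemma bdd_below_sqdist: "bdd_below ((\<lambda>l. sqdist n x (wcomb n J X l)) ` A)"
  using sqdist_nonneg by (intro bdd_belowI2) auto

lemma hull_dist_le: "l \<in> weights J \<Longrightarrow> hull_dist n J X x \<le> sqdist n x (wcomb n J X l)"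
  unfolding hull_dist_def by (rule cINF_lower[OF bdd_below_sqdist])

lemma hull_dist_attained:
  assumes "finite J" "J \<noteq> {}"
  obtains l where "l \<in> weights J" "hull_dist n J X x = sqdist n x (wcomb n J X l)"
proof -
  obtain l where l: "l \<in> weights J" "\<forall>l'\<in>weights J. sqdist n x (wcomb n J X l) \<le> sqdist n x (wcomb n J X l')"
    using continuous_attains_inf[OF compact_weights weights_nonempty continuous_sqdist] assms by metis
  have "sqdist n x (wcomb n J X l) \<le> hull_dist n J X x"
    unfolding hull_dist_def using l(1) l(2) by (intro cINF_greatest) auto
  with hull_dist_le[OF l(1), of n X x] have "hull_dist n J X x = sqdist n x (wcomb n J X l)" by linarith
  with l(1) show ?thesis by (rule that)
qed

lemma hull_dist_nonneg:
  assumes "finite J" "J \<noteq> {}"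
  shows "hull_dist n J X x \<ge> 0"
  using hull_dist_attained[OF assms, of n X x] sqdist_nonneg by metis

lemma hull_dist_cong:
  assumes "\<And>j i. j \<in> J \<Longrightarrow> i < n \<Longrightarrow> X j i = Y j i"
  shows "hull_dist n J X x = hull_dist n J Y x"
proof -
  have "sqdist n x (wcomb n J X l) = sqdist n x (wcomb n J Y l)" for l
    unfolding sqdist_wcomb using assms by (intro sum.cong arg_cong2[of _ _ _ _ "(\<lambda>a b. (a - b)\<^sup>2)"]) auto
  then show ?thesis by (simp add: hull_dist_def)
qed

lemma weights_extend:
  assumes "finite J" "S \<subseteq> J" "l \<in> weights S"
  shows "l \<in> weights J" "wcomb n J X l = wcomb n S X l"
proof -
  have z: "\<And>j. j \<in> J - S \<Longrightarrow> l j = 0" using assms by (auto simp: weights_def)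
  have "sum l J = sum l S" using assms z by (intro sum.mono_neutral_right) auto
  then show "l \<in> weights J" using assms by (auto simp: weights_def)
  have "(\<Sum>j\<in>J. l j * X j i) = (\<Sum>j\<in>S. l j * X j i)" for i
    using assms z by (intro sum.mono_neutral_right) auto
  then show "wcomb n J X l = wcomb n S X l" by (simp add: wcomb_def)
qed

lemma hull_dist_mono:
  assumes "finite J" "S \<subseteq> J" "S \<noteq> {}"
  shows "hull_dist n J X x \<le> hull_dist n S X x"
proof -
  have "finite S" using assms finite_subset by blast
  then obtain l where l: "l \<in> weights S" "hull_dist n S X x = sqdist n x (wcomb n S X l)"
    using hull_dist_attained assms(3) by metis
  have "hull_dist n J X x \<le> sqdist n x (wcomb n J X l)"
    by (rule hull_dist_le[OF weights_extend(1)[OF assms(1,2) l(1)]])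
  then show ?thesis using weights_extend(2)[OF assms(1,2) l(1)] l(2) by simp
qed

text \<open>
  By continuity in the weights, the infimum may be taken over a countable dense set of weights.
\<close>

lemma hull_dist_measurable:
  assumes X: "\<And>j i. j \<in> J \<Longrightarrow> i < n \<Longrightarrow> (\<lambda>w. X w j i) \<in> borel_measurable M"
    and x: "\<And>i. i < n \<Longrightarrow> (\<lambda>w. x w i) \<in> borel_measurable M" and J: "finite J" "J \<noteq> {}"
  shows "(\<lambda>w. hull_dist n J (X w) (x w)) \<in> borel_measurable M"
proof (rule borel_measurableI_less)
  fix a
  obtain D where D: "countable D" "D \<subseteq> weights J" "weights J \<subseteq> closure D"
    using separable[of "weights J"] by metis
  have m: "(\<lambda>w. sqdist n (x w) (wcomb n J (X w) l)) \<in> borel_measurable M" for l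
    unfolding sqdist_wcomb using X x by measurable
  have "{w \<in> space M. hull_dist n J (X w) (x w) < a} =
      (\<Union>l\<in>D. {w \<in> space M. sqdist n (x w) (wcomb n J (X w) l) < a})"
  proof (intro equalityI subsetI)
    fix w assume w: "w \<in> {w \<in> space M. hull_dist n J (X w) (x w) < a}"
    let ?f = "\<lambda>l. sqdist n (x w) (wcomb n J (X w) l)"
    obtain l where l: "l \<in> weights J" "?f l < a"
      using w hull_dist_attained[OF J, of n "X w" "x w"] by (metis (mono_tags, lifting) mem_Collect_eq)
    have "open {l. ?f l < a}"
      by (intro open_Collect_less continuous_sqdist continuous_on_const)
    moreover have "l \<in> closure D" using l D by blast
    ultimately have "D \<inter> {l. ?f l < a} \<noteq> {}" using l(2) open_Int_closure_eq_empty[of "{l. ?f l < a}" D] by blast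
    then show "w \<in> (\<Union>l\<in>D. {w \<in> space M. sqdist n (x w) (wcomb n J (X w) l) < a})" using w by blast
  next
    fix w assume "w \<in> (\<Union>l\<in>D. {w \<in> space M. sqdist n (x w) (wcomb n J (X w) l) < a})"
    then obtain l where "l \<in> D" "w \<in> space M" "sqdist n (x w) (wcomb n J (X w) l) < a" by blast
    then show "w \<in> {w \<in> space M. hull_dist n J (X w) (x w) < a}"
      using hull_dist_le[of l J n "X w" "x w"] D(2) by auto
  qed
  also have "\<dots> \<in> sets M"
    using D(1) m by (intro sets.countable_UN'') auto
  finally show "{w \<in> space M. hull_dist n J (X w) (x w) < a} \<in> sets M" .
qed

lemma Rn_convex_weighted:
  assumes t: "Rn_convex n t" and "finite J" "J \<noteq> {}" "X ` J \<subseteq> t"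
    and "\<And>j. j \<in> J \<Longrightarrow> 0 \<le> l j" "sum l J = 1"
  shows "wcomb n J X l \<in> t"
  using assms(2-)
proof (induction J arbitrary: l rule: finite_ne_induct)
  case (singleton j)
  then have "X j \<in> Rn n" "l j = 1" using t by (auto simp: Rn_convex_def)
  then have "wcomb n {j} X l = X j" by (auto simp: wcomb_def fun_eq_iff PiE_iff extensional_def)
  then show ?case using singleton by simp
next
  case (insert j J)
  have l0: "sum l J = 1 - l j" using insert by simp
  show ?case
  proof (cases "l j = 1")
    case True
    then have "sum l J = 0" using l0 by simp
    then have z: "\<And>k. k \<in> J \<Longrightarrow> l k = 0" using insert by (simp add: sum_nonneg_eq_0_iff)
    have "X j \<in> Rn n" using t insert by (auto simp: Rn_convex_def)
    then have "wcomb n (insert j J) X l = X j"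
      using True z insert(1,3) by (auto simp: wcomb_def fun_eq_iff PiE_iff extensional_def)
    then show ?thesis using insert by simp
  next
    case False
    have s: "sum l J > 0"
    proof -
      have "sum l J \<ge> 0" using insert by (intro sum_nonneg) auto
      then show ?thesis using False l0 by simp
    qed
    define l' where "l' k = l k / sum l J" for k
    have "wcomb n J X l' \<in> t"
    proof (rule insert.IH)
      show "sum l' J = 1" using s by (simp add: l'_def flip: sum_divide_distrib)
      show "0 \<le> l' k" if "k \<in> J" for k using that insert.prems(2) s by (simp add: l'_def)
    qed (use insert in auto)
    moreover have "X j \<in> t" using insert by simp
    ultimately have "(\<lambda>i\<in>{..<n}. l j * X j i + sum l J * wcomb n J X l' i) \<in> t"
      using t insert.prems(2)[of j] s l0 unfolding Rn_convex_def by simp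
    also have "(\<lambda>i\<in>{..<n}. l j * X j i + sum l J * wcomb n J X l' i) = wcomb n (insert j J) X l"
    proof (rule ext)
      fix i
      have "sum l J * (\<Sum>k\<in>J. l' k * X k i) = (\<Sum>k\<in>J. l k * X k i)"
        using s unfolding sum_distrib_left by (intro sum.cong) (auto simp: l'_def)
      then show "(\<lambda>i\<in>{..<n}. l j * X j i + sum l J * wcomb n J X l' i) i = wcomb n (insert j J) X l i"
        using insert(1,3) by (simp add: wcomb_def)
    qed
    finally show ?thesis .
  qed
qed

lemma hull_Rn_finite:
  assumes J: "finite J" "J \<noteq> {}" and X: "\<And>j. j \<in> J \<Longrightarrow> X j \<in> Rn n"
  shows "Rn_convex n hull (X ` J) = wcomb n J X ` weights J"
proof (rule hull_unique)
  show "X ` J \<subseteq> wcomb n J X ` weights J"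
  proof
    fix y assume "y \<in> X ` J"
    then obtain j where j: "j \<in> J" "y = X j" by auto
    let ?l = "\<lambda>k. if k = j then 1 else 0 :: real"
    have "(\<Sum>k\<in>J. ?l k * X k i) = X j i" for i
    proof -
      have "(\<Sum>k\<in>J. ?l k * X k i) = (\<Sum>k\<in>J. if k = j then X k i else 0)" by (intro sum.cong) auto
      then show ?thesis using j J by simp
    qed
    then have "wcomb n J X ?l = X j" using X[OF j(1)] by (auto simp: wcomb_def fun_eq_iff PiE_iff extensional_def)
    moreover have "?l \<in> weights J" using j J by (auto simp: weights_def)
    ultimately show "y \<in> wcomb n J X ` weights J" using j(2) by (metis image_eqI)
  qed
  show "Rn_convex n (wcomb n J X ` weights J)"
    unfolding Rn_convex_def
  proof (intro conjI ballI allI impI)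
    show "wcomb n J X ` weights J \<subseteq> Rn n" using wcomb_Rn by blast
    fix x y and u v :: real
    assume "x \<in> wcomb n J X ` weights J" "y \<in> wcomb n J X ` weights J" and uv: "0 \<le> u" "0 \<le> v" "u + v = 1"
    then obtain l m where lm: "l \<in> weights J" "x = wcomb n J X l" "m \<in> weights J" "y = wcomb n J X m" by auto
    let ?k = "\<lambda>j. u * l j + v * m j"
    have "?k \<in> weights J"
      using lm uv by (auto simp: weights_def sum.distrib simp flip: sum_distrib_left)
    moreover have "wcomb n J X ?k = Rn_comb n u x v y"
      by (auto simp: wcomb_def lm fun_eq_iff sum_distrib_left sum.distrib algebra_simps)
    ultimately show "Rn_comb n u x v y \<in> wcomb n J X ` weights J" by (metis image_eqI)
  qed
  fix t assume "X ` J \<subseteq> t" "Rn_convex n t"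
  then show "wcomb n J X ` weights J \<subseteq> t"
    using J by (auto intro!: Rn_convex_weighted simp: weights_def)
qed

lemma hull_dist_eq_0_iff:
  assumes J: "finite J" "J \<noteq> {}" and X: "\<And>j. j \<in> J \<Longrightarrow> X j \<in> Rn n" and x: "x \<in> Rn n"
  shows "hull_dist n J X x = 0 \<longleftrightarrow> x \<in> Rn_convex n hull (X ` J)"
proof -
  have hull: "Rn_convex n hull (X ` J) = wcomb n J X ` weights J" by (rule hull_Rn_finite[OF J X])
  show ?thesis unfolding hull
  proof
  assume "hull_dist n J X x = 0"
  then obtain l where l: "l \<in> weights J" "sqdist n x (wcomb n J X l) = 0"
    using hull_dist_attained[OF J, of n X x] by metis
  then have "x i = wcomb n J X l i" if "i < n" for i
    using that by (auto simp: sqdist_def sum_nonneg_eq_0_iff)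
  moreover have "x i = wcomb n J X l i" if "\<not> i < n" for i
    using that x by (auto simp: wcomb_def PiE_iff extensional_def)
  ultimately have "x = wcomb n J X l" by blast
  then show "x \<in> wcomb n J X ` weights J" using l(1) by blast
next
  assume "x \<in> wcomb n J X ` weights J"
  then obtain l where l: "l \<in> weights J" "x = wcomb n J X l" by blast
  then have "hull_dist n J X x \<le> sqdist n x x" using hull_dist_le by metis
  then show "hull_dist n J X x = 0" using hull_dist_nonneg[OF J, of n X x] by (simp add: sqdist_def)
  qed
qed

text \<open>
  An affine dependence of the points, scaled until the first weight vanishes, removes a point
  without changing the combination. The additional equation of the system, with all coefficients
  equal to \<open>1\<close>, keeps the sum of the weights.
\<close>

lemma caratheodory_step:
  assumes J: "finite J" and card: "card J > n + 1" and l: "l \<in> weights J"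
  obtains j l' where "j \<in> J" "l' \<in> weights (J - {j})" "wcomb n (J - {j}) X l' = wcomb n J X l"
proof -
  obtain c where c: "\<exists>j\<in>J. c j \<noteq> 0"
      "\<forall>i<n + 1. (\<Sum>j\<in>J. c j * (if i < n then X j i else 1)) = 0"
    using homogeneous_system[OF J card, of "\<lambda>i j. if i < n then X j i else 1"] by auto
  have cX: "(\<Sum>j\<in>J. c j * X j i) = 0" if "i < n" for i using c(2)[rule_format, of i] that by simp
  have c1: "sum c J = 0" using c(2)[rule_format, of n] by simp
  have "\<exists>j\<in>J. c j > 0"
  proof (rule ccontr)
    assume "\<not> (\<exists>j\<in>J. c j > 0)"
    then have np: "\<And>j. j \<in> J \<Longrightarrow> c j \<le> 0" by force
    have "(\<Sum>j\<in>J. - c j) = 0" using c1 by (simp add: sum_negf)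
    then have "\<forall>j\<in>J. - c j = 0" using np J by (subst (asm) sum_nonneg_eq_0_iff) auto
    then show False using c(1) by auto
  qed
  define P where "P = {j \<in> J. c j > 0}"
  have P: "finite P" "P \<noteq> {}" using J \<open>\<exists>j\<in>J. c j > 0\<close> by (auto simp: P_def)
  \<comment> \<open>The largest step along the dependence that keeps all weights non-negative.\<close>
  define h where "h = Min ((\<lambda>j. l j / c j) ` P)"
  have "h \<in> (\<lambda>j. l j / c j) ` P" unfolding h_def using P by (intro Min_in) auto
  then obtain j where j: "j \<in> P" "h = l j / c j" by auto
  have h_le: "h \<le> l k / c k" if "k \<in> P" for k unfolding h_def using P that by (intro Min_le) auto
  have l0: "\<And>k. l k \<ge> 0" using l by (simp add: weights_def)
  have h0: "h \<ge> 0" using j l0[of j] by (auto simp: P_def)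
  define l' where "l' k = (if k \<in> J then l k - h * c k else 0)" for k
  have jJ: "j \<in> J" using j by (simp add: P_def)
  have l'j: "l' j = 0" using j by (auto simp: l'_def P_def)
  have l'0: "l' k \<ge> 0" for k
  proof (cases "k \<in> P")
    case True
    then show ?thesis using h_le[OF True] by (auto simp: l'_def P_def field_simps)
  next
    case False
    then have "k \<in> J \<Longrightarrow> h * c k \<le> 0" using h0 by (auto simp: P_def mult_le_0_iff)
    then show ?thesis using l0[of k] by (auto simp: l'_def)
  qed
  have sum_l': "(\<Sum>k\<in>J. l' k * y k) = (\<Sum>k\<in>J. l k * y k) - h * (\<Sum>k\<in>J. c k * y k)" for y :: "nat \<Rightarrow> real"
    by (simp add: l'_def left_diff_distrib sum_subtractf sum_distrib_left mult.assoc)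
  have "sum l' J = 1" using sum_l'[of "\<lambda>_. 1"] c1 l by (simp add: weights_def)
  moreover have rm: "(\<Sum>k\<in>J. l' k * y k) = (\<Sum>k\<in>J - {j}. l' k * y k)" for y :: "nat \<Rightarrow> real"
    using J jJ l'j by (simp add: sum.remove)
  ultimately have "l' \<in> weights (J - {j})"
    using l'0 l'j rm[of "\<lambda>_. 1"] by (auto simp: weights_def l'_def)
  moreover have "wcomb n (J - {j}) X l' = wcomb n J X l"
    unfolding wcomb_def rm[symmetric] sum_l' using cX by (auto simp: fun_eq_iff)
  ultimately show ?thesis using that jJ by blast
qed

lemma caratheodory_weights:
  assumes "finite J" "l \<in> weights J"
  shows "\<exists>S l'. S \<subseteq> J \<and> card S \<le> n + 1 \<and> l' \<in> weights S \<and> wcomb n S X l' = wcomb n J X l"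
  using assms
proof (induction "card J" arbitrary: J l rule: less_induct)
  case less
  show ?case
  proof (cases "card J \<le> n + 1")
    case True
    then show ?thesis using less by blast
  next
    case False
    then have "card J > n + 1" by simp
    from caratheodory_step[OF less.prems(1) this less.prems(2), of X] obtain j l'
      where j: "j \<in> J" "l' \<in> weights (J - {j})" "wcomb n (J - {j}) X l' = wcomb n J X l" by blast
    have "card (J - {j}) < card J" using j(1) less.prems(1) by (intro psubset_card_mono) auto
    then have "\<exists>S l''. S \<subseteq> J - {j} \<and> card S \<le> n + 1 \<and> l'' \<in> weights S \<and> wcomb n S X l'' = wcomb n (J - {j}) X l'"
      using less.hyps[of "J - {j}" l'] less.prems(1) j(2) by simp
    then show ?thesis using j(3) by (metis Diff_subset order_trans)
  qed
qed

text \<open>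
  The nearest point of the hull is spanned by at most \<open>n + 1\<close> of the points, and no further point
  of \<open>J\<close> brings the hull closer to \<open>x\<close>. The latter is the form in which the position of the other
  points relative to the separating half-space is recorded.
\<close>

lemma hull_dist_compression:
  assumes J: "finite J" "J \<noteq> {}"
  obtains S where "S \<subseteq> J" "S \<noteq> {}" "card S \<le> n + 1"
    "\<And>j. j \<in> J \<Longrightarrow> hull_dist n (insert j S) X x = hull_dist n S X x" "hull_dist n S X x = hull_dist n J X x"
proof -
  obtain l where l: "l \<in> weights J" "hull_dist n J X x = sqdist n x (wcomb n J X l)"
    using hull_dist_attained[OF J] by metis
  obtain S l' where S: "S \<subseteq> J" "card S \<le> n + 1" "l' \<in> weights S" "wcomb n S X l' = wcomb n J X l"
    using caratheodory_weights[OF J(1) l(1), of n X] by blast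
  have ne: "S \<noteq> {}" using S(3) by (auto simp: weights_def)
  have eq: "hull_dist n S X x = hull_dist n J X x"
    using hull_dist_le[OF S(3), of n X x] hull_dist_mono[OF J(1) S(1) ne, of n X x] S(4) l(2) by simp
  have "hull_dist n (insert j S) X x = hull_dist n S X x" if "j \<in> J" for j
  proof (rule antisym)
    have fin: "finite S" using S(1) J(1) finite_subset by blast
    show "hull_dist n (insert j S) X x \<le> hull_dist n S X x"
      using fin ne by (intro hull_dist_mono) auto
    have "hull_dist n J X x \<le> hull_dist n (insert j S) X x"
      using S(1) that by (intro hull_dist_mono J) auto
    then show "hull_dist n S X x \<le> hull_dist n (insert j S) X x" using eq by simp
  qed
  with S ne eq that show ?thesis by blast
qed

text \<open>
  Let \<open>p\<close> be the nearest point. Any point on the far side of the hyperplane through \<open>x\<close> orthogonal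
  to \<open>x - p\<close> brings the hull closer to \<open>x\<close>: a short step from \<open>p\<close> towards it decreases the distance
  to first order.
\<close>

lemma hull_dist_decreases:
  assumes S: "finite S" "S \<noteq> {}" and d: "hull_dist n S X x > 0"
  obtains \<theta> where "\<theta> \<in> Rn n" "\<exists>i<n. \<theta> i \<noteq> 0"
    "\<And>j Y. j \<notin> S \<Longrightarrow> \<forall>k\<in>S. \<forall>i. Y k i = X k i \<Longrightarrow> Rn_inner n \<theta> (Y j) \<le> Rn_inner n \<theta> x \<Longrightarrow>
       hull_dist n (insert j S) Y x < hull_dist n S X x"
proof -
  obtain l where l: "l \<in> weights S" "hull_dist n S X x = sqdist n x (wcomb n S X l)"
    using hull_dist_attained[OF S] by metis
  define p where "p = wcomb n S X l"
  define \<theta> where "\<theta> = (\<lambda>i\<in>{..<n}. p i - x i)"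
  define d where "d = sqdist n x p"
  have d0: "d > 0" using d l by (simp add: d_def p_def)
  have nz: "\<exists>i<n. \<theta> i \<noteq> 0"
  proof (rule ccontr)
    assume "\<not> (\<exists>i<n. \<theta> i \<noteq> 0)"
    then have "d = 0" unfolding d_def sqdist_def by (intro sum.neutral) (auto simp: \<theta>_def)
    then show False using d0 by simp
  qed
  have dec: "hull_dist n (insert j S) Y x < hull_dist n S X x"
    if j: "j \<notin> S" and Y: "\<forall>k\<in>S. \<forall>i. Y k i = X k i" and le: "Rn_inner n \<theta> (Y j) \<le> Rn_inner n \<theta> x" for j Y
  proof -
    define E where "E = (\<Sum>i<n. (Y j i - p i)\<^sup>2)"
    have E: "E \<ge> 0" by (simp add: E_def sum_nonneg)
    \<comment> \<open>The length of the step from \<open>p\<close>; the quadratic term \<open>h\<^sup>2 * E\<close> stays below the gain \<open>2 * h * d\<close>.\<close>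
    define h where "h = min 1 (d / (E + 1))"
    have h: "0 < h" "h \<le> 1" "h * E < d"
    proof -
      show "0 < h" "h \<le> 1" using d0 E by (auto simp: h_def)
      have "h * E \<le> d / (E + 1) * E" using E by (intro mult_right_mono) (auto simp: h_def)
      also have "\<dots> < d" using d0 E by (simp add: field_simps)
      finally show "h * E < d" .
    qed
    define l' where "l' k = (1 - h) * l k + (if k = j then h else 0)" for k
    have lj: "l j = 0" using l(1) j by (simp add: weights_def)
    have sumS: "(\<Sum>k\<in>insert j S. l' k * y k) = h * y j + (1 - h) * (\<Sum>k\<in>S. l k * y k)" for y :: "nat \<Rightarrow> real"
    proof -
      have "(\<Sum>k\<in>S. l' k * y k) = (1 - h) * (\<Sum>k\<in>S. l k * y k)"
        unfolding sum_distrib_left using j by (intro sum.cong) (auto simp: l'_def)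
      then show ?thesis using S(1) j lj by (simp add: l'_def)
    qed
    have "sum l' (insert j S) = 1" using sumS[of "\<lambda>_. 1"] l(1) by (simp add: weights_def)
    then have l'w: "l' \<in> weights (insert j S)" using l(1) h by (auto simp: weights_def l'_def)
    have "(\<Sum>i<n. (x i - p i) * (Y j i - p i)) = d - (\<Sum>i<n. (p i - x i) * (Y j i - x i))"
      unfolding d_def sqdist_def by (simp add: power2_eq_square algebra_simps flip: sum_subtractf)
    moreover have "(\<Sum>i<n. (p i - x i) * (Y j i - x i)) = Rn_inner n \<theta> (Y j) - Rn_inner n \<theta> x"
      by (simp add: Rn_inner_def \<theta>_def algebra_simps flip: sum_subtractf)
    ultimately have cross: "(\<Sum>i<n. (x i - p i) * (Y j i - p i)) \<ge> d" using le by simp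
    have comb: "(\<Sum>k\<in>insert j S. l' k * Y k i) = h * Y j i + (1 - h) * p i" if "i < n" for i
    proof -
      have "(\<Sum>k\<in>S. l k * Y k i) = p i" using Y that by (simp add: p_def wcomb_def)
      then show ?thesis by (simp add: sumS)
    qed
    have "hull_dist n (insert j S) Y x \<le> sqdist n x (wcomb n (insert j S) Y l')" by (rule hull_dist_le[OF l'w])
    also have "\<dots> = (\<Sum>i<n. ((x i - p i) - h * (Y j i - p i))\<^sup>2)"
      unfolding sqdist_wcomb
    proof (rule sum.cong)
      fix i assume "i \<in> {..<n}"
      then have "x i - (\<Sum>k\<in>insert j S. l' k * Y k i) = (x i - p i) - h * (Y j i - p i)"
        using comb[of i] by (simp add: algebra_simps)
      then show "(x i - (\<Sum>k\<in>insert j S. l' k * Y k i))\<^sup>2 = ((x i - p i) - h * (Y j i - p i))\<^sup>2" by (simp only:)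
    qed simp
    also have "\<dots> = d - 2 * h * (\<Sum>i<n. (x i - p i) * (Y j i - p i)) + h\<^sup>2 * E"
      unfolding d_def sqdist_def E_def sum_distrib_left sum.distrib[symmetric] sum_subtractf[symmetric]
      by (intro sum.cong) (auto simp: power2_eq_square algebra_simps)
    also have "\<dots> \<le> d - 2 * h * d + h * (h * E)"
      using mult_left_mono[OF cross, of "2 * h"] h(1) by (simp add: power2_eq_square)
    also have "\<dots> < d"
    proof -
      have "h * (h * E) < h * d" using h by (intro mult_strict_left_mono) auto
      then show ?thesis using h(1) d0 by (simp add: mult_pos_pos add_pos_pos)
    qed
    finally show ?thesis using l(2) by (simp add: d_def p_def)
  qed
  have "\<theta> \<in> Rn n" unfolding \<theta>_def by simp
  then show ?thesis by (rule that[OF _ nz dec])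
qed

lemma hull_meets_cap:
  assumes X: "\<And>j. j \<in> J \<Longrightarrow> X j \<in> Rn n" and x: "x \<in> Rn_convex n hull (X ` J)" 
  shows "\<exists>j\<in>J. Rn_inner n \<theta> (X j) \<le> Rn_inner n \<theta> x"
proof (rule ccontr)
  assume "\<not> ?thesis"
  then have gt: "\<And>j. j \<in> J \<Longrightarrow> Rn_inner n \<theta> (X j) > Rn_inner n \<theta> x" by force
  let ?H = "{y \<in> Rn n. Rn_inner n \<theta> y > Rn_inner n \<theta> x}"
  have "Rn_convex n ?H" unfolding Rn_convex_def
  proof (intro conjI ballI allI impI)
    fix y z and u v :: real
    assume yz: "y \<in> ?H" "z \<in> ?H" and uv: "0 \<le> u" "0 \<le> v" "u + v = 1"
    define t where "t = Rn_inner n \<theta> x"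
    have "Rn_inner n \<theta> (Rn_comb n u y v z) = u * Rn_inner n \<theta> y + v * Rn_inner n \<theta> z"
      by (simp add: Rn_inner_def sum_distrib_left sum.distrib algebra_simps)
    moreover have "t < u * Rn_inner n \<theta> y + v * Rn_inner n \<theta> z"
    proof -
      have "- Rn_inner n \<theta> y < - t" "- Rn_inner n \<theta> z < - t" using yz by (auto simp: t_def)
      then have "u * (- Rn_inner n \<theta> y) + v * (- Rn_inner n \<theta> z) < - t" by (rule convex_bound_lt[OF _ _ uv])
      then show ?thesis by simp
    qed
    ultimately show "Rn_comb n u y v z \<in> ?H" by (simp add: t_def)
  qed auto
  moreover have "X ` J \<subseteq> ?H" using gt X by auto
  ultimately have "Rn_convex n hull (X ` J) \<subseteq> ?H" by (intro hull_minimal)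
  then show False using x by blast
qed

section \<open>Random polytopes\<close>

text \<open>
  Each such subset is the range of a map from \<open>{..<m}\<close>, repeating an element if necessary.
\<close>

lemma card_small_subsets:
  "finite {S. S \<subseteq> {..<N} \<and> S \<noteq> {} \<and> card S \<le> m}"
  "card {S. S \<subseteq> {..<N} \<and> S \<noteq> {} \<and> card S \<le> m} \<le> N ^ m"
proof -
  let ?A = "{S. S \<subseteq> {..<N} \<and> S \<noteq> {} \<and> card S \<le> m}"
  let ?F = "{..<m} \<rightarrow>\<^sub>E {..<N}"
  have sub: "?A \<subseteq> (\<lambda>s. s ` {..<m}) ` ?F"
  proof
    fix S assume S: "S \<in> ?A"
    then have fin: "finite S" using finite_subset by auto
    obtain f where f: "bij_betw f {0..<card S} S" using ex_bij_betw_nat_finite[OF fin] by blast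
    obtain p where p: "p \<in> S" using S by auto
    define s where "s = (\<lambda>k\<in>{..<m}. if k < card S then f k else p)"
    have fS: "f k \<in> S" if "k < card S" for k using bij_betwE[OF f] that by auto
    have "s ` {..<m} = S"
    proof (intro equalityI subsetI)
      fix y assume "y \<in> S"
      then have "y \<in> f ` {0..<card S}" using f by (simp add: bij_betw_def)
      then obtain k where "k < card S" "y = f k" by auto
      then show "y \<in> s ` {..<m}" using S by (intro image_eqI[of _ _ k]) (auto simp: s_def)
    qed (use fS p in \<open>auto simp: s_def\<close>)
    moreover have "s \<in> ?F"
    proof (rule PiE_I)
      fix k assume "k \<in> {..<m}"
      then have "s k \<in> S" using fS p by (auto simp: s_def)
      then show "s k \<in> {..<N}" using S by blast
    qed (auto simp: s_def)
    ultimately show "S \<in> (\<lambda>s. s ` {..<m}) ` ?F" by blast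
  qed
  have fin: "finite ?F" by (intro finite_PiE) auto
  show "finite ?A" by (rule finite_subset[OF sub]) (use fin in simp)
  have "card ?A \<le> card ((\<lambda>s. s ` {..<m}) ` ?F)" using fin by (intro card_mono sub) simp
  also have "\<dots> \<le> card ?F" by (rule card_image_le[OF fin])
  also have "\<dots> = N ^ m" by (simp add: card_PiE)
  finally show "card ?A \<le> N ^ m" .
qed

lemma lessThan_nonempty:
  assumes "N \<ge> 1"
  shows "{..<N::nat} \<noteq> {}"
proof -
  have "0 \<in> {..<N}" using assms by simp
  then show ?thesis by blast
qed

context body begin

abbreviation "sample J \<equiv> PiM J (\<lambda>_::nat. \<mu>)"
abbreviation "samples N \<equiv> sample {..<N}"
abbreviation "sample_hull N X \<equiv> Rn_convex n hull (X ` {..<N})"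

abbreviation "hits N x \<equiv> {X \<in> space (samples N). x \<in> sample_hull N X}"
abbreviation "misses N x \<equiv> {X \<in> space (samples N). x \<notin> sample_hull N X}"

lemma product_sigma_finite_\<mu>: "product_sigma_finite (\<lambda>_::nat. \<mu>)"
  by (rule product_sigma_finite.intro) (rule sigma_finite_measure_axioms)

lemma prob_space_sample: "prob_space (sample J)"
  by (rule prob_space_PiM) (rule prob_space_axioms)

lemma space_sample: "space (sample J) = J \<rightarrow>\<^sub>E Rn n"
  by (simp add: space_PiM)

lemma coord_\<mu>: "i < n \<Longrightarrow> (\<lambda>y. y i) \<in> borel_measurable \<mu>"
  by (subst measurable_cong_sets[OF sets_\<mu> refl]) simp

lemma coord_sample: "j \<in> J \<Longrightarrow> i < n \<Longrightarrow> (\<lambda>X. X j i) \<in> borel_measurable (sample J)"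
  by (rule measurable_compose[where f="\<lambda>X. X j" and g="\<lambda>y. y i", OF measurable_component_singleton coord_\<mu>])

lemma hull_dist_sample:
  assumes "finite J" "J \<noteq> {}" "J \<subseteq> I"
  shows "(\<lambda>X. hull_dist n J X x) \<in> borel_measurable (sample I)"
  using assms by (intro hull_dist_measurable coord_sample) auto

lemma mem_sample_hull_iff:
  assumes N: "N \<ge> 1" and x: "x \<in> Rn n" and X: "X \<in> space (samples N)"
  shows "x \<in> sample_hull N X \<longleftrightarrow> hull_dist n {..<N} X x = 0"
proof (rule hull_dist_eq_0_iff[symmetric])
  show "{..<N} \<noteq> {}" using N by (rule lessThan_nonempty)
  show "X j \<in> Rn n" if "j \<in> {..<N}" for j using X that unfolding space_sample by blast
qed (use x in auto)

lemma hit_sets: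
  assumes N: "N \<ge> 1" and x: "x \<in> Rn n"
  shows "hits N x \<in> sets (samples N)"
proof -
  have [measurable]: "(\<lambda>X. hull_dist n {..<N} X x) \<in> borel_measurable (samples N)"
    by (intro hull_dist_sample lessThan_nonempty N) auto
  have "hits N x = {X \<in> space (samples N). hull_dist n {..<N} X x = 0}"
    by (intro Collect_cong conj_cong refl mem_sample_hull_iff[OF N x])
  also have "\<dots> \<in> sets (samples N)" by measurable
  finally show ?thesis .
qed

lemma prob_coordinate:
  assumes j: "j < N" and A: "A \<in> events"
  shows "measure (samples N) {X \<in> space (samples N). X j \<in> A} = prob A"
proof -
  interpret P: product_sigma_finite "\<lambda>_::nat. \<mu>" by (rule product_sigma_finite_\<mu>)
  let ?B = "\<lambda>k. if k = j then A else space \<mu>"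
  have AR: "A \<subseteq> Rn n" using sets.sets_into_space[OF A] by simp
  have "{X \<in> space (samples N). X j \<in> A} = PiE {..<N} ?B"
  proof (intro equalityI subsetI)
    fix X assume "X \<in> {X \<in> space (samples N). X j \<in> A}"
    then have X: "X \<in> {..<N} \<rightarrow>\<^sub>E Rn n" "X j \<in> A" unfolding space_sample by blast+
    show "X \<in> PiE {..<N} ?B"
    proof (rule PiE_I)
      fix k assume "k \<in> {..<N}"
      then show "X k \<in> ?B k" using PiE_mem[OF X(1), of k] X(2) by simp
    qed (rule PiE_arb[OF X(1)])
  next
    fix X assume X: "X \<in> PiE {..<N} ?B"
    then have "X j \<in> A" using PiE_mem[OF X, of j] j by simp
    moreover have "X \<in> {..<N} \<rightarrow>\<^sub>E Rn n"
    proof (rule PiE_I)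
      fix k assume "k \<in> {..<N}"
      then show "X k \<in> Rn n" using PiE_mem[OF X, of k] AR by (auto split: if_splits)
    qed (rule PiE_arb[OF X])
    ultimately show "X \<in> {X \<in> space (samples N). X j \<in> A}" unfolding space_sample by blast
  qed
  moreover have "emeasure (samples N) (PiE {..<N} ?B) = (\<Prod>k<N. emeasure \<mu> (?B k))"
    using A by (intro P.emeasure_PiM) simp_all
  moreover have "(\<Prod>k<N. emeasure \<mu> (?B k)) = (\<Prod>k<N. if k = j then emeasure \<mu> A else 1)"
    using emeasure_space_1 by (intro prod.cong) auto
  ultimately show ?thesis using j by (simp add: measure_def)
qed

text \<open>
  If \<open>x\<close> is in the hull, each half-space containing \<open>x\<close> contains a sample; take the union bound over
  the samples and then the infimum over the half-spaces.
\<close>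

lemma hit_probability_le:
  assumes N: "N \<ge> 1" and x: "x \<in> Rn n"
  shows "measure (samples N) (hits N x) \<le> N * depth x"
proof -
  interpret S: prob_space "samples N" by (rule prob_space_sample)
  have "S.prob (hits N x) / N \<le> depth x"
  proof (rule depth_ge[OF x])
    fix \<theta>
    let ?C = "cap \<theta> (ip \<theta> x)"
    have C: "{X \<in> space (samples N). X j \<in> ?C} \<in> sets (samples N)" if "j < N" for j
      using that by (intro measurable_sets_Collect[OF measurable_component_singleton]) auto
    have "S.prob (hits N x) \<le> S.prob (\<Union>j<N. {X \<in> space (samples N). X j \<in> ?C})"
    proof (rule S.finite_measure_mono)
      show "hits N x \<subseteq> (\<Union>j<N. {X \<in> space (samples N). X j \<in> ?C})"
      proof
        fix X assume X: "X \<in> (hits N x)"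
        then have Xj: "X j \<in> Rn n" if "j \<in> {..<N}" for j using that unfolding space_sample by blast
        then obtain j where "j < N" "ip \<theta> (X j) \<le> ip \<theta> x"
          using hull_meets_cap[of "{..<N}" X n x \<theta>] X by auto
        then show "X \<in> (\<Union>j<N. {X \<in> space (samples N). X j \<in> ?C})"
          using X Xj[of j] unfolding mem_cap by blast
      qed
      show "(\<Union>j<N. {X \<in> space (samples N). X j \<in> ?C}) \<in> S.events" using C by (intro sets.finite_UN) auto
    qed
    also have "\<dots> \<le> (\<Sum>j<N. S.prob {X \<in> space (samples N). X j \<in> ?C})"
      using C by (intro S.finite_measure_subadditive_finite) auto
    also have "\<dots> = (\<Sum>j<N. prob ?C)" by (intro sum.cong refl prob_coordinate) auto
    finally show "S.prob (hits N x) / N \<le> prob ?C" using N by (simp add: field_simps)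
  qed
  then show ?thesis using N by (simp add: field_simps)
qed

text \<open>
  Condition on the samples indexed by \<open>S\<close>. They determine a half-space containing \<open>x\<close> that every
  other sample must avoid, by \<open>hull_dist_decreases\<close>, and the other samples are independent of it.
\<close>

lemma compressed_miss_le:
  assumes x: "x \<in> Rn n" and S: "S \<subseteq> {..<N}" "S \<noteq> {}"
  defines "E \<equiv> {X \<in> space (samples N). 0 < hull_dist n S X x \<and>
      (\<forall>j\<in>{..<N} - S. hull_dist n (insert j S) X x = hull_dist n S X x)}"
  shows "E \<in> sets (samples N)" "measure (samples N) E \<le> (1 - depth x) ^ (N - card S)"
proof -
  interpret P: product_sigma_finite "\<lambda>_::nat. \<mu>" by (rule product_sigma_finite_\<mu>)
  interpret PS: prob_space "samples N" by (rule prob_space_sample)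
  interpret PS': prob_space "sample S" by (rule prob_space_sample)
  have fin: "finite S" using S(1) finite_subset by blast
  have m: "(\<lambda>X. hull_dist n T X x) \<in> borel_measurable (samples N)" if "T \<subseteq> {..<N}" "T \<noteq> {}" for T
    using that finite_subset[OF that(1)] by (intro hull_dist_sample) auto
  show E_sets: "E \<in> sets (samples N)" unfolding E_def
  proof (intro sets.sets_Collect_conj sets.sets_Collect_finite_All)
    show "{X \<in> space (samples N). 0 < hull_dist n S X x} \<in> PS.events"
      using m[OF S] by measurable
    show "{X \<in> space (samples N). hull_dist n (insert j S) X x = hull_dist n S X x} \<in> PS.events"
      if "j \<in> {..<N} - S" for j
    proof -
      have [measurable]: "(\<lambda>X. hull_dist n (insert j S) X x) \<in> borel_measurable (samples N)"
        using that S by (intro m) auto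
      show ?thesis using m[OF S] by measurable
    qed
  qed auto
  define J where "J = {..<N} - S"
  have J: "finite J" "S \<inter> J = {}" "S \<union> J = {..<N}" "card J = N - card S"
    using S fin by (auto simp: J_def card_Diff_subset)
  have d: "0 \<le> 1 - depth x" using depth_le_1[OF x] by simp
  have inner: "(\<integral>\<^sup>+y. indicator E (merge S J (xs, y)) \<partial>sample J) \<le> ennreal ((1 - depth x) ^ card J)"
    if xs: "xs \<in> space (sample S)" for xs
  proof (cases "hull_dist n S xs x > 0")
    case False
    have "merge S J (xs, y) \<notin> E" for y
    proof -
      have "hull_dist n S (merge S J (xs, y)) x = hull_dist n S xs x"
        by (rule hull_dist_cong) (simp add: merge_def)
      then show ?thesis using False by (simp add: E_def)
    qed
    then show ?thesis by simp
  next
    case True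
    obtain \<theta> where \<theta>: "\<theta> \<in> Rn n" "\<exists>i<n. \<theta> i \<noteq> 0"
      "\<And>j Y. j \<notin> S \<Longrightarrow> \<forall>k\<in>S. \<forall>i. Y k i = xs k i \<Longrightarrow> ip \<theta> (Y j) \<le> ip \<theta> x \<Longrightarrow>
         hull_dist n (insert j S) Y x < hull_dist n S xs x"
      by (rule hull_dist_decreases[OF fin S(2) True]) blast
    let ?C = "cap \<theta> (ip \<theta> x)"
    have dir: "direction \<theta>" using \<theta>(1,2) by (simp add: direction_def)
    have C_sets: "space \<mu> - ?C \<in> events" by (rule sets.compl_sets) simp
    have "(\<integral>\<^sup>+y. indicator E (merge S J (xs, y)) \<partial>sample J) \<le> (\<integral>\<^sup>+y. indicator (PiE J (\<lambda>_. space \<mu> - ?C)) y \<partial>sample J)"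
    proof (rule nn_integral_mono)
      fix y assume y: "y \<in> space (sample J)"
      have "y \<in> PiE J (\<lambda>_. space \<mu> - ?C)" if E: "merge S J (xs, y) \<in> E"
      proof (rule PiE_I)
        fix j assume j: "j \<in> J"
        have yR: "y j \<in> Rn n" using y j unfolding space_sample by blast
        let ?Y = "merge S J (xs, y)"
        have Yj: "?Y j = y j" using j J(2) by (auto simp: merge_def)
        have YS: "\<forall>k\<in>S. \<forall>i. ?Y k i = xs k i" by (simp add: merge_def)
        have "hull_dist n S ?Y x = hull_dist n S xs x" by (rule hull_dist_cong) (use YS in blast)
        moreover have "hull_dist n (insert j S) ?Y x = hull_dist n S ?Y x"
          using E j by (simp add: E_def J_def)
        ultimately have "\<not> ip \<theta> (?Y j) \<le> ip \<theta> x"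
          using \<theta>(3)[of j ?Y] j J(2) YS by (metis disjoint_iff less_irrefl)
        then show "y j \<in> space \<mu> - ?C" using yR by (simp add: Yj mem_cap)
      next
        fix j assume "j \<notin> J"
        then show "y j = undefined" using y unfolding space_sample by (rule PiE_arb[rotated])
      qed
      then show "indicator E (merge S J (xs, y)) \<le> (indicator (PiE J (\<lambda>_. space \<mu> - ?C)) y :: ennreal)"
        by (simp split: split_indicator)
    qed
    also have "\<dots> = emeasure (sample J) (PiE J (\<lambda>_. space \<mu> - ?C))"
      using J(1) C_sets by (intro nn_integral_indicator sets_PiM_I_finite) auto
    also have "\<dots> = (\<Prod>j\<in>J. emeasure \<mu> (space \<mu> - ?C))"
      using J(1) C_sets by (intro P.emeasure_PiM) auto
    also have "\<dots> = ennreal ((1 - prob ?C) ^ card J)"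
    proof -
      have "emeasure \<mu> (space \<mu> - ?C) = ennreal (1 - prob ?C)"
        unfolding emeasure_eq_measure by (subst prob_compl) simp_all
      then show ?thesis by (simp only: prod_constant ennreal_power diff_ge_0_iff_ge prob_le_1)
    qed
    also have "\<dots> \<le> ennreal ((1 - depth x) ^ card J)"
      using depth_le[OF x dir order_refl] prob_le_1[of ?C] by (intro ennreal_leI power_mono) auto
    finally show ?thesis .
  qed
  have "emeasure (samples N) E = (\<integral>\<^sup>+X. indicator E X \<partial>sample (S \<union> J))"
    using E_sets J(3) by simp
  also have "\<dots> = (\<integral>\<^sup>+xs. (\<integral>\<^sup>+y. indicator E (merge S J (xs, y)) \<partial>sample J) \<partial>sample S)"
    using E_sets J(3) by (intro P.product_nn_integral_fold J(2) fin J(1)) simp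
  also have "\<dots> \<le> (\<integral>\<^sup>+xs. ennreal ((1 - depth x) ^ card J) \<partial>sample S)"
    by (rule nn_integral_mono) (rule inner)
  also have "\<dots> = ennreal ((1 - depth x) ^ card J)" by (simp add: PS'.emeasure_space_1)
  finally show "measure (samples N) E \<le> (1 - depth x) ^ (N - card S)"
    unfolding PS.emeasure_eq_measure J(4) using d by (subst (asm) ennreal_le_iff) auto
qed

text \<open>
  A union bound over the sets \<open>S\<close> of at most \<open>n + 1\<close> indices that can span the nearest point.
\<close>

lemma miss_probability_le:
  assumes N: "N \<ge> 1" and x: "x \<in> Rn n"
  shows "measure (samples N) (misses N x)
    \<le> real N ^ (n + 1) * (1 - depth x) ^ (N - (n + 1))"
proof -
  interpret PS: prob_space "samples N" by (rule prob_space_sample)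
  define E where "E S = {X \<in> space (samples N). 0 < hull_dist n S X x \<and>
      (\<forall>j\<in>{..<N} - S. hull_dist n (insert j S) X x = hull_dist n S X x)}" for S
  let ?A = "{S. S \<subseteq> {..<N} \<and> S \<noteq> {} \<and> card S \<le> n + 1}"
  have d: "0 \<le> 1 - depth x" "1 - depth x \<le> 1" using depth_le_1[OF x] depth_nonneg[OF x] by auto
  have E_sets: "E S \<in> PS.events" if "S \<in> ?A" for S
    unfolding E_def using that by (intro compressed_miss_le(1)[OF x]) auto
  have E_le: "PS.prob (E S) \<le> (1 - depth x) ^ (N - (n + 1))" if "S \<in> ?A" for S
  proof -
    have "PS.prob (E S) \<le> (1 - depth x) ^ (N - card S)"
      unfolding E_def using that by (intro compressed_miss_le(2)[OF x]) auto
    also have "\<dots> \<le> (1 - depth x) ^ (N - (n + 1))"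
      using that d by (intro power_decreasing) auto
    finally show ?thesis .
  qed
  have "PS.prob (misses N x) \<le> PS.prob (\<Union>S\<in>?A. E S)"
  proof (rule PS.finite_measure_mono)
    show "misses N x \<subseteq> (\<Union>S\<in>?A. E S)"
    proof
      fix X assume X: "X \<in> (misses N x)"
      have ne: "finite {..<N}" "{..<N} \<noteq> {}" using lessThan_nonempty[OF N] by auto
      have "hull_dist n {..<N} X x \<noteq> 0" using mem_sample_hull_iff[OF N x, of X] X by blast
      then have pos: "hull_dist n {..<N} X x > 0" using hull_dist_nonneg[OF ne, of n X x] by simp
      obtain S where S: "S \<subseteq> {..<N}" "S \<noteq> {}" "card S \<le> n + 1"
        "\<And>j. j \<in> {..<N} \<Longrightarrow> hull_dist n (insert j S) X x = hull_dist n S X x"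
        "hull_dist n S X x = hull_dist n {..<N} X x"
        by (rule hull_dist_compression[OF ne]) blast
      then have "X \<in> E S" using X pos unfolding E_def by auto
      then show "X \<in> (\<Union>S\<in>?A. E S)" using S by blast
    qed
    show "(\<Union>S\<in>?A. E S) \<in> PS.events"
      by (intro sets.finite_UN card_small_subsets(1) E_sets)
  qed
  also have "\<dots> \<le> (\<Sum>S\<in>?A. PS.prob (E S))"
    using E_sets by (intro PS.finite_measure_subadditive_finite card_small_subsets(1)) blast
  also have "\<dots> \<le> (\<Sum>S\<in>?A. (1 - depth x) ^ (N - (n + 1)))" by (rule sum_mono) (rule E_le)
  also have "\<dots> = card ?A * (1 - depth x) ^ (N - (n + 1))" by (rule sum_constant)
  also have "\<dots> \<le> real N ^ (n + 1) * (1 - depth x) ^ (N - (n + 1))"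
  proof (rule mult_right_mono)
    have "real (card ?A) \<le> real (N ^ (n + 1))"
      by (rule of_nat_mono) (rule card_small_subsets(2))
    then show "real (card ?A) \<le> real N ^ (n + 1)" by (simp only: of_nat_power)
  qed (use d in simp)
  finally show ?thesis .
qed

abbreviation "coverage N \<equiv> expected_hull_measure n \<mu> N"

text \<open>
  Fubini: the expected measure of the hull is the integral of the probability to be in the hull.
  It reduces both bounds below to a fixed point \<open>x\<close>.
\<close>

lemma coverage_eq:
  assumes N: "N \<ge> 1"
  shows "ennreal (coverage N) =
    (\<integral>\<^sup>+x. ennreal (measure (samples N) (hits N x)) \<partial>\<mu>)"
proof -
  interpret PS: prob_space "samples N" by (rule prob_space_sample)
  interpret PP: pair_sigma_finite "samples N" \<mu>
    by (rule pair_sigma_finite.intro) (rule PS.sigma_finite_measure_axioms, rule sigma_finite_measure_axioms)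
  define Q where "Q = {w \<in> space (samples N \<Otimes>\<^sub>M \<mu>). hull_dist n {..<N} (fst w) (snd w) = 0}"
  have "(\<lambda>w. hull_dist n {..<N} (fst w) (snd w)) \<in> borel_measurable (samples N \<Otimes>\<^sub>M \<mu>)"
    using lessThan_nonempty[OF N]
    by (intro hull_dist_measurable measurable_compose[OF measurable_fst coord_sample]
      measurable_compose[OF measurable_snd coord_\<mu>]) auto
  then have Q [measurable]: "Q \<in> sets (samples N \<Otimes>\<^sub>M \<mu>)" unfolding Q_def by measurable
  have Q_iff: "(X, x) \<in> Q \<longleftrightarrow> x \<in> sample_hull N X" if "X \<in> space (samples N)" "x \<in> Rn n" for X x
    using mem_sample_hull_iff[OF N that(2,1)] that by (simp add: Q_def space_pair_measure)
  have sec: "(\<integral>\<^sup>+x. indicator Q (X, x) \<partial>\<mu>) = ennreal (prob (sample_hull N X))"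
    if X: "X \<in> space (samples N)" for X
  proof -
    have "X j \<in> Rn n" if "j \<in> {..<N}" for j using X that unfolding space_sample by blast
    then have "sample_hull N X \<subseteq> Rn n"
      by (intro hull_minimal) (auto simp: Rn_convex_def)
    then have "Pair X -` Q = sample_hull N X"
      using Q_iff[OF X] sets.sets_into_space[OF Q] by (auto simp: space_pair_measure)
    moreover have "Pair X -` Q \<in> events" by (rule sets_Pair1[OF Q])
    moreover have "(\<integral>\<^sup>+x. indicator Q (X, x) \<partial>\<mu>) = (\<integral>\<^sup>+x. indicator (Pair X -` Q) x \<partial>\<mu>)"
      by (intro nn_integral_cong) (simp split: split_indicator)
    ultimately show ?thesis by (simp add: emeasure_eq_measure)
  qed
  have "(\<lambda>X. \<integral>\<^sup>+x. indicator Q (X, x) \<partial>\<mu>) \<in> borel_measurable (samples N)" by measurable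
  then have "(\<lambda>X. ennreal (prob (sample_hull N X))) \<in> borel_measurable (samples N)"
    by (subst (asm) measurable_cong[OF sec])
  then have meas: "(\<lambda>X. prob (sample_hull N X)) \<in> borel_measurable (samples N)"
    by (subst (asm) borel_measurable_ennreal_iff) auto
  have "coverage N = enn2real (\<integral>\<^sup>+X. ennreal (prob (sample_hull N X)) \<partial>samples N)"
    unfolding expected_hull_measure_def by (rule integral_eq_nn_integral[OF meas]) simp
  moreover have "(\<integral>\<^sup>+X. ennreal (prob (sample_hull N X)) \<partial>samples N) < top"
  proof -
    have "(\<integral>\<^sup>+X. ennreal (prob (sample_hull N X)) \<partial>samples N) \<le> (\<integral>\<^sup>+X. 1 \<partial>samples N)"
      by (intro nn_integral_mono) (simp add: ennreal_le_1)
    then show ?thesis by (simp add: PS.emeasure_space_1 le_less_trans)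
  qed
  ultimately have "ennreal (coverage N) = (\<integral>\<^sup>+X. ennreal (prob (sample_hull N X)) \<partial>samples N)"
    by simp
  also have "\<dots> = (\<integral>\<^sup>+X. (\<integral>\<^sup>+x. indicator Q (X, x) \<partial>\<mu>) \<partial>samples N)"
    by (rule nn_integral_cong) (rule sec[symmetric])
  also have "\<dots> = (\<integral>\<^sup>+x. (\<integral>\<^sup>+X. indicator Q (X, x) \<partial>samples N) \<partial>\<mu>)"
    by (rule PP.Fubini'[symmetric]) (use Q in simp)
  also have "\<dots> = (\<integral>\<^sup>+x. ennreal (measure (samples N) (hits N x)) \<partial>\<mu>)"
  proof (rule nn_integral_cong)
    fix x assume "x \<in> space \<mu>"
    then have x: "x \<in> Rn n" by simp
    have "(\<integral>\<^sup>+X. indicator Q (X, x) \<partial>samples N) =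
        (\<integral>\<^sup>+X. indicator (hits N x) X \<partial>samples N)"
      using Q_iff[OF _ x] by (intro nn_integral_cong) (simp split: split_indicator)
    also have "\<dots> = ennreal (measure (samples N) (hits N x))"
      unfolding PS.emeasure_eq_measure[symmetric] by (rule nn_integral_indicator[OF hit_sets[OF N x]])
    finally show "(\<integral>\<^sup>+X. indicator Q (X, x) \<partial>samples N) = ennreal (measure (samples N) (hits N x))" .
  qed
  finally show ?thesis .
qed

lemma coverage_nonneg: "coverage N \<ge> 0"
  unfolding expected_hull_measure_def by (rule integral_nonneg_AE) simp

theorem coverage_le:
  assumes N: "N \<ge> 1" and s: "s \<ge> 0"
  shows "coverage N \<le> prob (deep s) + N * s"
proof -
  interpret PS: prob_space "samples N" by (rule prob_space_sample)
  have "ennreal (coverage N) = (\<integral>\<^sup>+x. ennreal (PS.prob (hits N x)) \<partial>\<mu>)"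
    by (rule coverage_eq[OF N])
  also have "\<dots> \<le> (\<integral>\<^sup>+x. indicator (deep s) x + ennreal (N * s) \<partial>\<mu>)"
  proof (rule nn_integral_mono)
    fix x assume "x \<in> space \<mu>"
    then have x: "x \<in> Rn n" by simp
    show "ennreal (PS.prob (hits N x)) \<le> indicator (deep s) x + ennreal (N * s)"
    proof (cases "x \<in> deep s")
      case True
      have "ennreal (PS.prob (hits N x)) \<le> 1" using PS.prob_le_1 by (simp add: ennreal_le_1)
      then show ?thesis using True by (simp add: add_increasing2)
    next
      case False
      have "PS.prob (hits N x) \<le> N * depth x" by (rule hit_probability_le[OF N x])
      also have "\<dots> \<le> N * s" using False x by (intro mult_left_mono) (auto simp: mem_deep)
      finally show ?thesis using False by (simp add: ennreal_leI)
    qed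
  qed
  also have "\<dots> = ennreal (prob (deep s)) + ennreal (N * s)"
  proof -
    have "integral\<^sup>N \<mu> (indicator (deep s)) = ennreal (prob (deep s))"
      unfolding emeasure_eq_measure[symmetric] by (rule nn_integral_indicator) simp
    moreover have "(\<integral>\<^sup>+x. ennreal (N * s) \<partial>\<mu>) = ennreal (N * s)"
      by (simp only: nn_integral_const emeasure_space_1 mult_1_right)
    ultimately show ?thesis by (subst nn_integral_add) simp_all
  qed
  also have "\<dots> = ennreal (prob (deep s) + N * s)" using s by (intro ennreal_plus[symmetric]) auto
  finally show ?thesis using s by (subst (asm) ennreal_le_iff) auto
qed

theorem coverage_ge:
  assumes N: "N \<ge> 1" and s: "s \<le> 1"
  shows "coverage N \<ge> prob (deep s) - real N ^ (n + 1) * (1 - s) ^ (N - (n + 1))"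
proof -
  interpret PS: prob_space "samples N" by (rule prob_space_sample)
  define b where "b = real N ^ (n + 1) * (1 - s) ^ (N - (n + 1))"
  have b: "b \<ge> 0" using s by (simp add: b_def)
  show ?thesis
  proof (cases "b \<le> 1")
    case False
    then have "prob (deep s) \<le> b" using prob_le_1[of "deep s"] by linarith
    then show ?thesis using coverage_nonneg[of N] by (simp add: b_def)
  next
    case True
    have "ennreal ((1 - b) * prob (deep s)) = ennreal (1 - b) * emeasure \<mu> (deep s)"
      using True by (simp only: emeasure_eq_measure) (rule ennreal_mult, simp_all)
    also have "\<dots> = (\<integral>\<^sup>+x. ennreal (1 - b) * indicator (deep s) x \<partial>\<mu>)"
      by (rule nn_integral_cmult_indicator[symmetric]) simp
    also have "\<dots> \<le> (\<integral>\<^sup>+x. ennreal (PS.prob (hits N x)) \<partial>\<mu>)"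
    proof (rule nn_integral_mono)
      fix x assume "x \<in> space \<mu>"
      then have x: "x \<in> Rn n" by simp
      show "ennreal (1 - b) * indicator (deep s) x \<le> ennreal (PS.prob (hits N x))"
      proof (cases "x \<in> deep s")
        case True
        have "space (samples N) - hits N x = misses N x" by blast
        then have "1 - PS.prob (hits N x) = PS.prob (misses N x)"
          using PS.prob_compl[OF hit_sets[OF N x]] by simp
        also have "\<dots> \<le> real N ^ (n + 1) * (1 - depth x) ^ (N - (n + 1))" by (rule miss_probability_le[OF N x])
        also have "\<dots> \<le> b" unfolding b_def
          using True depth_le_1[OF x] by (intro mult_left_mono power_mono) (auto simp: mem_deep)
        finally have "1 - b \<le> PS.prob (hits N x)" by simp
        then show ?thesis using True by (simp add: ennreal_leI)
      qed simp
    qed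
    also have "\<dots> = ennreal (coverage N)" by (rule coverage_eq[OF N, symmetric])
    finally have "(1 - b) * prob (deep s) \<le> coverage N"
      using coverage_nonneg by (subst (asm) ennreal_le_iff) auto
    moreover have "b * prob (deep s) \<le> b" using b prob_le_1[of "deep s"] by (simp add: mult_left_le)
    ultimately show ?thesis unfolding b_def[symmetric] by (simp add: left_diff_distrib)
  qed
qed

end

section \<open>The sharp threshold\<close>

lemma cube_le_exp:
  assumes "(x::real) \<ge> 0"
  shows "x ^ 3 / 27 \<le> exp x"
proof -
  have "x / 3 \<le> exp (x / 3)" using exp_ge_add_one_self[of "x / 3"] by linarith
  then have "(x / 3) ^ 3 \<le> exp (x / 3) ^ 3" using assms by (intro power_mono) auto
  also have "exp (x / 3) ^ 3 = exp x" by (simp flip: exp_of_nat_mult)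
  finally show ?thesis by (simp add: power_divide)
qed

text \<open>
  In the proof of \<open>rho2_le\<close>, \<open>\<rho>\<close> is \<open>ln N\<close>; the exponential stems from the expected number of samples
  in a half-space, the square from the number of sets of \<open>n + 1\<close> samples.
\<close>

lemma square_minus_exp_le:
  fixes k :: real
  assumes k: "k > 0" and \<rho>: "\<rho> \<ge> 1" "\<rho> \<ge> 135 / k ^ 3" "\<rho> \<ge> b"
  shows "(\<rho> + 1)\<^sup>2 - exp (k * \<rho>) \<le> - b"
proof -
  have "5 \<le> k ^ 3 * \<rho> / 27" using \<rho>(2) k by (simp add: field_simps)
  then have "5 * \<rho>\<^sup>2 \<le> (k ^ 3 * \<rho> / 27) * \<rho>\<^sup>2" by (intro mult_right_mono) auto
  also have "\<dots> = (k * \<rho>) ^ 3 / 27" by (simp add: power_mult_distrib power3_eq_cube power2_eq_square)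
  also have "\<dots> \<le> exp (k * \<rho>)" using k \<rho> by (intro cube_le_exp) auto
  finally have 1: "5 * \<rho>\<^sup>2 \<le> exp (k * \<rho>)" .
  have 2: "(\<rho> + 1)\<^sup>2 \<le> (2 * \<rho>)\<^sup>2" using \<rho>(1) by (intro power_mono) auto
  have 3: "\<rho> \<le> \<rho>\<^sup>2" using \<rho>(1) by (simp add: power2_eq_square)
  have 4: "(2 * \<rho>)\<^sup>2 = 4 * \<rho>\<^sup>2" by (simp add: power_mult_distrib)
  show ?thesis using 1 2 3 4 \<rho>(3) by linarith
qed

text \<open>
  The constant is chosen such that \<open>exp (window \<delta> / 2) = 4 / \<delta>\<close>, which makes both tails of
  \<open>- ln q\<close> at distance \<open>n * window \<delta>\<close> from the median at most \<open>\<delta> / 2\<close>.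
\<close>

definition "window \<delta> = 2 * ln (4 / \<delta> :: real)"

context body begin

abbreviation "mean_cramer \<equiv> enn2real (expect n K cramer)"

lemma median_bounds:
  assumes "is_median s0"
  shows "0 < s0" "- ln s0 \<ge> 0"
  using assms by (simp_all add: is_median_def)

lemma depth_concentration:
  assumes s0: "is_median s0" and \<delta>: "0 < \<delta>" "\<delta> < 1"
  shows "prob (deep (s0 * exp (- (n * window \<delta>)))) \<ge> 1 - \<delta> / 2"
    and "prob (deep (s0 * exp (n * window \<delta>))) \<le> \<delta> / 2"
proof -
  have w: "window \<delta> > 0" using \<delta> by (simp add: window_def)
  have e: "exp (window \<delta> / 2) = 4 / \<delta>" "exp (- window \<delta> / 2) = \<delta> / 4"
    using \<delta> by (simp_all add: window_def exp_minus)
  have "1 - \<delta> / 2 \<le> 1 - \<delta> / 4" using \<delta> by simp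
  also have "\<dots> \<le> (1 / 2) powr (\<delta> / 4)" using \<delta> by (intro half_powr_ge) simp
  also have "\<dots> \<le> prob (deep (s0 * exp (- (n * window \<delta>))))"
    using depth_upper_tail[OF s0 w] unfolding e .
  finally show "prob (deep (s0 * exp (- (n * window \<delta>)))) \<ge> 1 - \<delta> / 2" .
  have "prob (deep (s0 * exp (n * window \<delta>))) \<le> (1 / 2) powr (4 / \<delta>)"
    using depth_lower_tail[OF s0 w] unfolding e .
  also have "\<dots> \<le> 2 / (4 / \<delta>)" using \<delta> by (intro half_powr_le) simp
  finally show "prob (deep (s0 * exp (n * window \<delta>))) \<le> \<delta> / 2" by simp
qed

lemma expect_cramer_le: "expect n K cramer \<le> expect n K neg_log"
  unfolding expect_def
  by (intro nn_integral_mono e2ennreal_mono cramer_le_neg_log_depth) simp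

lemma expect_cramer_finite: "expect n K cramer < top"
proof -
  obtain s0 where s0: "is_median s0" by (rule median_exists)
  have "expect n K cramer \<le> ennreal (- ln s0 + n * (1 / (1 - exp (- 1 / 2))))"
    using expect_cramer_le expect_neg_log_depth_le[OF s0] by (rule order_trans)
  then show ?thesis by (rule le_less_trans) simp
qed

lemma mean_cramer_pos: "mean_cramer > 0"
  using expect_cramer_pos expect_cramer_finite by (simp add: enn2real_positive_iff)

lemma mean_cramer_le:
  assumes s0: "is_median s0"
  shows "mean_cramer \<le> - ln s0 + n * (1 / (1 - exp (- 1 / 2)))"
proof (rule enn2real_leI)
  have "0 \<le> - ln s0" using s0 by (simp add: is_median_def)
  moreover have "0 \<le> n * (1 / (1 - exp (- 1 / 2 :: real)))" by (intro mult_nonneg_nonneg divide_nonneg_nonneg) auto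
  ultimately show "0 \<le> - ln s0 + n * (1 / (1 - exp (- 1 / 2)))" by linarith
  show "expect n K cramer \<le> ennreal (- ln s0 + n * (1 / (1 - exp (- 1 / 2))))"
    using expect_cramer_le expect_neg_log_depth_le[OF s0] by (rule order_trans)
qed

text \<open>
  The pointwise lower bound for the Cramer transform, on the set where \<open>- ln q\<close> is within
  \<open>n * window \<delta>\<close> of the median. The side condition keeps the level \<open>s2\<close> at most \<open>1\<close>.
\<close>

lemma mean_cramer_ge:
  assumes s0: "is_median s0" and \<delta>: "0 < \<delta>" "\<delta> < 1" and c: "0 < c" "c < 1"
    and small: "n * window \<delta> \<le> - ln s0"
  shows "(c * (- ln s0 - n * window \<delta>) - ln (exp_tail_const c)) * (1 - \<delta>) \<le> mean_cramer"
proof -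
  define b where "b = c * (- ln s0 - n * window \<delta>) - ln (exp_tail_const c)"
  define s1 where "s1 = s0 * exp (- (n * window \<delta>))"
  define s2 where "s2 = s0 * exp (n * window \<delta>)"
  define D where "D = deep s1 - deep s2"
  have s0': "s0 > 0" using s0 by (simp add: is_median_def)
  have w: "window \<delta> > 0" using \<delta> by (simp add: window_def)
  have s12: "0 < s1" "s1 \<le> s2" using s0' w by (simp_all add: s1_def s2_def)
  have ln_s2: "ln s2 = ln s0 + n * window \<delta>" using s0' by (simp add: s2_def ln_mult)
  have s2_1: "s2 \<le> 1"
  proof -
    have "ln s2 \<le> 0" using small ln_s2 by simp
    then show ?thesis using s12 by simp
  qed
  have D_sets: "D \<in> events" unfolding D_def by (intro sets.Diff) simp_all
  have "prob D = prob (deep s1) - prob (deep s2)"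
    unfolding D_def using s12 by (intro finite_measure_Diff) (auto simp: mem_deep)
  then have pD: "prob D \<ge> 1 - \<delta>"
    using depth_concentration[OF s0 \<delta>] unfolding s1_def s2_def by linarith
  show ?thesis
  proof (cases "b \<le> 0")
    case True
    then have "b * (1 - \<delta>) \<le> 0" using \<delta> by (intro mult_nonpos_nonneg) auto
    then show ?thesis unfolding b_def using enn2real_nonneg order_trans by blast
  next
    case False
    have "ennreal (b * prob D) = (\<integral>\<^sup>+x. ennreal b * indicator D x \<partial>\<mu>)"
      using False by (simp add: nn_integral_cmult_indicator[OF D_sets] emeasure_eq_measure ennreal_mult)
    also have "\<dots> \<le> expect n K cramer"
      unfolding expect_def
    proof (rule nn_integral_mono)
      fix x
      show "ennreal b * indicator D x \<le> e2ennreal (cramer x)"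
      proof (cases "x \<in> D")
        case True
        then have in_deep: "x \<in> deep s1" "x \<notin> deep s2" unfolding D_def by blast+
        then have x: "x \<in> Rn n" "0 < depth x" "depth x < s2"
          using s12(1) unfolding mem_deep by simp_all
        have "ln (1 / s2) = - ln s0 - n * window \<delta>" using s12 ln_s2 by (simp add: ln_div)
        then have "ereal b \<le> cramer x"
          using cramer_ge_neg_log_depth[OF x s2_1 c] unfolding b_def by simp
        then have "e2ennreal (ereal b) \<le> e2ennreal (cramer x)" by (rule e2ennreal_mono)
        then show ?thesis using True by simp
      qed simp
    qed
    also have "\<dots> = ennreal mean_cramer" using expect_cramer_finite by simp
    finally have "b * prob D \<le> mean_cramer" by (simp add: ennreal_le_iff)
    moreover have "b * (1 - \<delta>) \<le> b * prob D" using False pD by (intro mult_left_mono) auto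
    ultimately show ?thesis unfolding b_def by linarith
  qed
qed

text \<open>
  Points of depth at least \<open>s\<close> have measure at most \<open>\<delta> / 2\<close>. The others are covered with probability
  at most \<open>N s\<close>, whose logarithm is at most \<open>(1 - e) (1 + e) m - m = - e\<^sup>2 m\<close> up to the window.
\<close>

theorem rho1_ge:
  assumes s0: "is_median s0" and \<delta>: "0 < \<delta>" "\<delta> < 1" and e: "0 < e" "e < 1"
    and T: "mean_cramer \<le> (1 + e) * - ln s0"
    and m: "n * window \<delta> + ln (2 / \<delta>) \<le> e\<^sup>2 * - ln s0"
  shows "rho1 n \<mu> \<delta> \<ge> ereal ((1 - e) * mean_cramer)"
proof -
  define r where "r = (1 - e) * mean_cramer"
  define s where "s = s0 * exp (n * window \<delta>)"
  have s0': "s0 > 0" using s0 by (simp add: is_median_def)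
  have r: "r > 0" using e mean_cramer_pos by (simp add: r_def)
  have "coverage N \<le> \<delta>" if N: "N \<ge> 1" "real N \<le> exp r" for N
  proof -
    have "coverage N \<le> prob (deep s) + N * s"
      using s0' by (intro coverage_le N) (simp add: s_def)
    moreover have "prob (deep s) \<le> \<delta> / 2" unfolding s_def by (rule depth_concentration(2)[OF s0 \<delta>])
    moreover have "N * s \<le> \<delta> / 2"
    proof -
      have "N * s \<le> exp r * s" using N s0' by (intro mult_right_mono) (auto simp: s_def)
      also have "\<dots> = exp (r + ln s0 + n * window \<delta>)" using s0' by (simp add: s_def exp_add)
      also have "\<dots> \<le> exp (ln (\<delta> / 2))"
      proof -
        have "r \<le> (1 - e) * ((1 + e) * - ln s0)" unfolding r_def using T e by (intro mult_left_mono) auto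
        also have "\<dots> = - ln s0 - e\<^sup>2 * - ln s0" by (simp add: algebra_simps power2_eq_square)
        finally have "r + ln s0 + n * window \<delta> \<le> - ln (2 / \<delta>)" using m by linarith
        also have "\<dots> = ln (\<delta> / 2)" using \<delta> by (simp add: ln_div)
        finally show ?thesis by simp
      qed
      also have "\<dots> = \<delta> / 2" using \<delta> by simp
      finally show ?thesis .
    qed
    ultimately show ?thesis by linarith
  qed
  then have "r \<in> {r. r > 0 \<and> (\<forall>N\<ge>1. real N \<le> exp r \<longrightarrow> coverage N \<le> \<delta>)}" using r by blast
  then show ?thesis unfolding rho1_def r_def[symmetric] by (intro Sup_upper imageI)
qed

text \<open>
  Up to measure \<open>\<delta> / 2\<close> all points have depth at least \<open>s\<close>. For \<open>\<rho> = ln N\<close> above the threshold, \<open>N s\<close>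
  exceeds \<open>exp (e \<rho> / 6)\<close>, which beats the factor \<open>N ^ (n + 1) \<le> exp ((\<rho> + 1) \<rho>)\<close> because \<open>n \<le> m \<le> \<rho>\<close>.
\<close>

theorem rho2_le:
  assumes s0: "is_median s0" and \<delta>: "0 < \<delta>" "\<delta> < 1" and e: "0 < e" "e < 1"
    and T: "(1 - e / 4) * - ln s0 \<le> mean_cramer"
    and m: "n * window \<delta> \<le> e / 4 * - ln s0" "n \<le> - ln s0"
      "135 / (e / 6) ^ 3 \<le> - ln s0" "ln (2 / \<delta>) \<le> - ln s0"
  shows "rho2 n \<mu> \<delta> \<le> ereal ((1 + e) * mean_cramer)"
proof -
  define r where "r = (1 + e) * mean_cramer"
  define M where "M = - ln s0"
  define s where "s = s0 * exp (- (n * window \<delta>))"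
  have s0': "s0 > 0" "s0 \<le> 1" using s0 by (auto simp: is_median_def)
  have w: "window \<delta> > 0" using \<delta> by (simp add: window_def)
  have s: "s = exp (- (M + n * window \<delta>))" using s0' by (simp add: s_def M_def exp_add exp_minus exp_diff field_simps)
  have M1: "M \<ge> 1" using m(2) n_pos by (simp add: M_def)
  have "0 \<le> n * window \<delta>" using w by simp
  then have "- (M + n * window \<delta>) \<le> 0" using M1 by linarith
  then have s1: "0 < s" "s \<le> 1" unfolding s by (simp_all only: exp_gt_zero exp_le_one_iff)
  have r: "r > 0" using e mean_cramer_pos by (simp add: r_def)
  have rM: "r \<ge> (1 + e / 2) * M"
  proof -
    have "e * e \<le> e * 1" using e by (intro mult_left_mono) auto
    moreover have "(1 + e) * (1 - e / 4) = 1 + e - e / 4 - e * e / 4"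
      by (simp add: field_simps)
    ultimately have "1 + e / 2 \<le> (1 + e) * (1 - e / 4)" by linarith
    then have "(1 + e / 2) * M \<le> (1 + e) * (1 - e / 4) * M" using M1 by (intro mult_right_mono) auto
    also have "\<dots> = (1 + e) * ((1 - e / 4) * M)" by (rule mult.assoc)
    also have "\<dots> \<le> r" unfolding r_def M_def using T e by (intro mult_left_mono) auto
    finally show ?thesis .
  qed
  have "coverage N \<ge> 1 - \<delta>" if N: "N \<ge> 1" "real N \<ge> exp r" for N
  proof -
    define \<rho> where "\<rho> = ln (real N)"
    have N0: "real N > 0" using N by simp
    have \<rho>N: "exp \<rho> = N" using N0 by (simp add: \<rho>_def)
    have \<rho>r: "\<rho> \<ge> r"
    proof -
      have "exp r \<le> exp \<rho>" using N(2) \<rho>N by simp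
      then show ?thesis by simp
    qed
    have \<rho>M': "\<rho> \<ge> (1 + e / 2) * M" using \<rho>r rM by linarith
    have \<rho>M: "\<rho> \<ge> M"
    proof -
      have "1 * M \<le> (1 + e / 2) * M" using M1 e by (intro mult_right_mono) auto
      then show ?thesis using \<rho>M' by simp
    qed
    have gain: "e / 6 * \<rho> \<le> \<rho> - (M + n * window \<delta>)"
    proof -
      have "(M + n * window \<delta>) * (1 + e / 2) \<le> ((1 + e / 4) * M) * (1 + e / 2)"
        using m(1) e by (intro mult_right_mono) (auto simp: M_def algebra_simps)
      also have "\<dots> = (1 + e / 4) * ((1 + e / 2) * M)" by simp
      also have "\<dots> \<le> (1 + e / 4) * \<rho>" using \<rho>M' e by (intro mult_left_mono) auto
      also have "\<dots> \<le> ((1 - e / 6) * (1 + e / 2)) * \<rho>"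
      proof (rule mult_right_mono)
        have "e * e \<le> e * 1" using e by (intro mult_left_mono) auto
        moreover have "(1 - e / 6) * (1 + e / 2) = 1 + e / 2 - e / 6 - e * e / 12"
          by (simp add: field_simps)
        ultimately show "1 + e / 4 \<le> (1 - e / 6) * (1 + e / 2)" by linarith
        show "0 \<le> \<rho>" using \<rho>M M1 by simp
      qed
      also have "\<dots> = ((1 - e / 6) * \<rho>) * (1 + e / 2)" by simp
      finally have "M + n * window \<delta> \<le> (1 - e / 6) * \<rho>" by (rule mult_right_le_imp_le) (use e in simp)
      then show ?thesis by (simp add: algebra_simps)
    qed
    have "real N ^ (n + 1) * (1 - s) ^ (N - (n + 1)) \<le> \<delta> / 2"
    proof -
      have "(1 - s) ^ (N - (n + 1)) \<le> exp (- s) ^ (N - (n + 1))"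
        using s1 exp_ge_add_one_self[of "- s"] by (intro power_mono) auto
      also have "\<dots> = exp (- s * real (N - (n + 1)))" by (simp flip: exp_of_nat_mult add: mult.commute)
      also have "\<dots> \<le> exp (real (n + 1) - exp (e / 6 * \<rho>))"
      proof -
        have "s * real N = exp (\<rho> - (M + n * window \<delta>))" unfolding s \<rho>N[symmetric] by (simp flip: exp_add)
        then have "exp (e / 6 * \<rho>) \<le> s * real N" using gain by simp
        moreover have "s * (real N - real (n + 1)) \<le> s * real (N - (n + 1))"
          using s1 by (intro mult_left_mono) auto
        moreover have "s * real (n + 1) \<le> 1 * real (n + 1)" using s1 by (intro mult_right_mono) auto
        ultimately show ?thesis by (simp add: algebra_simps)
      qed
      finally have "real N ^ (n + 1) * (1 - s) ^ (N - (n + 1)) \<le> exp \<rho> ^ (n + 1) * exp (real (n + 1) - exp (e / 6 * \<rho>))"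
        unfolding \<rho>N by (intro mult_left_mono) auto
      also have "\<dots> = exp (real (n + 1) * \<rho> + (real (n + 1) - exp (e / 6 * \<rho>)))"
        by (simp only: exp_add exp_of_nat_mult)
      also have "\<dots> \<le> exp (- ln (2 / \<delta>))"
      proof -
        have "real n \<le> \<rho>" using m(2) \<rho>M by (simp add: M_def)
        then have "real (n + 1) * (\<rho> + 1) \<le> (\<rho> + 1) * (\<rho> + 1)"
          using \<rho>M M1 by (intro mult_right_mono) auto
        then have "real (n + 1) * \<rho> + (real (n + 1) - exp (e / 6 * \<rho>)) \<le> (\<rho> + 1)\<^sup>2 - exp (e / 6 * \<rho>)"
          by (simp add: power2_eq_square algebra_simps)
        also have "\<dots> \<le> - ln (2 / \<delta>)"
          using e m(3,4) \<rho>M M1 by (intro square_minus_exp_le) (auto simp: M_def)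
        finally show ?thesis by simp
      qed
      also have "\<dots> = \<delta> / 2" using \<delta> by (simp add: exp_minus)
      finally show ?thesis .
    qed
    moreover have "prob (deep s) \<ge> 1 - \<delta> / 2" unfolding s_def by (rule depth_concentration(1)[OF s0 \<delta>])
    moreover have "coverage N \<ge> prob (deep s) - real N ^ (n + 1) * (1 - s) ^ (N - (n + 1))"
      by (rule coverage_ge[OF N(1) s1(2)])
    ultimately show ?thesis by linarith
  qed
  then have "r \<in> {r. r > 0 \<and> (\<forall>N\<ge>1. real N \<ge> exp r \<longrightarrow> coverage N \<ge> 1 - \<delta>)}" using r by blast
  then show ?thesis unfolding rho2_def r_def[symmetric] by (intro Inf_lower imageI)
qed

end

text \<open>
  At stage \<open>n\<close> take the last \<open>k \<le> n\<close> whose property has set in by then.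
\<close>

lemma diagonal_sequence:
  assumes "\<And>k::nat. \<forall>\<^sub>F n in sequentially. P k n"
  shows "\<exists>j :: nat \<Rightarrow> nat. \<forall>k. \<forall>\<^sub>F n in sequentially. k \<le> j n \<and> P (j n) n"
proof -
  have "\<forall>k. \<exists>N. \<forall>n\<ge>N. P k n" using assms by (simp add: eventually_sequentially)
  then obtain N where N: "\<forall>k. \<forall>n\<ge>N k. P k n" by (rule choice[THEN exE])
  define A where "A n = {k. k \<le> n \<and> N k \<le> n}" for n
  have fin: "finite (A n)" for n by (simp add: A_def)
  have "k \<le> Max (A n) \<and> P (Max (A n)) n" if "n \<ge> max k (N k)" for k n
  proof -
    have k: "k \<in> A n" using that by (simp add: A_def)
    then have "Max (A n) \<in> A n" using fin by (intro Max_in) auto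
    then have "P (Max (A n)) n" using N by (simp add: A_def)
    then show ?thesis using Max_ge[OF fin k] by simp
  qed
  then have "\<forall>k. \<forall>\<^sub>F n in sequentially. k \<le> Max (A n) \<and> P (Max (A n)) n"
    unfolding eventually_sequentially by blast
  then show ?thesis by (intro exI[of _ "\<lambda>n. Max (A n)"])
qed

theorem corollary8p8:
  fixes K :: "nat \<Rightarrow> (nat \<Rightarrow> real) set"
  assumes "\<And>n. n \<ge> 1 \<Longrightarrow> convex_body n (K n)"
    and "(\<lambda>n. expect n (K n) (neg_log_depth n (K n)) / of_nat n) \<longlonglongrightarrow> \<infinity>"
  shows "sharp_threshold (\<lambda>n. unif n (K n))
           (\<lambda>n. enn2real (expect n (K n) (cramer_transform n (K n))))"
proof -
  define T where "T n = enn2real (expect n (K n) (cramer_transform n (K n)))" for n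
  have B: "body n (K n)" if "n \<ge> 1" for n using assms(1)[OF that] that by (intro body.intro)
  have "\<exists>s. body.is_median n (K n) s" if "n \<ge> 1" for n using body.median_exists[OF B[OF that]] by metis
  then obtain s0 where s0: "\<And>n. n \<ge> 1 \<Longrightarrow> body.is_median n (K n) (s0 n)" by metis
  define m where "m n = - ln (s0 n)" for n
  define C where "C = 1 / (1 - exp (- 1 / 2 :: real))"
  have C: "C > 0" by (simp add: C_def)
  have m0: "m n \<ge> 0" if "n \<ge> 1" for n
    unfolding m_def by (rule body.median_bounds(2)[OF B[OF that] s0[OF that]])
  \<comment> \<open>The mean of \<open>- ln q\<close> exceeds the median by at most \<open>C * n\<close>, so the median inherits the growth.\<close>
  have m_large: "\<forall>\<^sub>F n in sequentially. A * n \<le> m n" for A :: real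
  proof -
    have "\<forall>\<^sub>F n in sequentially. ennreal (\<bar>A\<bar> + C) < expect n (K n) (neg_log_depth n (K n)) / of_nat n"
      using assms(2) by (rule order_tendstoD) simp
    then show ?thesis using eventually_ge_at_top[of 1]
    proof eventually_elim
      case (elim n)
      have n: "real n > 0" using elim(2) by simp
      have "expect n (K n) (neg_log_depth n (K n)) \<le> ennreal (m n + n * C)"
        using body.expect_neg_log_depth_le[OF B s0, OF elim(2) elim(2)] by (simp only: m_def C_def)
      then have "expect n (K n) (neg_log_depth n (K n)) / of_nat n \<le> ennreal (m n + n * C) / of_nat n"
        by (rule divide_right_mono_ennreal)
      also have "\<dots> = ennreal ((m n + n * C) / n)"
        unfolding ennreal_of_nat_eq_real_of_nat using n m0[OF elim(2)] C by (intro divide_ennreal) auto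
      finally have "ennreal (\<bar>A\<bar> + C) < ennreal ((m n + n * C) / n)" using elim(1) by (rule less_le_trans[rotated])
      then have "\<bar>A\<bar> + C < (m n + n * C) / n" using C by (subst (asm) ennreal_less_iff) auto
      then have "\<bar>A\<bar> * n < m n" using n by (simp add: field_simps)
      moreover have "A * n \<le> \<bar>A\<bar> * n" by (intro mult_right_mono) auto
      ultimately show ?case by linarith
    qed
  qed
  have m_large': "\<forall>\<^sub>F n in sequentially. A + D * n \<le> \<eta> * m n" if \<eta>: "\<eta> > 0" for A D \<eta> :: real
    using m_large[of "(\<bar>A\<bar> + D) / \<eta>"] eventually_ge_at_top[of 1]
  proof eventually_elim
    case (elim n)
    have "A \<le> \<bar>A\<bar> * real n" using elim(2) mult_left_mono[of 1 "real n" "\<bar>A\<bar>"] by simp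
    moreover have "(\<bar>A\<bar> + D) * n \<le> \<eta> * m n" using elim(1) \<eta> by (simp add: field_simps)
    ultimately show ?case by (simp add: algebra_simps)
  qed
  have T_pos: "T n > 0" if "n \<ge> 1" for n
    unfolding T_def by (rule body.mean_cramer_pos[OF B[OF that]])
  have T_le: "\<forall>\<^sub>F n in sequentially. T n \<le> (1 + \<eta>) * m n" if \<eta>: "\<eta> > 0" for \<eta>
    using m_large'[OF \<eta>, of 0 C] eventually_ge_at_top[of 1]
  proof eventually_elim
    case (elim n)
    have "T n \<le> m n + n * C"
      using body.mean_cramer_le[OF B s0, OF elim(2) elim(2)] by (simp only: T_def m_def C_def)
    then show ?case using elim(1) by (simp add: algebra_simps)
  qed
  \<comment> \<open>Four losses of relative size \<open>\<delta>\<close>: the factor \<open>c\<close>, the window, the constant \<open>L\<close> and the exceptional set.\<close>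
  have T_ge: "\<forall>\<^sub>F n in sequentially. (1 - \<eta>) * m n \<le> T n" if \<eta>: "0 < \<eta>" "\<eta> < 1" for \<eta>
  proof -
    define \<delta> where "\<delta> = \<eta> / 4"
    have \<delta>: "0 < \<delta>" "\<delta> < 1" using \<eta> by (auto simp: \<delta>_def)
    define w where "w = window \<delta>"
    define L where "L = ln (exp_tail_const (1 - \<delta>))"
    show ?thesis
      using m_large'[OF \<delta>(1), of L 0] m_large'[OF \<delta>(1), of 0 w] eventually_ge_at_top[of 1]
    proof eventually_elim
      case (elim n)
      note Bn = B[OF elim(3)]
      have M: "m n \<ge> 0" by (rule m0[OF elim(3)])
      have nw: "n * w \<le> \<delta> * m n" using elim(2) by (simp add: mult.commute)
      have "\<delta> * m n \<le> 1 * m n" using \<delta> M by (intro mult_right_mono) auto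
      then have "n * w \<le> m n" using nw by simp
      then have lower: "((1 - \<delta>) * (m n - n * w) - L) * (1 - \<delta>) \<le> T n"
        using body.mean_cramer_ge[OF Bn s0[OF elim(3)] \<delta>, of "1 - \<delta>"] \<delta>
        unfolding w_def m_def T_def L_def by simp
      have "(1 - \<delta>) * (m n - n * w) \<ge> (1 - \<delta>) * ((1 - \<delta>) * m n)"
        using nw \<delta> by (intro mult_left_mono) (auto simp: algebra_simps)
      moreover have "(1 - \<delta>) * ((1 - \<delta>) * m n) \<ge> (1 - 2 * \<delta>) * m n"
        using M mult_nonneg_nonneg[of "\<delta> * \<delta>" "m n"] by (simp add: algebra_simps)
      ultimately have "(1 - 3 * \<delta>) * m n \<le> (1 - \<delta>) * (m n - n * w) - L"
        using elim(1) by (simp add: algebra_simps)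
      then have "(1 - 3 * \<delta>) * m n * (1 - \<delta>) \<le> ((1 - \<delta>) * (m n - n * w) - L) * (1 - \<delta>)"
        using \<delta> by (intro mult_right_mono) auto
      moreover have "(1 - \<eta>) * m n \<le> (1 - 3 * \<delta>) * m n * (1 - \<delta>)"
        using M mult_nonneg_nonneg[of "\<delta> * \<delta>" "m n"] by (simp add: \<delta>_def algebra_simps)
      ultimately show ?case using lower by linarith
    qed
  qed
  \<comment> \<open>Tolerance and failure probability are both \<open>d k\<close>; the offset \<open>2\<close> keeps them strictly below \<open>1\<close>.\<close>
  define d where "d k = 1 / (real k + 2)" for k :: nat
  have d: "0 < d k" "d k < 1" for k by (auto simp: d_def)
  define good where "good k n \<longleftrightarrow> rho1 n (unif n (K n)) (d k) \<ge> ereal ((1 - d k) * T n) \<and>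
      rho2 n (unif n (K n)) (d k) \<le> ereal ((1 + d k) * T n)" for k n
  have main: "\<forall>\<^sub>F n in sequentially. good k n" for k
  proof -
    define e where "e = d k"
    have e: "0 < e" "e < 1" "0 < e / 4" "e / 4 < 1" "0 < e\<^sup>2" using d[of k] by (auto simp: e_def)
    define w where "w = window e"
    show ?thesis
      using T_le[OF e(1)] T_ge[OF e(3,4)] m_large'[OF e(5), of "ln (2 / e)" w] m_large'[OF e(3), of 0 w]
        m_large'[OF zero_less_one, of 0 1] m_large'[OF zero_less_one, of "135 / (e / 6) ^ 3" 0]
        m_large'[OF zero_less_one, of "ln (2 / e)" 0]
        eventually_ge_at_top[of 1]
      unfolding good_def e_def[symmetric]
    proof eventually_elim
      case (elim n)
      note Bn = B[OF elim(8)]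
      have "rho1 n (unif n (K n)) e \<ge> ereal ((1 - e) * T n)"
        unfolding T_def
        by (rule body.rho1_ge[OF Bn s0[OF elim(8)] e(1,2) e(1,2)])
          (use elim(1,3) in \<open>simp_all add: T_def m_def w_def mult.commute\<close>)
      moreover have "rho2 n (unif n (K n)) e \<le> ereal ((1 + e) * T n)"
        unfolding T_def
        by (rule body.rho2_le[OF Bn s0[OF elim(8)] e(1,2) e(1,2)])
          (use elim(2,4-7) in \<open>simp_all add: T_def m_def w_def mult.commute\<close>)
      ultimately show ?case by blast
    qed
  qed
  obtain j where j: "\<forall>k. \<forall>\<^sub>F n in sequentially. k \<le> j n \<and> good (j n) n"
    using diagonal_sequence[of good, OF main] by (rule exE)
  have d_small: "\<exists>k. \<forall>i\<ge>k. d i < e" if pos: "e > 0" for e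
  proof -
    obtain k where k: "1 / real (Suc k) < e" by (rule nat_approx_posE[OF pos])
    have "d i < e" if "i \<ge> k" for i
    proof -
      have "d i \<le> 1 / real (Suc k)" unfolding d_def using that by (intro divide_left_mono) auto
      then show ?thesis using k by simp
    qed
    then show ?thesis by blast
  qed
  have lim: "(\<lambda>n. d (j n)) \<longlonglongrightarrow> 0"
  proof (rule tendstoI)
    fix e :: real assume "e > 0"
    then obtain k where k: "\<And>i. i \<ge> k \<Longrightarrow> d i < e" using d_small by blast
    show "\<forall>\<^sub>F n in sequentially. dist (d (j n)) 0 < e"
      using j[rule_format, of k] by eventually_elim (use k d(1) in \<open>simp add: abs_of_pos\<close>)
  qed
  have thr: "\<exists>n0\<ge>1. \<forall>n\<ge>n0. rho1 n (unif n (K n)) (d (j n)) \<ge> ereal ((1 - e) * T n) \<and>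
      rho2 n (unif n (K n)) (d (j n)) \<le> ereal ((1 + e) * T n)" if e: "0 < e" "e < 1" for e
  proof -
    obtain k where k: "\<And>i. i \<ge> k \<Longrightarrow> d i < e" using d_small[OF e(1)] by blast
    have "\<forall>\<^sub>F n in sequentially. 1 \<le> n \<and> rho1 n (unif n (K n)) (d (j n)) \<ge> ereal ((1 - e) * T n) \<and>
      rho2 n (unif n (K n)) (d (j n)) \<le> ereal ((1 + e) * T n)"
      using j[rule_format, of k] eventually_ge_at_top[of 1]
    proof eventually_elim
      case (elim n)
      have "d (j n) * T n \<le> e * T n"
        using k[of "j n"] elim T_pos[of n] by (intro mult_right_mono) auto
      then have "ereal ((1 - e) * T n) \<le> ereal ((1 - d (j n)) * T n)"
        "ereal ((1 + d (j n)) * T n) \<le> ereal ((1 + e) * T n)" by (simp_all add: algebra_simps)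
      then show ?case using elim unfolding good_def by (meson order_trans)
    qed
    then obtain n0 where "\<And>n. n \<ge> n0 \<Longrightarrow> 1 \<le> n \<and> rho1 n (unif n (K n)) (d (j n)) \<ge> ereal ((1 - e) * T n) \<and>
      rho2 n (unif n (K n)) (d (j n)) \<le> ereal ((1 + e) * T n)" by (auto simp: eventually_sequentially)
    then show ?thesis by (intro exI[of _ n0]) auto
  qed
  have borel: "prob_space (unif n (K n)) \<and> sets (unif n (K n)) = sets (PiM {..<n} (\<lambda>_. borel))" if "n \<ge> 1" for n
  proof -
    interpret body n "K n" by (rule B[OF that])
    have "sets (Rn_lborel n) = sets (PiM {..<n} (\<lambda>_. borel))" by (rule sets_PiM_cong) simp_all
    then show ?thesis using prob_space_axioms by simp
  qed
  show ?thesis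
    unfolding sharp_threshold_def T_def[symmetric]
    using borel T_pos d(1) lim thr by (intro conjI allI impI exI[of _ "\<lambda>n. d (j n)"]) auto
qed

end
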